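(* Let $\mathbb K$ be a commutative semiring with $0\neq 1$ and let $S:\mathrm{NW}(\Delta)\to K$ be a nested word series. Then: (a) $S$ is regular iff $S$ is $\mathrm{sRMSO}(\mathbb K)$-definable iff $S$ is $\mathrm{sREMSO}(\mathbb K)$-definable. (b) If $\mathbb K$ is additively locally finite, then $S$ is regular iff $S$ is $\mathrm{swRMSO}(\mathbb K)$-definable. (c) If $\mathbb K$ is locally finite, then $S$ is regular iff $S$ is $\mathrm{MSO}(\mathbb K)$-definable. (All logics are over the signature of nested words.)
   Context: Nested words. Fix a finite alphabet $\Delta$; $[n]=\{1,\dots,n\}$. A nesting relation of width $n$ is a binary relation $\nu$ on $[n]$ such that: (1) $\nu(i,j)$ implies $i<j$; (2) $\nu(i,j),\nu(i,j')$ imply $j=j'$, and $\nu(i,j),\nu(i',j)$ imply $i=i'$; (3) $\nu(i,j),\nu(i',j')$ and $i<i'$ imply $j<i'$ or $j'<j$. A nested word is a pair $(w,\nu)$ with $w=a_1\cdots a_n\in\Delta^+$ and $\nu$ a nesting relation of width $n$; $\mathrm{NW}(\Delta)$ is the set of nested words. If $\nu(i,j)$, $i$ is a call position and $j$ a return position; all other positions are internal. Automata. $\mathbb K=(K,+,\cdot,0,1)$ is a commutative semiring. A weighted nested word automaton (WNWA) is $\mathcal A=(Q,\iota,\delta_{call},\delta_{int},\delta_{ret},\kappa)$ with $Q$ a finite set, $\delta_{call},\delta_{int}:Q\times\Delta\times Q\to K$, $\delta_{ret}:Q\times Q\times\Delta\times Q\to K$, $\iota,\kappa:Q\to K$. A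 run on $nw=(a_1\cdots a_n,\nu)$ is a state sequence $r=(q_0,\dots,q_n)$; its weight at position $j$ is $\delta_{call}(q_{j-1},a_j,q_j)$ if $j$ is a call position, $\delta_{int}(q_{j-1},a_j,q_j)$ if $j$ is internal, and $\delta_{ret}(q_{j-1},q_{i-1},a_j,q_j)$ if $\nu(i,j)$; $\mathrm{wt}(r)$ is the product of these over $j=1,\dots,n$. The behavior is $\|\mathcal A\|(nw)=\sum_{r=(q_0,\dots,q_n)}\iota(q_0)\,\mathrm{wt}(r)\,\kappa(q_n)$. A function $S:\mathrm{NW}(\Delta)\to K$ (nested word series) is regular if $S=\|\mathcal A\|$ for some WNWA $\mathcal A$. Logic. A nested word $(a_1\cdots a_n,\nu)$ is viewed as the structure with domain $[n]$, unary relations $\mathrm{Lab}_a=\{i:a_i=a\}$ ($a\in\Delta$), the natural order $\le$ and the binary relation $\nu$. Classical MSO formulas: $x=y$, $\mathrm{Lab}_a(x)$, $x\le y$, $\nu(x,y)$, $x\in X$, closed under $\vee,\neg,\exists x,\exists X$ (with the usual abbreviations $\wedge,\to,\leftrightarrow,\forall$, and $x<y:=\neg(y\le x)$). Weighted formulas $\mathrm{MSO}(\mathbb K)$ are given by: $k$ ($k\in K$), the atomic formulas $x=y,\mathrm{Lab}_a(x),x\le y,\nu(x,y),x\in X$ and their negations, and $\varphi\vee\psi$, $\varphi\wedge\psi$, $\exists x.\varphi$, $\exists X.\varphi$, $\forall x.\varphi$, $\forall X.\varphi$. For a structure $s$ and an assignment $\gamma$ of positions to first-order and subsets of the domain to second-order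 variables (defined on a finite set containing the free variables), the semantics $[\![\varphi]\!](s,\gamma)\in K$ is: $[\![k]\!]=k$; an atomic or negated atomic formula has value $1$ if it holds and $0$ otherwise; $\vee\mapsto +$, $\wedge\mapsto\cdot$; $\exists x$ (resp. $\exists X$) is the sum over all positions (resp. all subsets of the domain) of the value with $x$ (resp. $X$) so assigned; $\forall x$, $\forall X$ are the corresponding products. For a sentence $\varphi$, $[\![\varphi]\!]$ is a series $\mathrm{NW}(\Delta)\to K$; a series $S$ is $Z$-definable if $S=[\![\varphi]\!]$ for some sentence $\varphi\in Z$. To each classical formula $\varphi$ assign weighted formulas $\varphi^+,\varphi^-$: for atomic $\varphi$, $\varphi^+=\varphi$, $\varphi^-=\neg\varphi$; $(\neg\psi)^+=\psi^-$, $(\neg\psi)^-=\psi^+$; $(\psi\vee\psi')^+=\psi^+\vee(\psi^-\wedge\psi'^+)$, $(\psi\vee\psi')^-=\psi^-\wedge\psi'^-$; $(\exists x.\psi(x))^+=\exists x.(\psi(x)^+\wedge\forall y.(y<x\wedge\psi(y))^-)$, $(\exists x.\psi)^-=\forall x.\psi^-$; $(\exists X.\psi(X))^+=\exists X.(\psi(X)^+\wedge\forall Y.(Y<X\wedge\psi(Y))^-)$, $(\exists X.\psi)^-=\forall X.\psi^-$, where $Y<X$ is the classical formula $\exists y.(y\in X\wedge\neg y\in Y\wedge\forall z.(z<y\to(z\in X\leftrightarrow z\in Y)))$ (lexicographic order on sets). Formulas of the form $\varphi^+$ or $\varphi^-$ are syntactically unambiguous. $\mathrm{aUMSO}(\mathbb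 K)$ is the smallest set of weighted formulas containing all constants $k$ and all syntactically unambiguous formulas and closed under $\wedge,\vee$; $\mathrm{wUMSO}(\mathbb K)$ is the smallest such set closed additionally under $\exists x$ and $\exists X$. $\mathrm{sRMSO}(\mathbb K)$ consists of weighted formulas in which every subformula $\forall X.\psi$ has $\psi$ syntactically unambiguous and every subformula $\forall x.\psi$ has $\psi\in\mathrm{aUMSO}(\mathbb K)$; $\mathrm{swRMSO}(\mathbb K)$ is defined likewise with $\mathrm{wUMSO}(\mathbb K)$ in place of $\mathrm{aUMSO}(\mathbb K)$. $\mathrm{sRFO}(\mathbb K)$ consists of the $\mathrm{sRMSO}(\mathbb K)$ formulas without second-order quantification, and $\mathrm{sREMSO}(\mathbb K)$ of formulas $\exists X_1.\cdots\exists X_m.\psi$ with $\psi\in\mathrm{sRFO}(\mathbb K)$. $\mathbb K$ is additively locally finite if every finitely generated submonoid of $(K,+,0)$ is finite, and locally finite if every finitely generated subsemiring is finite. *)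

theory Defs
  imports Main
begin

text \<open>A nested word is a pair (w, nu): w a word over the alphabet 'a (a finite type),
  positions are 1..length w, and nu is a set of pairs of positions.\<close>

type_synonym 'a nword = "'a list \<times> (nat \<times> nat) set"

definition nesting_rel :: "nat \<Rightarrow> (nat \<times> nat) set \<Rightarrow> bool" where
  "nesting_rel n \<nu> \<longleftrightarrow>
     \<nu> \<subseteq> {1..n} \<times> {1..n} \<and>
     (\<forall>i j. (i, j) \<in> \<nu> \<longrightarrow> i < j) \<and>
     (\<forall>i j j'. (i, j) \<in> \<nu> \<longrightarrow> (i, j') \<in> \<nu> \<longrightarrow> j = j') \<and>
     (\<forall>i i' j. (i, j) \<in> \<nu> \<longrightarrow> (i', j) \<in> \<nu> \<longrightarrow> i = i') \<and>
     (\<forall>i j i' j'. (i, j) \<in> \<nu> \<longrightarrow> (i', j') \<in> \<nu> \<longrightarrow> i < i' \<longrightarrow> j < i' \<or> j' < j)"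

definition NW :: "'a nword set" where
  "NW = {(w, \<nu>). w \<noteq> [] \<and> nesting_rel (length w) \<nu>}"

record ('a, 'k) wnwa =
  states :: "nat set"
  init :: "nat \<Rightarrow> 'k"
  dcall :: "nat \<Rightarrow> 'a \<Rightarrow> nat \<Rightarrow> 'k"
  dint :: "nat \<Rightarrow> 'a \<Rightarrow> nat \<Rightarrow> 'k"
  dret :: "nat \<Rightarrow> nat \<Rightarrow> 'a \<Rightarrow> nat \<Rightarrow> 'k"
  fin :: "nat \<Rightarrow> 'k"

text \<open>Weight of a run r = [q0,...,qn] at position j (1 \<le> j \<le> n).\<close>

definition step_wt :: "('a, 'k) wnwa \<Rightarrow> 'a nword \<Rightarrow> nat list \<Rightarrow> nat \<Rightarrow> 'k" where
  "step_wt A nw r j =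
     (if (\<exists>k. (j, k) \<in> snd nw) then dcall A (r ! (j - 1)) (fst nw ! (j - 1)) (r ! j)
      else if (\<exists>i. (i, j) \<in> snd nw) then
        dret A (r ! (j - 1)) (r ! ((THE i. (i, j) \<in> snd nw) - 1)) (fst nw ! (j - 1)) (r ! j)
      else dint A (r ! (j - 1)) (fst nw ! (j - 1)) (r ! j))"

definition runs :: "('a, 'k) wnwa \<Rightarrow> 'a nword \<Rightarrow> nat list set" where
  "runs A nw = {r. length r = Suc (length (fst nw)) \<and> set r \<subseteq> states A}"

definition behaviour :: "('a, 'k::comm_semiring_1) wnwa \<Rightarrow> 'a nword \<Rightarrow> 'k" where
  "behaviour A nw =
     (\<Sum>r\<in>runs A nw. init A (r ! 0) * (\<Prod>j\<in>{1..length (fst nw)}. step_wt A nw r j)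
                      * fin A (r ! length (fst nw)))"

definition regular :: "('a nword \<Rightarrow> 'k::comm_semiring_1) \<Rightarrow> bool" where
  "regular S \<longleftrightarrow> (\<exists>A :: ('a, 'k) wnwa. finite (states A) \<and> (\<forall>nw\<in>NW. S nw = behaviour A nw))"

text \<open>First-order variables and second-order variables are both named by natural numbers,
  in separate name spaces.\<close>

datatype 'a atom =
    AEq nat nat
  | ALab 'a nat
  | ALe nat nat
  | ANu nat nat
  | AIn nat nat

datatype 'a cform =
    CAtom "'a atom"
  | CNot "'a cform"
  | COr "'a cform" "'a cform"
  | CEx1 nat "'a cform"
  | CExS nat "'a cform"

datatype ('a, 'k) wform =
    WConst 'k
  | WAtom "'a atom"
  | WNAtom "'a atom"
  | WOr "('a, 'k) wform" "('a, 'k) wform"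
  | WAnd "('a, 'k) wform" "('a, 'k) wform"
  | WEx1 nat "('a, 'k) wform"
  | WExS nat "('a, 'k) wform"
  | WAll1 nat "('a, 'k) wform"
  | WAllS nat "('a, 'k) wform"

definition cand :: "'a cform \<Rightarrow> 'a cform \<Rightarrow> 'a cform" where
  "cand a b = CNot (COr (CNot a) (CNot b))"
definition cimp :: "'a cform \<Rightarrow> 'a cform \<Rightarrow> 'a cform" where
  "cimp a b = COr (CNot a) b"
definition ciff :: "'a cform \<Rightarrow> 'a cform \<Rightarrow> 'a cform" where
  "ciff a b = cand (cimp a b) (cimp b a)"
definition call1 :: "nat \<Rightarrow> 'a cform \<Rightarrow> 'a cform" where
  "call1 x a = CNot (CEx1 x (CNot a))"
definition clt :: "nat \<Rightarrow> nat \<Rightarrow> 'a cform" where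
  "clt x y = CNot (CAtom (ALe y x))"

definition lexless :: "nat \<Rightarrow> nat \<Rightarrow> 'a cform" where
  "lexless Y X = CEx1 0 (cand (CAtom (AIn 0 X))
      (cand (CNot (CAtom (AIn 0 Y)))
        (call1 1 (cimp (clt 1 0) (ciff (CAtom (AIn 1 X)) (CAtom (AIn 1 Y)))))))"

fun avars1 :: "'a atom \<Rightarrow> nat set" where
  "avars1 (AEq x y) = {x, y}"
| "avars1 (ALab a x) = {x}"
| "avars1 (ALe x y) = {x, y}"
| "avars1 (ANu x y) = {x, y}"
| "avars1 (AIn x X) = {x}"

fun avars2 :: "'a atom \<Rightarrow> nat set" where
  "avars2 (AIn x X) = {X}"
| "avars2 _ = {}"

fun vars1 :: "'a cform \<Rightarrow> nat set" where
  "vars1 (CAtom a) = avars1 a"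
| "vars1 (CNot p) = vars1 p"
| "vars1 (COr p q) = vars1 p \<union> vars1 q"
| "vars1 (CEx1 x p) = insert x (vars1 p)"
| "vars1 (CExS X p) = vars1 p"

fun vars2 :: "'a cform \<Rightarrow> nat set" where
  "vars2 (CAtom a) = avars2 a"
| "vars2 (CNot p) = vars2 p"
| "vars2 (COr p q) = vars2 p \<union> vars2 q"
| "vars2 (CEx1 x p) = vars2 p"
| "vars2 (CExS X p) = insert X (vars2 p)"

lemma finite_avars1 [simp]: "finite (avars1 a)" by (cases a) auto
lemma finite_avars2 [simp]: "finite (avars2 a)" by (cases a) auto
lemma finite_vars1 [simp]: "finite (vars1 p)" by (induction p) auto
lemma finite_vars2 [simp]: "finite (vars2 p)" by (induction p) auto

definition fresh1 :: "nat \<Rightarrow> 'a cform \<Rightarrow> nat" where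
  "fresh1 x p = Suc (Max (insert x (vars1 p)))"
definition fresh2 :: "nat \<Rightarrow> 'a cform \<Rightarrow> nat" where
  "fresh2 X p = Suc (Max (insert X (vars2 p)))"

fun aren1 :: "nat \<Rightarrow> nat \<Rightarrow> 'a atom \<Rightarrow> 'a atom" where
  "aren1 x y (AEq u v) = AEq (if u = x then y else u) (if v = x then y else v)"
| "aren1 x y (ALab a u) = ALab a (if u = x then y else u)"
| "aren1 x y (ALe u v) = ALe (if u = x then y else u) (if v = x then y else v)"
| "aren1 x y (ANu u v) = ANu (if u = x then y else u) (if v = x then y else v)"
| "aren1 x y (AIn u U) = AIn (if u = x then y else u) U"

fun aren2 :: "nat \<Rightarrow> nat \<Rightarrow> 'a atom \<Rightarrow> 'a atom" where
  "aren2 X Y (AIn u U) = AIn u (if U = X then Y else U)"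
| "aren2 X Y a = a"

text \<open>Rename the free occurrences of x to y (used only with y not occurring in the formula,
  so no capture occurs): psi(y) from psi(x).\<close>
fun ren1 :: "nat \<Rightarrow> nat \<Rightarrow> 'a cform \<Rightarrow> 'a cform" where
  "ren1 x y (CAtom a) = CAtom (aren1 x y a)"
| "ren1 x y (CNot p) = CNot (ren1 x y p)"
| "ren1 x y (COr p q) = COr (ren1 x y p) (ren1 x y q)"
| "ren1 x y (CEx1 z p) = (if z = x then CEx1 z p else CEx1 z (ren1 x y p))"
| "ren1 x y (CExS Z p) = CExS Z (ren1 x y p)"

fun ren2 :: "nat \<Rightarrow> nat \<Rightarrow> 'a cform \<Rightarrow> 'a cform" where
  "ren2 X Y (CAtom a) = CAtom (aren2 X Y a)"
| "ren2 X Y (CNot p) = CNot (ren2 X Y p)"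
| "ren2 X Y (COr p q) = COr (ren2 X Y p) (ren2 X Y q)"
| "ren2 X Y (CEx1 z p) = CEx1 z (ren2 X Y p)"
| "ren2 X Y (CExS Z p) = (if Z = X then CExS Z p else CExS Z (ren2 X Y p))"

fun cntS :: "'a cform \<Rightarrow> nat" where
  "cntS (CAtom a) = 0"
| "cntS (CNot p) = cntS p"
| "cntS (COr p q) = cntS p + cntS q"
| "cntS (CEx1 x p) = cntS p"
| "cntS (CExS X p) = Suc (cntS p)"

fun cntQ :: "'a cform \<Rightarrow> nat" where
  "cntQ (CAtom a) = 0"
| "cntQ (CNot p) = cntQ p"
| "cntQ (COr p q) = cntQ p + cntQ q"
| "cntQ (CEx1 x p) = Suc (cntQ p)"
| "cntQ (CExS X p) = Suc (cntQ p)"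

lemma cntS_ren1 [simp]: "cntS (ren1 x y p) = cntS p" by (induction p) auto
lemma cntQ_ren1 [simp]: "cntQ (ren1 x y p) = cntQ p" by (induction p) auto
lemma cntS_ren2 [simp]: "cntS (ren2 x y p) = cntS p" by (induction p) auto
lemma cntQ_ren2 [simp]: "cntQ (ren2 x y p) = cntQ p" by (induction p) auto

function pm :: "bool \<Rightarrow> 'a cform \<Rightarrow> ('a, 'k) wform" where
  "pm True (CAtom a) = WAtom a"
| "pm False (CAtom a) = WNAtom a"
| "pm b (CNot p) = pm (\<not> b) p"
| "pm True (COr p q) = WOr (pm True p) (WAnd (pm False p) (pm True q))"
| "pm False (COr p q) = WAnd (pm False p) (pm False q)"
| "pm True (CEx1 x p) =
     WEx1 x (WAnd (pm True p)
       (WAll1 (fresh1 x p) (pm False (cand (clt (fresh1 x p) x) (ren1 x (fresh1 x p) p)))))"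
| "pm False (CEx1 x p) = WAll1 x (pm False p)"
| "pm True (CExS X p) =
     WExS X (WAnd (pm True p)
       (WAllS (fresh2 X p) (pm False (cand (lexless (fresh2 X p) X) (ren2 X (fresh2 X p) p)))))"
| "pm False (CExS X p) = WAllS X (pm False p)"
  by pat_completeness auto
termination
  by (relation "measures [\<lambda>(b, p). cntS p, \<lambda>(b, p). cntQ p, \<lambda>(b, p). size p]")
     (auto simp: cand_def clt_def lexless_def call1_def cimp_def ciff_def)

abbreviation plusF :: "'a cform \<Rightarrow> ('a, 'k) wform" where "plusF p \<equiv> pm True p"
abbreviation minusF :: "'a cform \<Rightarrow> ('a, 'k) wform" where "minusF p \<equiv> pm False p"

fun asem :: "'a atom \<Rightarrow> 'a nword \<Rightarrow> (nat \<Rightarrow> nat) \<Rightarrow> (nat \<Rightarrow> nat set) \<Rightarrow> bool" where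
  "asem (AEq x y) nw s1 s2 = (s1 x = s1 y)"
| "asem (ALab a x) nw s1 s2 = (fst nw ! (s1 x - 1) = a)"
| "asem (ALe x y) nw s1 s2 = (s1 x \<le> s1 y)"
| "asem (ANu x y) nw s1 s2 = ((s1 x, s1 y) \<in> snd nw)"
| "asem (AIn x X) nw s1 s2 = (s1 x \<in> s2 X)"

fun wsem :: "('a, 'k::comm_semiring_1) wform \<Rightarrow> 'a nword \<Rightarrow> (nat \<Rightarrow> nat) \<Rightarrow> (nat \<Rightarrow> nat set) \<Rightarrow> 'k" where
  "wsem (WConst k) nw s1 s2 = k"
| "wsem (WAtom a) nw s1 s2 = (if asem a nw s1 s2 then 1 else 0)"
| "wsem (WNAtom a) nw s1 s2 = (if asem a nw s1 s2 then 0 else 1)"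
| "wsem (WOr p q) nw s1 s2 = wsem p nw s1 s2 + wsem q nw s1 s2"
| "wsem (WAnd p q) nw s1 s2 = wsem p nw s1 s2 * wsem q nw s1 s2"
| "wsem (WEx1 x p) nw s1 s2 = (\<Sum>i\<in>{1..length (fst nw)}. wsem p nw (s1(x := i)) s2)"
| "wsem (WExS X p) nw s1 s2 = (\<Sum>P\<in>Pow {1..length (fst nw)}. wsem p nw s1 (s2(X := P)))"
| "wsem (WAll1 x p) nw s1 s2 = (\<Prod>i\<in>{1..length (fst nw)}. wsem p nw (s1(x := i)) s2)"
| "wsem (WAllS X p) nw s1 s2 = (\<Prod>P\<in>Pow {1..length (fst nw)}. wsem p nw s1 (s2(X := P)))"

fun wfree1 :: "('a, 'k) wform \<Rightarrow> nat set" where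
  "wfree1 (WConst k) = {}"
| "wfree1 (WAtom a) = avars1 a"
| "wfree1 (WNAtom a) = avars1 a"
| "wfree1 (WOr p q) = wfree1 p \<union> wfree1 q"
| "wfree1 (WAnd p q) = wfree1 p \<union> wfree1 q"
| "wfree1 (WEx1 x p) = wfree1 p - {x}"
| "wfree1 (WExS X p) = wfree1 p"
| "wfree1 (WAll1 x p) = wfree1 p - {x}"
| "wfree1 (WAllS X p) = wfree1 p"

fun wfree2 :: "('a, 'k) wform \<Rightarrow> nat set" where
  "wfree2 (WConst k) = {}"
| "wfree2 (WAtom a) = avars2 a"
| "wfree2 (WNAtom a) = avars2 a"
| "wfree2 (WOr p q) = wfree2 p \<union> wfree2 q"
| "wfree2 (WAnd p q) = wfree2 p \<union> wfree2 q"
| "wfree2 (WEx1 x p) = wfree2 p"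
| "wfree2 (WExS X p) = wfree2 p - {X}"
| "wfree2 (WAll1 x p) = wfree2 p"
| "wfree2 (WAllS X p) = wfree2 p - {X}"

definition sentence :: "('a, 'k) wform \<Rightarrow> bool" where
  "sentence p \<longleftrightarrow> wfree1 p = {} \<and> wfree2 p = {}"

text \<open>S is Z-definable: S = [[phi]] on all nested words for some sentence phi in Z
  (the assignment is irrelevant for sentences).\<close>
definition definable :: "(('a, 'k::comm_semiring_1) wform \<Rightarrow> bool) \<Rightarrow> ('a nword \<Rightarrow> 'k) \<Rightarrow> bool" where
  "definable Z S \<longleftrightarrow>
     (\<exists>p. Z p \<and> sentence p \<and> (\<forall>nw\<in>NW. S nw = wsem p nw (\<lambda>_. 0) (\<lambda>_. {})))"

definition synt_unamb :: "('a, 'k) wform \<Rightarrow> bool" where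
  "synt_unamb p \<longleftrightarrow> (\<exists>q :: 'a cform. p = plusF q \<or> p = minusF q)"

inductive aUMSO :: "('a, 'k) wform \<Rightarrow> bool" where
  "aUMSO (WConst k)"
| "synt_unamb p \<Longrightarrow> aUMSO p"
| "aUMSO p \<Longrightarrow> aUMSO q \<Longrightarrow> aUMSO (WAnd p q)"
| "aUMSO p \<Longrightarrow> aUMSO q \<Longrightarrow> aUMSO (WOr p q)"

inductive wUMSO :: "('a, 'k) wform \<Rightarrow> bool" where
  "wUMSO (WConst k)"
| "synt_unamb p \<Longrightarrow> wUMSO p"
| "wUMSO p \<Longrightarrow> wUMSO q \<Longrightarrow> wUMSO (WAnd p q)"
| "wUMSO p \<Longrightarrow> wUMSO q \<Longrightarrow> wUMSO (WOr p q)"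
| "wUMSO p \<Longrightarrow> wUMSO (WEx1 x p)"
| "wUMSO p \<Longrightarrow> wUMSO (WExS X p)"

fun restr :: "(('a, 'k) wform \<Rightarrow> bool) \<Rightarrow> ('a, 'k) wform \<Rightarrow> bool" where
  "restr U (WConst k) = True"
| "restr U (WAtom a) = True"
| "restr U (WNAtom a) = True"
| "restr U (WOr p q) = (restr U p \<and> restr U q)"
| "restr U (WAnd p q) = (restr U p \<and> restr U q)"
| "restr U (WEx1 x p) = restr U p"
| "restr U (WExS X p) = restr U p"
| "restr U (WAll1 x p) = (U p \<and> restr U p)"
| "restr U (WAllS X p) = (synt_unamb p \<and> restr U p)"

definition sRMSO :: "('a, 'k) wform \<Rightarrow> bool" where
  "sRMSO p \<longleftrightarrow> restr aUMSO p"

definition swRMSO :: "('a, 'k) wform \<Rightarrow> bool" where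
  "swRMSO p \<longleftrightarrow> restr wUMSO p"

fun no_SO :: "('a, 'k) wform \<Rightarrow> bool" where
  "no_SO (WOr p q) = (no_SO p \<and> no_SO q)"
| "no_SO (WAnd p q) = (no_SO p \<and> no_SO q)"
| "no_SO (WEx1 x p) = no_SO p"
| "no_SO (WAll1 x p) = no_SO p"
| "no_SO (WExS X p) = False"
| "no_SO (WAllS X p) = False"
| "no_SO _ = True"

definition sRFO :: "('a, 'k) wform \<Rightarrow> bool" where
  "sRFO p \<longleftrightarrow> sRMSO p \<and> no_SO p"

inductive sREMSO :: "('a, 'k) wform \<Rightarrow> bool" where
  "sRFO p \<Longrightarrow> sREMSO p"
| "sREMSO p \<Longrightarrow> sREMSO (WExS X p)"

definition MSO :: "('a, 'k) wform \<Rightarrow> bool" where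
  "MSO p \<longleftrightarrow> True"

inductive_set add_submonoid_gen :: "'k::comm_semiring_1 set \<Rightarrow> 'k set" for A where
  "a \<in> A \<Longrightarrow> a \<in> add_submonoid_gen A"
| "0 \<in> add_submonoid_gen A"
| "a \<in> add_submonoid_gen A \<Longrightarrow> b \<in> add_submonoid_gen A \<Longrightarrow> a + b \<in> add_submonoid_gen A"

inductive_set subsemiring_gen :: "'k::comm_semiring_1 set \<Rightarrow> 'k set" for A where
  "a \<in> A \<Longrightarrow> a \<in> subsemiring_gen A"
| "0 \<in> subsemiring_gen A"
| "1 \<in> subsemiring_gen A"
| "a \<in> subsemiring_gen A \<Longrightarrow> b \<in> subsemiring_gen A \<Longrightarrow> a + b \<in> subsemiring_gen A"
| "a \<in> subsemiring_gen A \<Longrightarrow> b \<in> subsemiring_gen A \<Longrightarrow> a * b \<in> subsemiring_gen A"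

definition add_locally_finite :: "'k::comm_semiring_1 itself \<Rightarrow> bool" where
  "add_locally_finite _ \<longleftrightarrow> (\<forall>A :: 'k set. finite A \<longrightarrow> finite (add_submonoid_gen A))"

definition locally_finite :: "'k::comm_semiring_1 itself \<Rightarrow> bool" where
  "locally_finite _ \<longleftrightarrow> (\<forall>A :: 'k set. finite A \<longrightarrow> finite (subsemiring_gen A))"

end

theory Submission
  imports Defs "HOL-Library.FuncSet"
begin

text \<open>
  All calls of a nested word are matched, so it is the linearization of a tree, a nested word automaton is
  evaluated by recursion over trees, and a deterministic one is a finite algebra. The central
  observation is that, for a function recognized by a finite algebra, the numbers of labellings of a word
  that give each value are again computed by a finite algebra, once they are taken modulo a congruence of
  finite index on the naturals. Choosing the congruence suitably, this yields closure under existential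
  quantification in the Boolean case, closure under sums if the semiring is additively locally finite,
  and closure under products if it is locally finite.

  Over an arbitrary semiring, series of automata are closed under sums, products and relabelling. A product
  \<open>\<forall>x. \<phi>\<close> with a recognizable step function \<open>\<phi>\<close> is handled by guessing the value of \<open>\<phi>\<close> at every
  position; the set of words with a correct guess is recognizable, and the automaton multiplies
  the guessed values. Conversely, a run of an automaton is a partition of the positions into sets \<open>X\<^sub>q\<close>,
  which a first-order formula checks, while its weight is the value of a formula \<open>\<forall>x. \<phi>\<close>.
\<close>

section \<open>Nested words as trees\<close>

text \<open>A product over positions or sets can be controlled only if its body takes finitely many
  values and a deterministic device decides which. Passing from a tree to its labellings destroys
  determinism, and counting restores it: the counts for a compound tree are linear or bilinear in
  the counts for its parts, so they may be reduced modulo any congruence of the semiring of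
  naturals. Three congruences occur: \<open>n\<close> and \<open>m\<close> are identified if both or
  neither are positive, if \<open>n * y = m * y\<close> for every attained value \<open>y\<close>,
  or if \<open>y ^ n = y ^ m\<close> for every such \<open>y\<close>. The hypotheses on the semiring
  serve to give the last two finite index. In the converse direction the obstacle is the state
  before the first position: no position carries it, so no set variable can hold it. The formula of
  a run therefore sums over this state outside the universal quantifier, where all positions see the
  same choice.\<close>

datatype 'c nest = Emp | Snoc "'c nest" 'c | Wrap "'c nest" 'c "'c nest" 'c

fun lin :: "'c nest \<Rightarrow> 'c list" where
  "lin Emp = []"
| "lin (Snoc f a) = lin f @ [a]"
| "lin (Wrap f a g b) = lin f @ a # lin g @ [b]"

fun edges :: "'c nest \<Rightarrow> ('c \<times> 'c) set" where
  "edges Emp = {}"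
| "edges (Snoc f a) = edges f"
| "edges (Wrap f a g b) = insert (a, b) (edges f \<union> edges g)"

lemma set_lin [simp]: "set (lin f) = set_nest f"
  by (induction f) auto

lemma lin_map_nest [simp]: "lin (map_nest h f) = map h (lin f)"
  by (induction f) auto

lemma edges_map_nest: "edges (map_nest h f) = map_prod h h ` edges f"
  by (induction f) auto

lemma edges_subset: "edges f \<subseteq> set_nest f \<times> set_nest f"
  by (induction f) auto

text \<open>The conditions of \<open>nesting_rel\<close> other than the bound on the positions. They
  pass to subrelations, whereas the interval of positions changes whenever a word is split.\<close>

definition noncrossing :: "(nat \<times> nat) set \<Rightarrow> bool" where
  "noncrossing \<nu> \<longleftrightarrow>
     (\<forall>i j. (i, j) \<in> \<nu> \<longrightarrow> i < j) \<and>
     (\<forall>i j j'. (i, j) \<in> \<nu> \<longrightarrow> (i, j') \<in> \<nu> \<longrightarrow> j = j') \<and>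
     (\<forall>i i' j. (i, j) \<in> \<nu> \<longrightarrow> (i', j) \<in> \<nu> \<longrightarrow> i = i') \<and>
     (\<forall>i j i' j'. (i, j) \<in> \<nu> \<longrightarrow> (i', j') \<in> \<nu> \<longrightarrow> i < i' \<longrightarrow> j < i' \<or> j' < j)"

lemma noncrossing_subset: "noncrossing \<nu> \<Longrightarrow> \<nu>' \<subseteq> \<nu> \<Longrightarrow> noncrossing \<nu>'"
  unfolding noncrossing_def by (elim conjE; intro conjI allI impI; blast)

text \<open>Induction on the length of the interval, peeling off its last position \<open>l\<close>.
  If \<open>l\<close> closes an edge from \<open>i\<close>, an edge starting before \<open>i\<close>
  can end neither between \<open>i\<close> and \<open>l\<close> nor beyond \<open>l\<close>, so the
  other edges split into those left of \<open>i\<close> and those strictly inside.\<close>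

lemma noncrossing_parse:
  assumes "\<nu> \<subseteq> {m..<k} \<times> {m..<k}" "noncrossing \<nu>"
  shows "\<exists>f. lin f = [m..<k] \<and> edges f = \<nu>"
  using assms
proof (induction "k - m" arbitrary: m k \<nu> rule: less_induct)
  case less
  note nc = less.prems(2)[unfolded noncrossing_def]
  have lt: "i < j" if "(i, j) \<in> \<nu>" for i j using that nc by blast
  show ?case
  proof (cases "m < k")
    case False
    then have "\<nu> = {}" using less.prems(1) by auto
    then show ?thesis using False by (intro exI[of _ Emp]) auto
  next
    case True
    then obtain l where k: "k = Suc l" and ml: "m \<le> l" by (cases k) auto
    show ?thesis
    proof (cases "\<exists>i. (i, l) \<in> \<nu>")
      case True
      then obtain i where il: "(i, l) \<in> \<nu>" by blast
      have i: "m \<le> i" "i < l" using il less.prems(1) lt by auto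
      define \<nu>1 \<nu>2 where "\<nu>1 = \<nu> \<inter> {m..<i} \<times> {m..<i}" and "\<nu>2 = \<nu> \<inter> {Suc i..<l} \<times> {Suc i..<l}"
      have "\<exists>f. lin f = [m..<i] \<and> edges f = \<nu>1"
      proof (rule less.hyps)
        show "noncrossing \<nu>1" using noncrossing_subset[OF less.prems(2)] by (simp add: \<nu>1_def)
      qed (use i k in \<open>auto simp: \<nu>1_def\<close>)
      then obtain f where f: "lin f = [m..<i]" "edges f = \<nu>1" by blast
      have "\<exists>f. lin f = [Suc i..<l] \<and> edges f = \<nu>2"
      proof (rule less.hyps)
        show "noncrossing \<nu>2" using noncrossing_subset[OF less.prems(2)] by (simp add: \<nu>2_def)
      qed (use i k in \<open>auto simp: \<nu>2_def\<close>)
      then obtain g where g: "lin g = [Suc i..<l]" "edges g = \<nu>2" by blast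
      have "\<nu> = insert (i, l) (\<nu>1 \<union> \<nu>2)"
      proof (intro set_eqI iffI)
        fix e assume e: "e \<in> \<nu>"
        obtain u v where uv: "e = (u, v)" by force
        have b: "m \<le> u" "u < v" "v \<le> l" "m \<le> v" using e uv less.prems(1) lt k by auto
        show "e \<in> insert (i, l) (\<nu>1 \<union> \<nu>2)"
        proof (cases u i rule: linorder_cases)
          case less
          then have "v < i \<or> l < v" using e il uv nc by blast
          then show ?thesis using e uv b less by (auto simp: \<nu>1_def)
        next
          case equal
          then show ?thesis using e il uv nc by blast
        next
          case greater
          then have "l < u \<or> v < l" using e il uv nc by blast
          then show ?thesis using e uv b greater by (auto simp: \<nu>2_def)
        qed
      qed (use il in \<open>auto simp: \<nu>1_def \<nu>2_def\<close>)
      moreover have "[m..<k] = [m..<i] @ i # [Suc i..<l] @ [l]"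
        using i ml k upt_add_eq_append[of m i "l - i"] by (simp add: upt_conv_Cons[symmetric])
      ultimately show ?thesis
        by (intro exI[of _ "Wrap f i g l"]) (simp add: f g Un_commute)
    next
      case False
      \<comment> \<open>\<open>l\<close> closes no edge by the case assumption, and opens none
        because edges run to the right and \<open>l\<close> is the last position.\<close>
      have "\<nu> \<subseteq> {m..<l} \<times> {m..<l}"
      proof
        fix e assume e: "e \<in> \<nu>"
        obtain u v where uv: "e = (u, v)" by force
        have "u \<in> {m..<Suc l}" "v \<in> {m..<Suc l}" "u < v" "v \<noteq> l"
          using e uv less.prems(1) lt k False by auto
        then show "e \<in> {m..<l} \<times> {m..<l}" using uv by auto
      qed
      then have "\<exists>f. lin f = [m..<l] \<and> edges f = \<nu>"
        using k ml less.prems(2) by (intro less.hyps) simp_all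
      then obtain f where "lin f = [m..<l]" "edges f = \<nu>" by blast
      then show ?thesis using k ml by (intro exI[of _ "Snoc f l"]) simp
    qed
  qed
qed

lemma NW_parse:
  assumes "(w, \<nu>) \<in> NW"
  obtains f where "lin f = [1..<Suc (length w)]" "edges f = \<nu>"
proof -
  have nr: "nesting_rel (length w) \<nu>" using assms by (simp add: NW_def)
  have "\<nu> \<subseteq> {1..<Suc (length w)} \<times> {1..<Suc (length w)}"
    using nr unfolding nesting_rel_def atLeastLessThanSuc_atLeastAtMost by (rule conjunct1)
  moreover have "noncrossing \<nu>"
    using nr unfolding nesting_rel_def noncrossing_def by (rule conjunct2)
  ultimately have "\<exists>f. lin f = [1..<Suc (length w)] \<and> edges f = \<nu>" by (rule noncrossing_parse)
  then show thesis using that by blast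
qed

section \<open>Labellings of trees\<close>

fun labs :: "'l set \<Rightarrow> 'c nest \<Rightarrow> ('c \<times> 'l) nest set" where
  "labs B Emp = {Emp}"
| "labs B (Snoc f a) = (\<lambda>(v, l). Snoc v (a, l)) ` (labs B f \<times> B)"
| "labs B (Wrap f a g b) =
     (\<lambda>(v, l, u, l'). Wrap v (a, l) u (b, l')) ` (labs B f \<times> B \<times> labs B g \<times> B)"

lemma finite_labs [simp]: "finite B \<Longrightarrow> finite (labs B f)"
  by (induction f) auto

text \<open>The recursive form of \<open>labs\<close> is chosen for this equation and the next: a
  sum over labellings unfolds along the tree in the same way as the evaluation of an
  automaton.\<close>

lemma sum_labs_Snoc:
  "sum F (labs B (Snoc f a)) = (\<Sum>v\<in>labs B f. \<Sum>l\<in>B. F (Snoc v (a, l)))"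
  by (simp add: sum.cartesian_product)
    (subst sum.reindex, auto simp: inj_on_def case_prod_unfold)

lemma sum_labs_Wrap:
  "sum F (labs B (Wrap f a g b)) =
     (\<Sum>v\<in>labs B f. \<Sum>l\<in>B. \<Sum>u\<in>labs B g. \<Sum>l'\<in>B. F (Wrap v (a, l) u (b, l')))"
  by (simp add: sum.cartesian_product)
    (subst sum.reindex, auto simp: inj_on_def case_prod_unfold)

lemma in_labs_iff: "v \<in> labs B f \<longleftrightarrow> map_nest fst v = f \<and> snd ` set_nest v \<subseteq> B"
proof (induction f arbitrary: v)
  case Emp
  then show ?case by (cases v) auto
next
  case (Snoc f a)
  then show ?case by (cases v) (force simp: image_iff)+
next
  case (Wrap f a g b)
  then show ?case by (cases v) (force simp: image_iff)+
qed

lemma map_nest_fst_snd_eq: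
  "map_nest fst v = map_nest fst u \<Longrightarrow> map_nest snd v = map_nest snd u \<Longrightarrow> v = u"
proof (induction v arbitrary: u)
  case Emp
  then show ?case by (cases u) auto
next
  case (Snoc f a)
  then show ?case by (cases u) (auto simp: prod_eq_iff)
next
  case (Wrap f a g b)
  then show ?case by (cases u) (auto simp: prod_eq_iff)
qed

lemma labs_map_nest: "labs B (map_nest c f) = map_nest (map_prod c id) ` labs B f"
proof (induction f)
  case (Snoc f a)
  show ?case
    unfolding nest.map labs.simps Snoc by (fastforce simp: image_iff)
next
  case (Wrap f a g b)
  show ?case
    unfolding nest.map labs.simps Wrap
  proof (intro equalityI subsetI)
    fix x assume "x \<in> (\<lambda>(v, l, u, l'). Wrap v (c a, l) u (c b, l')) `
      (map_nest (map_prod c id) ` labs B f \<times> B \<times> map_nest (map_prod c id) ` labs B g \<times> B)"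
    then obtain v l u l' where "v \<in> labs B f" "u \<in> labs B g" "l \<in> B" "l' \<in> B"
      "x = map_nest (map_prod c id) (Wrap v (a, l) u (b, l'))" by auto
    then show "x \<in> map_nest (map_prod c id) ` (\<lambda>(v, l, u, l'). Wrap v (a, l) u (b, l')) ` (labs B f \<times> B \<times> labs B g \<times> B)"
      by (intro image_eqI[of _ _ "Wrap v (a, l) u (b, l')"] image_eqI[of _ _ "(v, l, u, l')"]) auto
  next
    fix x assume "x \<in> map_nest (map_prod c id) ` (\<lambda>(v, l, u, l'). Wrap v (a, l) u (b, l')) ` (labs B f \<times> B \<times> labs B g \<times> B)"
    then obtain v l u l' where "v \<in> labs B f" "u \<in> labs B g" "l \<in> B" "l' \<in> B"
      "x = map_nest (map_prod c id) (Wrap v (a, l) u (b, l'))" by auto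
    then show "x \<in> (\<lambda>(v, l, u, l'). Wrap v (c a, l) u (c b, l')) `
      (map_nest (map_prod c id) ` labs B f \<times> B \<times> map_nest (map_prod c id) ` labs B g \<times> B)"
      by (intro image_eqI[of _ _ "(map_nest (map_prod c id) v, l, map_nest (map_prod c id) u, l')"]) auto
  qed
qed simp_all

text \<open>A word is the image \<open>map_nest c f\<close> of the tree \<open>f\<close> of its
  positions. Letters may repeat but positions do not, so labellings are analysed on \<open>f\<close>
  and transported to the word.\<close>

lemma bij_betw_labs_map_nest:
  "bij_betw (map_nest (map_prod c id)) (labs B f) (labs B (map_nest c f))"
  unfolding bij_betw_def labs_map_nest
proof (intro conjI inj_onI refl)
  fix v u assume "v \<in> labs B f" "u \<in> labs B f"
    and eq: "map_nest (map_prod c id) v = map_nest (map_prod c id) u"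
  then have "map_nest fst v = map_nest fst u" by (simp add: in_labs_iff)
  moreover have "map_nest snd v = map_nest snd u"
    using arg_cong[OF eq, of "map_nest snd"] by (simp add: nest.map_comp o_def)
  ultimately show "v = u" by (rule map_nest_fst_snd_eq)
qed

text \<open>With distinct entries in \<open>f\<close>, the list \<open>lin v\<close> is the graph of
  a function, which \<open>map_of\<close> recovers.\<close>

lemma labs_obtain_fun:
  assumes "v \<in> labs B f" "distinct (lin f)"
  obtains L where "v = map_nest (\<lambda>j. (j, L j)) f" "\<And>j. j \<in> set_nest f \<Longrightarrow> L j \<in> B"
proof
  let ?L = "\<lambda>j. the (map_of (lin v) j)"
  have f: "f = map_nest fst v" and B: "snd ` set_nest v \<subseteq> B" using assms(1) by (auto simp: in_labs_iff)
  have d: "distinct (map fst (lin v))" using assms(2) f by simp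
  have L: "?L (fst e) = snd e" if "e \<in> set_nest v" for e
    using that map_of_eq_Some_iff[OF d, of "fst e" "snd e"] by simp
  have "map_nest (\<lambda>j. (j, ?L j)) f = map_nest id v"
    unfolding f nest.map_comp by (intro nest.map_cong) (auto simp: L)
  then show "v = map_nest (\<lambda>j. (j, ?L j)) f" by (simp add: nest.map_id)
  show "?L j \<in> B" if "j \<in> set_nest f" for j
    using that B L by (auto simp: f nest.set_map)
qed

lemma map_nest_inj_on_set: "map_nest h f = map_nest h' f \<Longrightarrow> j \<in> set_nest f \<Longrightarrow> h j = h' j"
  by (induction f) auto

text \<open>Sets of positions are Boolean labellings. This turns a set quantifier into an operation
  over \<open>labs UNIV\<close>.\<close>

lemma bij_betw_Pow_labs:
  fixes f :: "'a nest"
  assumes "distinct (lin f)"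
  shows "bij_betw (\<lambda>P. map_nest (\<lambda>j. (c j, j \<in> P)) f) (Pow (set_nest f)) (labs UNIV (map_nest c f))"
proof -
  have "bij_betw (\<lambda>P. map_nest (\<lambda>j. (j, j \<in> P)) f) (Pow (set_nest f)) (labs UNIV f)"
  proof (rule bij_betw_imageI)
    show "inj_on (\<lambda>P. map_nest (\<lambda>j. (j, j \<in> P)) f) (Pow (set_nest f))"
      by (rule inj_onI) (auto dest: map_nest_inj_on_set)
    show "(\<lambda>P. map_nest (\<lambda>j. (j, j \<in> P)) f) ` Pow (set_nest f) = labs UNIV f"
    proof (intro equalityI subsetI)
      fix v :: "('a \<times> bool) nest" assume "v \<in> labs UNIV f"
      then obtain L where "v = map_nest (\<lambda>j. (j, L j)) f" using labs_obtain_fun[OF _ assms] by metis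
      then have "v = map_nest (\<lambda>j. (j, j \<in> {j \<in> set_nest f. L j})) f"
        by (auto intro: nest.map_cong)
      then show "v \<in> (\<lambda>P. map_nest (\<lambda>j. (j, j \<in> P)) f) ` Pow (set_nest f)" by blast
    qed (auto simp: in_labs_iff nest.map_comp o_def nest.map_ident)
  qed
  from bij_betw_trans[OF this bij_betw_labs_map_nest[of c]]
  show ?thesis by (simp add: nest.map_comp o_def)
qed

section \<open>Recognizable functions on trees\<close>

text \<open>The inner tree of a \<open>Wrap\<close> is evaluated from scratch, independently of its
  context; \<open>call\<close> is what is remembered of the part before it. Finiteness of the call
  values is required separately because the alphabet may be infinite, as it will be for
  formulas.\<close>

definition recognizes ::
  "('c nest \<Rightarrow> nat) \<Rightarrow> (nat \<Rightarrow> 'c \<Rightarrow> nat) \<Rightarrow> (nat \<Rightarrow> 'c \<Rightarrow> nat) \<Rightarrow> (nat \<Rightarrow> nat \<Rightarrow> 'c \<Rightarrow> nat) \<Rightarrow>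
    (nat \<Rightarrow> 'v) \<Rightarrow> ('c nest \<Rightarrow> 'v) \<Rightarrow> bool" where
  "recognizes \<phi> istep call ret out T \<longleftrightarrow>
     finite (range \<phi>) \<and> finite (range (\<lambda>(f, a). call (\<phi> f) a)) \<and>
     (\<forall>f a. \<phi> (Snoc f a) = istep (\<phi> f) a) \<and>
     (\<forall>f a g b. \<phi> (Wrap f a g b) = ret (call (\<phi> f) a) (\<phi> g) b) \<and>
     (\<forall>f. T f = out (\<phi> f))"

lemma recognizesD:
  assumes "recognizes \<phi> istep call ret out T"
  shows "finite (range \<phi>)" "finite (range (\<lambda>(f, a). call (\<phi> f) a))"
    "\<phi> (Snoc f a) = istep (\<phi> f) a"
    "\<phi> (Wrap f a g b) = ret (call (\<phi> f) a) (\<phi> g) b"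
    "T f = out (\<phi> f)"
  using assms unfolding recognizes_def by blast+

definition recog :: "('c nest \<Rightarrow> 'v) \<Rightarrow> bool" where
  "recog T \<longleftrightarrow> (\<exists>\<phi> istep call ret out. recognizes \<phi> istep call ret out T)"

text \<open>A criterion in the style of Myhill and Nerode: two compatible invariants of finite range
  suffice, since the operations can be recovered by evaluating at representatives. Coding by
  naturals removes the types \<open>'s\<close> and \<open>'t\<close>, over which
  \<open>recog\<close> could not quantify.\<close>

lemma recogI:
  fixes \<phi> :: "'c nest \<Rightarrow> 's" and \<psi> :: "'c nest \<Rightarrow> 'c \<Rightarrow> 't"
  assumes fin: "finite (range \<phi>)" "finite (range (\<lambda>(f, a). \<psi> f a))"
    and istep: "\<And>f f' a. \<phi> f = \<phi> f' \<Longrightarrow> \<phi> (Snoc f a) = \<phi> (Snoc f' a)"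
    and call: "\<And>f f' a. \<phi> f = \<phi> f' \<Longrightarrow> \<psi> f a = \<psi> f' a"
    and ret: "\<And>f f' a a' g g' b. \<psi> f a = \<psi> f' a' \<Longrightarrow> \<phi> g = \<phi> g' \<Longrightarrow>
      \<phi> (Wrap f a g b) = \<phi> (Wrap f' a' g' b)"
    and out: "\<And>f f'. \<phi> f = \<phi> f' \<Longrightarrow> T f = T f'"
  shows "recog T"
proof -
  obtain i :: "'s \<Rightarrow> nat" where i: "inj_on i (range \<phi>)"
    using finite_imp_inj_to_nat_seg[OF fin(1)] by blast
  obtain j :: "'t \<Rightarrow> nat" where j: "inj_on j (range (\<lambda>(f, a). \<psi> f a))"
    using finite_imp_inj_to_nat_seg[OF fin(2)] by blast
  define \<Phi> where "\<Phi> f = i (\<phi> f)" for f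
  define rep where "rep n = (SOME f. \<Phi> f = n)" for n
  have rep: "\<phi> (rep (\<Phi> f)) = \<phi> f" for f
  proof -
    have "\<Phi> (rep (\<Phi> f)) = \<Phi> f" unfolding rep_def by (rule someI) (rule refl)
    then show ?thesis by (simp add: \<Phi>_def inj_on_eq_iff[OF i])
  qed
  define \<Psi> where "\<Psi> n a = j (\<psi> (rep n) a)" for n a
  have \<Psi>: "\<Psi> (\<Phi> f) a = j (\<psi> f a)" for f a
    using call[OF rep] by (simp add: \<Psi>_def)
  \<comment> \<open>A call value is represented by a tree together with the opening letter, since
    \<open>\<psi>\<close> depends on both.\<close>
  define repc where "repc m = (SOME fa. j (\<psi> (fst fa) (snd fa)) = m)" for m
  have repc: "\<psi> (fst (repc (j (\<psi> f a)))) (snd (repc (j (\<psi> f a)))) = \<psi> f a" for f a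
  proof -
    have "j (\<psi> (fst (repc (j (\<psi> f a)))) (snd (repc (j (\<psi> f a))))) = j (\<psi> f a)"
      unfolding repc_def by (rule someI[of _ "(f, a)"]) simp
    moreover have "\<psi> x y \<in> range (\<lambda>(f, a). \<psi> f a)" for x y
      by (rule range_eqI[of _ _ "(x, y)"]) simp
    ultimately show ?thesis by (simp add: inj_on_eq_iff[OF j])
  qed
  have "finite (range \<Phi>)"
    using finite_imageI[OF fin(1), of i] by (simp add: \<Phi>_def[abs_def] image_image)
  moreover have "finite (range (\<lambda>(f, a). \<Psi> (\<Phi> f) a))"
    using finite_imageI[OF fin(2), of j] by (simp add: \<Psi> image_image case_prod_unfold)
  moreover have "\<Phi> (Snoc f a) = \<Phi> (Snoc (rep (\<Phi> f)) a)" for f a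
    using istep[OF rep] by (simp add: \<Phi>_def)
  moreover have "\<Phi> (Wrap f a g b) =
      \<Phi> (Wrap (fst (repc (\<Psi> (\<Phi> f) a))) (snd (repc (\<Psi> (\<Phi> f) a))) (rep (\<Phi> g)) b)" for f a g b
    using ret[OF repc rep, of f a g b] by (simp add: \<Phi>_def[of "Wrap _ _ _ _"] \<Psi>)
  moreover have "T f = T (rep (\<Phi> f))" for f
    using out[OF rep] by simp
  ultimately show ?thesis
    unfolding recog_def recognizes_def
    by (intro exI[of _ \<Phi>] exI[of _ \<Psi>] exI[of _ "\<lambda>n a. \<Phi> (Snoc (rep n) a)"]
        exI[of _ "\<lambda>m n b. \<Phi> (Wrap (fst (repc m)) (snd (repc m)) (rep n) b)"]
        exI[of _ "\<lambda>n. T (rep n)"] conjI allI) assumption+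
qed

lemma finite_range_recog:
  assumes "recog T"
  shows "finite (range T)"
proof -
  obtain \<phi> istep call ret out where T: "recognizes \<phi> istep call ret out T"
    using assms unfolding recog_def by blast
  show ?thesis
    using finite_imageI[OF recognizesD(1)[OF T], of out] by (simp add: image_image recognizesD(5)[OF T])
qed

lemma recog_const: "recog (\<lambda>_. c)"
  by (rule recogI[of "\<lambda>_. ()" "\<lambda>_ _. ()"]) auto

lemma recog_comp:
  assumes "recog T"
  shows "recog (\<lambda>f. F (T f))"
proof -
  obtain \<phi> istep call ret out where T: "recognizes \<phi> istep call ret out T"
    using assms unfolding recog_def by blast
  note T = recognizesD[OF T]
  show ?thesis
    by (rule recogI[of \<phi> "\<lambda>f a. call (\<phi> f) a"]) (simp_all add: T)
qed

lemma recog_Pair: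
  assumes "recog T" "recog U"
  shows "recog (\<lambda>f. (T f, U f))"
proof -
  obtain \<phi> istep call ret out where T: "recognizes \<phi> istep call ret out T"
    using assms(1) unfolding recog_def by blast
  note T = recognizesD[OF T]
  obtain \<phi>' istep' call' ret' out' where U: "recognizes \<phi>' istep' call' ret' out' U"
    using assms(2) unfolding recog_def by blast
  note U = recognizesD[OF U]
  show ?thesis
  proof (rule recogI[of "\<lambda>f. (\<phi> f, \<phi>' f)" "\<lambda>f a. (call (\<phi> f) a, call' (\<phi>' f) a)"])
    show "finite (range (\<lambda>f. (\<phi> f, \<phi>' f)))"
      by (rule finite_subset[OF _ finite_cartesian_product[OF T(1) U(1)]]) auto
    have "call (\<phi> f) a \<in> range (\<lambda>(f, a). call (\<phi> f) a)"
      "call' (\<phi>' f) a \<in> range (\<lambda>(f, a). call' (\<phi>' f) a)" for f a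
      by (rule range_eqI[of _ _ "(f, a)"]; simp)+
    then show "finite (range (\<lambda>(f, a). (call (\<phi> f) a, call' (\<phi>' f) a)))"
      by (intro finite_subset[OF _ finite_cartesian_product[OF T(2) U(2)]]) auto
  qed (simp_all add: T(3-5) U(3-5))
qed

lemma recog_comp2:
  assumes "recog T" "recog U"
  shows "recog (\<lambda>f. F (T f) (U f))"
  using recog_comp[OF recog_Pair[OF assms], of "case_prod F"] by simp

lemma recog_map_nest:
  assumes "recog T"
  shows "recog (\<lambda>f. T (map_nest h f))"
proof -
  obtain \<phi> istep call ret out where T: "recognizes \<phi> istep call ret out T"
    using assms unfolding recog_def by blast
  note T = recognizesD[OF T]
  show ?thesis
  proof (rule recogI[of "\<lambda>f. \<phi> (map_nest h f)" "\<lambda>f a. call (\<phi> (map_nest h f)) (h a)"])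
    show "finite (range (\<lambda>f. \<phi> (map_nest h f)))"
      by (rule finite_subset[OF _ T(1)]) auto
    have "call (\<phi> (map_nest h f)) (h a) \<in> range (\<lambda>(f, a). call (\<phi> f) a)" for f a
      by (rule range_eqI[of _ _ "(map_nest h f, h a)"]) simp
    then show "finite (range (\<lambda>(f, a). call (\<phi> (map_nest h f)) (h a)))"
      by (intro finite_subset[OF _ T(2)]) auto
  qed (simp_all add: T(3-5))
qed

lemma recog_ball:
  assumes "finite Y" "\<And>y. y \<in> Y \<Longrightarrow> recog (P y)"
  shows "recog (\<lambda>f. \<forall>y\<in>Y. P y f)"
  using assms
proof (induction Y rule: finite_induct)
  case (insert y Y)
  then show ?case using recog_comp2[of "P y" "\<lambda>f. \<forall>y\<in>Y. P y f" "(\<and>)"] by simp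
qed (simp add: recog_const)

text \<open>A tree is mapped to the transformation of states that its linearization induces, because
  the value of an inner tree must not depend on the state in which it is entered. Over a finite
  \<open>'s\<close> there are finitely many transformations.\<close>

lemma recog_foldl:
  fixes d :: "'s::finite \<Rightarrow> 'c \<Rightarrow> 's"
  shows "recog (\<lambda>f. foldl d q (lin f))"
proof (rule recogI[of "\<lambda>f q. foldl d q (lin f)" "\<lambda>f a q. d (foldl d q (lin f)) a"])
qed (auto simp: fun_eq_iff)

lemma recog_Bex: "recog (\<lambda>f. \<exists>c\<in>set_nest f. P c)"
proof -
  have "foldl (\<lambda>s c. s \<or> P c) b xs \<longleftrightarrow> b \<or> (\<exists>c\<in>set xs. P c)" for b xs
    by (induction xs arbitrary: b) auto
  from recog_foldl[of "\<lambda>s c. s \<or> P c" False] this show ?thesis by simp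
qed

section \<open>Counting labellings modulo a congruence on the naturals\<close>

locale counting_key =
  fixes \<kappa> :: "nat \<Rightarrow> 'z"
  assumes finite_range: "finite (range \<kappa>)"
    and add: "\<kappa> a = \<kappa> a' \<Longrightarrow> \<kappa> b = \<kappa> b' \<Longrightarrow> \<kappa> (a + b) = \<kappa> (a' + b')"
    and mult: "\<kappa> a = \<kappa> a' \<Longrightarrow> \<kappa> b = \<kappa> b' \<Longrightarrow> \<kappa> (a * b) = \<kappa> (a' * b')"
begin

lemma sum: "(\<And>i. i \<in> I \<Longrightarrow> \<kappa> (x i) = \<kappa> (y i)) \<Longrightarrow> \<kappa> (sum x I) = \<kappa> (sum y I)"
  by (induction I rule: infinite_finite_induct) (auto intro: add)

text \<open>The counts for \<open>Snoc\<close> are linear and those for \<open>Wrap\<close> bilinear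
  in the counts for the parts, with natural coefficients that depend only on the letters. Hence the
  classes of the counts under \<open>\<kappa>\<close> again form an algebra.\<close>

lemma recog_count:
  assumes T: "recog T" and B: "finite B"
  shows "recog (\<lambda>f y. \<kappa> (card {v \<in> labs B f. T v = y}))"
proof -
  obtain \<phi> istep call ret out where rec: "recognizes \<phi> istep call ret out T"
    using T unfolding recog_def by blast
  note fin = recognizesD(1,2)[OF rec] and i = recognizesD(3)[OF rec]
    and r = recognizesD(4)[OF rec] and o = recognizesD(5)[OF rec]
  define H where "H = range \<phi>"
  define K where "K = range (\<lambda>(f, a). call (\<phi> f) a)"
  have finHK: "finite H" "finite K" using fin by (simp_all add: H_def K_def)
  have \<phi>H: "\<phi> v \<in> H" for v by (simp add: H_def)
  have callK: "call (\<phi> v) a \<in> K" for v a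
    unfolding K_def by (rule range_eqI[of _ _ "(v, a)"]) simp
  define N where "N f s = card {v \<in> labs B f. \<phi> v = s}" for f s
  \<comment> \<open>\<open>N\<close> counts the labellings of a tree by their value.
    \<open>M\<close> labels an opening letter as well and counts by the call value; it is what
    survives until the matching return.\<close>
  define M where "M f a k = (\<Sum>v\<in>labs B f. \<Sum>l\<in>B. of_bool (call (\<phi> v) (a, l) = k) :: nat)" for f a k
  have N_sum: "N f s = (\<Sum>v\<in>labs B f. of_bool (\<phi> v = s))" for f s
    using B by (simp add: N_def Int_def)
  have group: "(\<Sum>v\<in>labs B f. G (\<phi> v)) = (\<Sum>s\<in>H. N f s * G s)" for f and G :: "nat \<Rightarrow> nat"
    using sum_fun_comp[of "labs B f" H \<phi> G] B finHK \<phi>H by (auto simp: N_def)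
  have NS: "N (Snoc f a) s = (\<Sum>h\<in>H. N f h * (\<Sum>l\<in>B. of_bool (istep h (a, l) = s)))" for f a s
    unfolding N_sum[of "Snoc f a"] sum_labs_Snoc i
    by (rule group[of "\<lambda>h. \<Sum>l\<in>B. of_bool (istep h (a, l) = s)"])
  have M: "M f a k = (\<Sum>h\<in>H. N f h * (\<Sum>l\<in>B. of_bool (call h (a, l) = k)))" for f a k
    unfolding M_def by (rule group[of "\<lambda>h. \<Sum>l\<in>B. of_bool (call h (a, l) = k)"])
  have groupM: "(\<Sum>v\<in>labs B f. \<Sum>l\<in>B. G (call (\<phi> v) (a, l))) = (\<Sum>k\<in>K. M f a k * G k)"
    for f a and G :: "nat \<Rightarrow> nat"
  proof -
    have "G (call (\<phi> v) (a, l)) = (\<Sum>k\<in>K. of_bool (call (\<phi> v) (a, l) = k) * G k)" for v l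
      using finHK callK[of v] by (subst sum.remove[of _ "call (\<phi> v) (a, l)"]) (auto intro!: sum.neutral)
    then show ?thesis
      unfolding M_def sum_distrib_right
      by (subst (3) sum.swap, subst (2) sum.swap) simp
  qed
  have NW: "N (Wrap f a g b) s =
      (\<Sum>k\<in>K. M f a k * (\<Sum>h\<in>H. N g h * (\<Sum>l\<in>B. of_bool (ret k h (b, l) = s))))" for f a g b s
    unfolding N_sum[of "Wrap f a g b"] sum_labs_Wrap r
    using groupM[where G = "\<lambda>k. \<Sum>u\<in>labs B g. \<Sum>l\<in>B. of_bool (ret k (\<phi> u) (b, l) = s)"]
      group[where G = "\<lambda>h. \<Sum>l\<in>B. of_bool (ret k h (b, l) = s)" for k] by simp
  \<comment> \<open>Off the finite sets \<open>H\<close> and \<open>K\<close> all counts vanish, so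
    the families of classes have the fixed value \<open>\<kappa> 0\<close> there and only finitely
    many families exist.\<close>
  have N0: "N f s = 0" if "s \<notin> H" for f s
    using that \<phi>H by (auto simp: N_def intro: card_eq_0_iff[THEN iffD2])
  have M0: "M f a k = 0" if "k \<notin> K" for f a k
    using that callK by (fastforce simp: M_def intro!: sum.neutral)
  have eqD: "\<kappa> (N f s) = \<kappa> (N f' s)" if "(\<lambda>s. \<kappa> (N f s)) = (\<lambda>s. \<kappa> (N f' s))" for f f' s
    using fun_cong[OF that] .
  show ?thesis
  proof (rule recogI[of "\<lambda>f s. \<kappa> (N f s)" "\<lambda>f a k. \<kappa> (M f a k)"])
    show "finite (range (\<lambda>f s. \<kappa> (N f s)))"
      by (rule finite_subset[OF _ finite_set_of_finite_funs[OF finHK(1) finite_range, of "\<kappa> 0"]])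
        (auto simp: N0)
    show "finite (range (\<lambda>(f, a) k. \<kappa> (M f a k)))"
      by (rule finite_subset[OF _ finite_set_of_finite_funs[OF finHK(2) finite_range, of "\<kappa> 0"]])
        (auto simp: M0)
    show "(\<lambda>s. \<kappa> (N (Snoc f a) s)) = (\<lambda>s. \<kappa> (N (Snoc f' a) s))"
      if "(\<lambda>s. \<kappa> (N f s)) = (\<lambda>s. \<kappa> (N f' s))" for f f' a
      unfolding NS by (intro ext sum mult refl eqD[OF that])
    show "(\<lambda>s. \<kappa> (M f a s)) = (\<lambda>s. \<kappa> (M f' a s))"
      if "(\<lambda>s. \<kappa> (N f s)) = (\<lambda>s. \<kappa> (N f' s))" for f f' a
      unfolding M by (intro ext sum mult refl eqD[OF that])
    show "(\<lambda>s. \<kappa> (N (Wrap f a g b) s)) = (\<lambda>s. \<kappa> (N (Wrap f' a' g' b) s))"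
      if "(\<lambda>k. \<kappa> (M f a k)) = (\<lambda>k. \<kappa> (M f' a' k))" "(\<lambda>s. \<kappa> (N g s)) = (\<lambda>s. \<kappa> (N g' s))"
      for f f' a a' g g' b
      unfolding NW by (intro ext sum mult refl eqD[OF that(2)] fun_cong[OF that(1)])
    show "(\<lambda>y. \<kappa> (card {v \<in> labs B f. T v = y})) = (\<lambda>y. \<kappa> (card {v \<in> labs B f'. T v = y}))"
      if "(\<lambda>s. \<kappa> (N f s)) = (\<lambda>s. \<kappa> (N f' s))" for f f'
    proof -
      have "card {v \<in> labs B f. T v = y} = (\<Sum>s\<in>H. N f s * of_bool (out s = y))" for f y
        using group[of "\<lambda>s. of_bool (out s = y)" f] B by (simp add: o Int_def)
      then show ?thesis by (simp only:) (intro ext sum mult refl eqD[OF that])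
    qed
  qed
qed

end

text \<open>Keeping only whether a count is positive leaves the set of values that labellings
  attain: this is the subset construction.\<close>

lemma recog_ex_labs:
  assumes "recog P" "finite B"
  shows "recog (\<lambda>f. \<exists>v\<in>labs B f. P v)"
proof -
  interpret counting_key "\<lambda>n::nat. 0 < n"
    by unfold_locales auto
  have "recog (\<lambda>f. (\<lambda>y. 0 < card {v \<in> labs B f. P v = y}) True)"
    by (rule recog_comp[OF recog_count[OF assms]])
  moreover have "0 < card {v \<in> labs B f. P v = True} \<longleftrightarrow> (\<exists>v\<in>labs B f. P v)" for f
    using assms(2) by (auto simp: card_gt_0_iff)
  ultimately show ?thesis by simp
qed

lemma of_nat_mult_in_add_submonoid_gen: "of_nat n * y \<in> add_submonoid_gen {y}"
  by (induction n) (simp_all add: distrib_right add_submonoid_gen.intros)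

lemma power_in_subsemiring_gen: "y ^ n \<in> subsemiring_gen {y}"
  by (induction n) (simp_all add: subsemiring_gen.intros)

text \<open>Labellings with the same value \<open>y\<close> are collected into a multiple of
  \<open>y\<close>. Only these multiples matter, and for each of the finitely many \<open>y\<close>
  they lie in the finite monoid generated by \<open>y\<close>.\<close>

lemma recog_sum_labs:
  fixes T :: "('c \<times> 'l) nest \<Rightarrow> 'k::comm_semiring_1"
  assumes T: "recog T" and B: "finite B" and lf: "add_locally_finite TYPE('k)"
  shows "recog (\<lambda>f. \<Sum>v\<in>labs B f. T v)"
proof -
  define Y where "Y = range T"
  have Y: "finite Y" using finite_range_recog[OF T] by (simp add: Y_def)
  define \<kappa> where "\<kappa> n y = (if y \<in> Y then of_nat n * y else 0)" for n y
  have fm: "finite (add_submonoid_gen {y})" for y :: 'k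
    using lf by (simp add: add_locally_finite_def)
  interpret counting_key \<kappa>
  proof
    have "finite (\<Union>y\<in>Y. add_submonoid_gen {y})" using Y fm by simp
    note finite_set_of_finite_funs[OF Y this, of 0]
    moreover have "range \<kappa> \<subseteq> {f. \<forall>x. (x \<in> Y \<longrightarrow> f x \<in> (\<Union>y\<in>Y. add_submonoid_gen {y})) \<and> (x \<notin> Y \<longrightarrow> f x = 0)}"
      using of_nat_mult_in_add_submonoid_gen by (fastforce simp: \<kappa>_def)
    ultimately show "finite (range \<kappa>)" by (rule rev_finite_subset)
    show "\<kappa> (a + b) = \<kappa> (a' + b')" if "\<kappa> a = \<kappa> a'" "\<kappa> b = \<kappa> b'" for a a' b b'
      using that by (auto simp: \<kappa>_def fun_eq_iff distrib_right) metis
    show "\<kappa> (a * b) = \<kappa> (a' * b')" if "\<kappa> a = \<kappa> a'" "\<kappa> b = \<kappa> b'" for a a' b b'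
    proof
      fix y
      have "of_nat (a * b) * y = of_nat (a' * b') * y" if y: "y \<in> Y"
      proof -
        have e: "of_nat a * y = of_nat a' * y" "of_nat b * y = of_nat b' * y"
          using y \<open>\<kappa> a = \<kappa> a'\<close> \<open>\<kappa> b = \<kappa> b'\<close> by (auto simp: \<kappa>_def fun_eq_iff split: if_splits)
        \<comment> \<open>Equality is known only after multiplication with \<open>y\<close>, so each
          factor has to stand next to \<open>y\<close> when it is exchanged.\<close>
        have "of_nat (a * b) * y = of_nat b * (of_nat a * y)" by (simp add: ac_simps)
        also have "\<dots> = of_nat b * (of_nat a' * y)" by (simp only: e(1))
        also have "\<dots> = of_nat a' * (of_nat b * y)" by (simp add: ac_simps)
        also have "\<dots> = of_nat a' * (of_nat b' * y)" by (simp only: e(2))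
        also have "\<dots> = of_nat (a' * b') * y" by (simp add: ac_simps)
        finally show ?thesis .
      qed
      then show "\<kappa> (a * b) y = \<kappa> (a' * b') y" by (simp add: \<kappa>_def)
    qed
  qed
  have "(\<Sum>v\<in>labs B f. T v) = (\<Sum>y\<in>Y. \<kappa> (card {v \<in> labs B f. T v = y}) y)" for f
    using sum_fun_comp[of "labs B f" Y T "\<lambda>y. y"] B Y by (auto simp: Y_def \<kappa>_def)
  moreover have "recog (\<lambda>f. (\<lambda>N. \<Sum>y\<in>Y. N y y) (\<lambda>y. \<kappa> (card {v \<in> labs B f. T v = y})))"
    by (rule recog_comp[OF recog_count[OF T B]])
  ultimately show ?thesis by simp
qed

text \<open>The multiplicative counterpart: labellings with value \<open>y\<close> contribute a
  power of \<open>y\<close>, and the powers of \<open>y\<close> stay in a finite subsemiring. The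
  law \<open>y ^ (a * b) = (y ^ a) ^ b\<close> makes equality of powers compatible with products of
  exponents.\<close>

lemma recog_prod_labs:
  fixes T :: "('c \<times> 'l) nest \<Rightarrow> 'k::comm_semiring_1"
  assumes T: "recog T" and B: "finite B" and lf: "locally_finite TYPE('k)"
  shows "recog (\<lambda>f. \<Prod>v\<in>labs B f. T v)"
proof -
  define Y where "Y = range T"
  have Y: "finite Y" using finite_range_recog[OF T] by (simp add: Y_def)
  define \<kappa> where "\<kappa> n y = (if y \<in> Y then y ^ n else 1)" for n y
  have fm: "finite (subsemiring_gen {y})" for y :: 'k
    using lf by (simp add: locally_finite_def)
  interpret counting_key \<kappa>
  proof
    have "finite (\<Union>y\<in>Y. subsemiring_gen {y})" using Y fm by simp
    note finite_set_of_finite_funs[OF Y this, of 1]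
    moreover have "range \<kappa> \<subseteq> {f. \<forall>x. (x \<in> Y \<longrightarrow> f x \<in> (\<Union>y\<in>Y. subsemiring_gen {y})) \<and> (x \<notin> Y \<longrightarrow> f x = 1)}"
      using power_in_subsemiring_gen by (fastforce simp: \<kappa>_def)
    ultimately show "finite (range \<kappa>)" by (rule rev_finite_subset)
    show "\<kappa> (a + b) = \<kappa> (a' + b')" if "\<kappa> a = \<kappa> a'" "\<kappa> b = \<kappa> b'" for a a' b b'
      using that by (auto simp: \<kappa>_def fun_eq_iff power_add) metis
    show "\<kappa> (a * b) = \<kappa> (a' * b')" if "\<kappa> a = \<kappa> a'" "\<kappa> b = \<kappa> b'" for a a' b b'
    proof
      fix y
      have "y ^ (a * b) = y ^ (a' * b')" if y: "y \<in> Y"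
      proof -
        have e: "y ^ a = y ^ a'" "y ^ b = y ^ b'"
          using y \<open>\<kappa> a = \<kappa> a'\<close> \<open>\<kappa> b = \<kappa> b'\<close> by (auto simp: \<kappa>_def fun_eq_iff split: if_splits)
        have "y ^ (a * b) = (y ^ b) ^ a'"
          by (metis e(1) power_mult mult.commute)
        then show ?thesis by (metis e(2) power_mult mult.commute)
      qed
      then show "\<kappa> (a * b) y = \<kappa> (a' * b') y" by (simp add: \<kappa>_def)
    qed
  qed
  have "(\<Prod>v\<in>labs B f. T v) = (\<Prod>y\<in>Y. \<kappa> (card {v \<in> labs B f. T v = y}) y)" for f
  proof -
    have "(\<Prod>v\<in>labs B f. T v) = (\<Prod>y\<in>Y. \<Prod>v\<in>{v \<in> labs B f. T v = y}. T v)"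
      by (rule prod.group[symmetric]) (use B Y in \<open>auto simp: Y_def\<close>)
    then show ?thesis by (simp add: \<kappa>_def)
  qed
  moreover have "recog (\<lambda>f. (\<lambda>N. \<Prod>y\<in>Y. N y y) (\<lambda>y. \<kappa> (card {v \<in> labs B f. T v = y})))"
    by (rule recog_comp[OF recog_count[OF T B]])
  ultimately show ?thesis by simp
qed

lemma add_locally_finite_if_locally_finite:
  assumes "locally_finite TYPE('k::comm_semiring_1)"
  shows "add_locally_finite TYPE('k)"
  unfolding add_locally_finite_def
proof (intro allI impI)
  fix A :: "'k set" assume "finite A"
  then have "finite (subsemiring_gen A)" using assms by (simp add: locally_finite_def)
  moreover have "x \<in> subsemiring_gen A" if "x \<in> add_submonoid_gen A" for x
    using that by induction (simp_all add: subsemiring_gen.intros)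
  ultimately show "finite (add_submonoid_gen A)" by (blast intro: finite_subset)
qed

section \<open>Weighted automata on trees\<close>

lemma sum_eq_single:
  assumes "finite A" "c \<in> A" "\<And>x. x \<in> A \<Longrightarrow> x \<noteq> c \<Longrightarrow> F x = 0"
  shows "sum F A = F c"
  using assms by (subst sum.remove[of _ c]) (auto intro!: sum.neutral)

lemma sum_Times: "sum F (A \<times> B) = (\<Sum>a\<in>A. \<Sum>b\<in>B. F (a, b))"
  by (simp add: sum.cartesian_product)

text \<open>The entry at \<open>p\<close> and \<open>q\<close> is the total weight of the runs from
  \<open>p\<close> to \<open>q\<close>. In a \<open>Wrap\<close> the return transition receives the
  state \<open>t\<close> at the end of the inner run and, in addition, the state \<open>r\<close>
  before the call.\<close>

fun mat :: "'s set \<Rightarrow> ('s \<Rightarrow> 'c \<Rightarrow> 's \<Rightarrow> 'k) \<Rightarrow> ('s \<Rightarrow> 'c \<Rightarrow> 's \<Rightarrow> 'k) \<Rightarrow> ('s \<Rightarrow> 's \<Rightarrow> 'c \<Rightarrow> 's \<Rightarrow> 'k) \<Rightarrow>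
    'c nest \<Rightarrow> 's \<Rightarrow> 's \<Rightarrow> 'k::comm_semiring_1" where
  "mat Q dc di dr Emp p q = of_bool (p = q)"
| "mat Q dc di dr (Snoc f a) p q = (\<Sum>r\<in>Q. mat Q dc di dr f p r * di r a q)"
| "mat Q dc di dr (Wrap f a g b) p q =
     (\<Sum>r\<in>Q. \<Sum>s\<in>Q. \<Sum>t\<in>Q. mat Q dc di dr f p r * dc r a s * mat Q dc di dr g s t * dr t r b q)"

definition nest_behaviour where
  "nest_behaviour Q \<iota> dc di dr \<kappa> f = (\<Sum>p\<in>Q. \<Sum>q\<in>Q. \<iota> p * mat Q dc di dr f p q * \<kappa> q)"

definition reg :: "('c nest \<Rightarrow> 'k::comm_semiring_1) \<Rightarrow> bool" where
  "reg T \<longleftrightarrow> (\<exists>A :: ('c, 'k) wnwa. finite (states A) \<and>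
     (\<forall>f. T f = nest_behaviour (states A) (init A) (dcall A) (dint A) (dret A) (fin A) f))"

lemma regI:
  fixes Q :: "'s set"
  assumes Q: "finite Q" and T: "\<And>f. T f = nest_behaviour Q \<iota> dc di dr \<kappa> f"
  shows "reg T"
proof -
  obtain g :: "'s \<Rightarrow> nat" where g: "inj_on g Q"
    using finite_imp_inj_to_nat_seg[OF Q] by blast
  define h where "h = inv_into Q g"
  have h: "r \<in> Q \<Longrightarrow> h (g r) = r" for r using g by (simp add: h_def)
  let ?dc = "\<lambda>x a y. dc (h x) a (h y)" and ?di = "\<lambda>x a y. di (h x) a (h y)"
    and ?dr = "\<lambda>x y a z. dr (h x) (h y) a (h z)"
  have m: "mat (g ` Q) ?dc ?di ?dr f (g p) (g q) = mat Q dc di dr f p q"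
    if "p \<in> Q" "q \<in> Q" for f p q
    using that
  proof (induction f arbitrary: p q)
    case Emp
    then show ?case using inj_on_eq_iff[OF g] by simp
  next
    case (Snoc f a)
    then show ?case by (simp add: sum.reindex[OF g] h)
  next
    case (Wrap f a f' b)
    then show ?case by (simp add: sum.reindex[OF g] h)
  qed
  define A where "A = \<lparr>states = g ` Q, init = \<lambda>x. \<iota> (h x), dcall = ?dc, dint = ?di, dret = ?dr,
    fin = \<lambda>x. \<kappa> (h x)\<rparr>"
  have "T f = nest_behaviour (states A) (init A) (dcall A) (dint A) (dret A) (fin A) f" for f
    by (simp add: A_def T nest_behaviour_def sum.reindex[OF g] h m)
  moreover have "finite (states A)" using Q by (simp add: A_def)
  ultimately show ?thesis unfolding reg_def by blast
qed

section \<open>Closure properties of series of automata\<close>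

lemma reg_add:
  assumes "reg T" "reg U"
  shows "reg (\<lambda>f. T f + U f)"
proof -
  obtain Q \<iota> dc di dr \<kappa> where Q: "finite (Q :: nat set)" and T: "\<And>f. T f = nest_behaviour Q \<iota> dc di dr \<kappa> f"
    using assms(1) unfolding reg_def by blast
  obtain Q' \<iota>' dc' di' dr' \<kappa>' where Q': "finite (Q' :: nat set)"
    and U: "\<And>f. U f = nest_behaviour Q' \<iota>' dc' di' dr' \<kappa>' f"
    using assms(2) unfolding reg_def by blast
  define d where "d F F' x a y = (case (x, y) of (Inl r, Inl s) \<Rightarrow> F r a s | (Inr r, Inr s) \<Rightarrow> F' r a s | _ \<Rightarrow> 0)"
    for F F' :: "nat \<Rightarrow> 'a \<Rightarrow> nat \<Rightarrow> 'b" and x y a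
  define d2 where "d2 x y a z = (case (x, y, z) of (Inl t, Inl r, Inl s) \<Rightarrow> dr t r a s
    | (Inr t, Inr r, Inr s) \<Rightarrow> dr' t r a s | _ \<Rightarrow> 0)" for x y a z
  let ?M = "mat (Q <+> Q') (d dc dc') (d di di') d2"
  note S = sum.Plus[OF Q Q']
  have m: "?M f (Inl p) (Inl q) = mat Q dc di dr f p q \<and> ?M f (Inr p) (Inr q) = mat Q' dc' di' dr' f p q \<and>
      ?M f (Inl p) (Inr q) = 0 \<and> ?M f (Inr p) (Inl q) = 0" for f p q
    by (induction f arbitrary: p q) (simp_all add: S d_def d2_def)
  show ?thesis
  proof (rule regI[of "Q <+> Q'"])
    show "T f + U f = nest_behaviour (Q <+> Q') (case_sum \<iota> \<iota>') (d dc dc') (d di di') d2 (case_sum \<kappa> \<kappa>') f" for f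
      by (simp add: T U nest_behaviour_def S m)
  qed (use Q Q' in simp)
qed

text \<open>In the product automaton the weights of the two factors alternate along a run;
  commutativity separates them again.\<close>

lemma reg_mult:
  assumes "reg T" "reg U"
  shows "reg (\<lambda>f. T f * U f)"
proof -
  obtain Q \<iota> dc di dr \<kappa> where Q: "finite (Q :: nat set)" and T: "\<And>f. T f = nest_behaviour Q \<iota> dc di dr \<kappa> f"
    using assms(1) unfolding reg_def by blast
  obtain Q' \<iota>' dc' di' dr' \<kappa>' where Q': "finite (Q' :: nat set)"
    and U: "\<And>f. U f = nest_behaviour Q' \<iota>' dc' di' dr' \<kappa>' f"
    using assms(2) unfolding reg_def by blast
  define d where "d F F' x a y = F (fst x) a (fst y) * F' (snd x) a (snd y)"
    for F F' :: "nat \<Rightarrow> 'a \<Rightarrow> nat \<Rightarrow> 'b" and x y a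
  define d2 where "d2 x y a z = dr (fst x) (fst y) a (fst z) * dr' (snd x) (snd y) a (snd z)" for x y a z
  have S: "sum F (Q \<times> Q') = (\<Sum>r\<in>Q. \<Sum>r'\<in>Q'. F (r, r'))" for F :: "_ \<Rightarrow> 'b"
    by (simp add: sum.cartesian_product)
  have m: "mat (Q \<times> Q') (d dc dc') (d di di') d2 f (p, p') (q, q') =
      mat Q dc di dr f p q * mat Q' dc' di' dr' f p' q'" for f p q p' q'
  proof (induction f arbitrary: p p' q q')
    case (Snoc f a)
    show ?case unfolding mat.simps S Snoc sum_product
      by (intro sum.cong refl) (simp add: d_def ac_simps)
  next
    case (Wrap f a g b)
    show ?case unfolding mat.simps S Wrap sum_product
      by (intro sum.cong refl) (simp add: d_def d2_def ac_simps)
  qed simp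
  show ?thesis
  proof (rule regI[of "Q \<times> Q'"])
    show "T f * U f = nest_behaviour (Q \<times> Q') (\<lambda>x. \<iota> (fst x) * \<iota>' (snd x)) (d dc dc') (d di di') d2
      (\<lambda>x. \<kappa> (fst x) * \<kappa>' (snd x)) f" for f
      unfolding T U nest_behaviour_def S m sum_product
      by (intro sum.cong refl) (simp add: ac_simps)
  qed (use Q Q' in simp)
qed

text \<open>The automaton guesses the labels: each transition weight is summed over them, and
  distributivity expands the product of these sums into a sum over labellings.\<close>

lemma reg_sum_labs:
  assumes "reg T" and B: "finite B"
  shows "reg (\<lambda>f. \<Sum>v\<in>labs B f. T v)"
proof -
  obtain Q \<iota> dc di dr \<kappa> where Q: "finite (Q :: nat set)" and T: "\<And>f. T f = nest_behaviour Q \<iota> dc di dr \<kappa> f"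
    using assms(1) unfolding reg_def by blast
  let ?dc = "\<lambda>r a s. \<Sum>l\<in>B. dc r (a, l) s" and ?di = "\<lambda>r a s. \<Sum>l\<in>B. di r (a, l) s"
    and ?dr = "\<lambda>t r a s. \<Sum>l\<in>B. dr t r (a, l) s"
  have four: "sum m V * sum d L * sum m' U * sum e K =
      (\<Sum>v\<in>V. \<Sum>l\<in>L. \<Sum>u\<in>U. \<Sum>k\<in>K. m v * d l * m' u * e k)"
    for m :: "'v \<Rightarrow> 'c" and d :: "'l \<Rightarrow> 'c" and m' :: "'u \<Rightarrow> 'c" and e :: "'m \<Rightarrow> 'c" and V L U K
    by (simp only: mult.assoc sum_distrib_right) (simp only: sum_distrib_left)
  have m: "mat Q ?dc ?di ?dr f p q = (\<Sum>v\<in>labs B f. mat Q dc di dr v p q)" for f p q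
  proof (induction f arbitrary: p q)
    case (Snoc f a)
    have "(\<Sum>r\<in>Q. (\<Sum>v\<in>labs B f. mat Q dc di dr v p r) * (\<Sum>l\<in>B. di r (a, l) q)) =
        (\<Sum>r\<in>Q. \<Sum>x\<in>labs B f \<times> B. mat Q dc di dr (fst x) p r * di r (a, snd x) q)"
      by (simp only: sum_product sum_Times fst_conv snd_conv)
    also have "\<dots> = (\<Sum>x\<in>labs B f \<times> B. \<Sum>r\<in>Q. mat Q dc di dr (fst x) p r * di r (a, snd x) q)"
      by (rule sum.swap)
    finally show ?case
      by (simp only: sum_labs_Snoc mat.simps Snoc sum_Times fst_conv snd_conv)
  next
    case (Wrap f a g b)
    \<comment> \<open>With three state sums and four label sums packed into tuples, a single
      exchange of summation takes the place of twelve.\<close>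
    let ?F = "\<lambda>x y. mat Q dc di dr (fst x) p (fst y) * dc (fst y) (a, fst (snd x)) (fst (snd y)) *
      mat Q dc di dr (fst (snd (snd x))) (fst (snd y)) (snd (snd y)) *
      dr (snd (snd y)) (fst y) (b, snd (snd (snd x))) q"
    have "mat Q ?dc ?di ?dr (Wrap f a g b) p q =
        (\<Sum>y\<in>Q \<times> Q \<times> Q. \<Sum>x\<in>labs B f \<times> B \<times> labs B g \<times> B. ?F x y)"
      by (simp only: mat.simps Wrap four sum_Times fst_conv snd_conv)
    also have "\<dots> = (\<Sum>x\<in>labs B f \<times> B \<times> labs B g \<times> B. \<Sum>y\<in>Q \<times> Q \<times> Q. ?F x y)"
      by (rule sum.swap)
    also have "\<dots> = (\<Sum>v\<in>labs B (Wrap f a g b). mat Q dc di dr v p q)"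
      by (simp only: sum_labs_Wrap mat.simps sum_Times fst_conv snd_conv)
    finally show ?case .
  qed simp
  show ?thesis
  proof (rule regI[OF Q])
    show "(\<Sum>v\<in>labs B f. T v) = nest_behaviour Q \<iota> ?dc ?di ?dr \<kappa> f" for f
      unfolding T nest_behaviour_def m
      by (subst sum.swap, intro sum.cong refl, subst sum.swap)
        (simp add: sum_distrib_left sum_distrib_right)
  qed
qed

text \<open>A return transition is given the state before the call but not the letter of the call.
  Therefore the call value travels through the inner tree in the first component of the state, with
  \<open>None\<close> at the top level; at the return the outer first component is restored from the
  state before the call.\<close>

lemma reg_if_recog:
  fixes T :: "'c nest \<Rightarrow> 'k::comm_semiring_1"
  assumes "recog T"
  shows "reg T"
proof -
  obtain \<phi> istep call ret out where T: "recognizes \<phi> istep call ret out T"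
    using assms unfolding recog_def by blast
  note T = recognizesD[OF T]
  define e where "e = \<phi> Emp"
  define Q where "Q = insert None (Some ` range (\<lambda>(f, a). call (\<phi> f) a)) \<times> range \<phi>"
  have Q: "finite Q" using T(1,2) by (simp add: Q_def)
  define dc where "dc r a s = (of_bool (s = (Some (call (snd r) a), e)) :: 'k)"
    for r s :: "nat option \<times> nat" and a
  define di where "di r a s = (of_bool (s = (fst r, istep (snd r) a)) :: 'k)"
    for r s :: "nat option \<times> nat" and a
  define dr where "dr t r b s = (of_bool (s = (fst r, ret (the (fst t)) (snd t) b)) :: 'k)"
    for t r s :: "nat option \<times> nat" and b
  have Qx: "(x, \<phi> f) \<in> Q" if "(x, e) \<in> Q" for x f
    using that by (simp add: Q_def)
  have Qc: "(Some (call (\<phi> f) a), e) \<in> Q" for f a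
  proof -
    have "call (\<phi> f) a \<in> range (\<lambda>(f, a). call (\<phi> f) a)"
      by (rule range_eqI[of _ _ "(f, a)"]) simp
    then show ?thesis by (simp add: Q_def e_def)
  qed
  \<comment> \<open>Only rows starting in \<open>e\<close> are described: every tree, inner ones
    included, is entered with the value of \<open>Emp\<close>. Such a row has a single entry
    \<open>1\<close>, because the automaton is deterministic.\<close>
  have m: "mat Q dc di dr f (x, e) q = of_bool (q = (x, \<phi> f))" if "(x, e) \<in> Q" for f x q
    using that
  proof (induction f arbitrary: x q)
    case (Snoc f a)
    have "mat Q dc di dr (Snoc f a) (x, e) q = (\<Sum>r\<in>Q. of_bool (r = (x, \<phi> f)) * di r a q)"
      by (simp add: Snoc)
    also have "\<dots> = of_bool ((x, \<phi> f) = (x, \<phi> f)) * di (x, \<phi> f) a q"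
      by (rule sum_eq_single[OF Q Qx]) (use Snoc in auto)
    also have "\<dots> = of_bool (q = (x, \<phi> (Snoc f a)))" by (simp add: di_def T(3))
    finally show ?case .
  next
    case (Wrap f a g b)
    let ?s = "(Some (call (\<phi> f) a), e)"
    have "mat Q dc di dr (Wrap f a g b) (x, e) q =
      (\<Sum>r\<in>Q. \<Sum>s\<in>Q. \<Sum>t\<in>Q. of_bool (r = (x, \<phi> f)) * dc r a s * mat Q dc di dr g s t * dr t r b q)"
      by (simp add: Wrap)
    also have "\<dots> = (\<Sum>s\<in>Q. \<Sum>t\<in>Q. dc (x, \<phi> f) a s * mat Q dc di dr g s t * dr t (x, \<phi> f) b q)"
      by (subst sum_eq_single[OF Q Qx]) (use Wrap in auto)
    also have "\<dots> = (\<Sum>t\<in>Q. mat Q dc di dr g ?s t * dr t (x, \<phi> f) b q)"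
      by (subst sum_eq_single[OF Q Qc[of f a]]) (auto simp: dc_def)
    also have "\<dots> = (\<Sum>t\<in>Q. of_bool (t = (Some (call (\<phi> f) a), \<phi> g)) * dr t (x, \<phi> f) b q)"
      by (simp add: Wrap.IH(2)[OF Qc])
    also have "\<dots> = dr (Some (call (\<phi> f) a), \<phi> g) (x, \<phi> f) b q"
      by (subst sum_eq_single[OF Q Qx[OF Qc[of f a]]]) auto
    also have "\<dots> = of_bool (q = (x, \<phi> (Wrap f a g b)))" by (simp add: dr_def T(4))
    finally show ?case .
  qed (auto simp: e_def)
  have "(None, e) \<in> Q" by (simp add: Q_def e_def)
  note i = this and Qf = Qx[OF this]
  show ?thesis
  proof (rule regI[OF Q])
    fix f
    have "nest_behaviour Q (\<lambda>p. of_bool (p = (None, e))) dc di dr (\<lambda>q. out (snd q)) f =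
        (\<Sum>q\<in>Q. mat Q dc di dr f (None, e) q * out (snd q))"
      unfolding nest_behaviour_def by (subst sum_eq_single[OF Q i]) auto
    also have "\<dots> = (\<Sum>q\<in>Q. of_bool (q = (None, \<phi> f)) * out (snd q))"
      by (simp add: m[OF i])
    also have "\<dots> = T f"
      by (subst sum_eq_single[OF Q Qf[of f]]) (auto simp: T(5))
    finally show "T f = nest_behaviour Q (\<lambda>p. of_bool (p = (None, e))) dc di dr (\<lambda>q. out (snd q)) f"
      by simp
  qed
qed

lemma reg_prod_list: "reg (\<lambda>f. prod_list (map g (lin f)))"
proof (rule regI[of "{()}"])
  let ?M = "mat {()} (\<lambda>_ a _. g a) (\<lambda>_ a _. g a) (\<lambda>_ _ a _. g a)"
  have m: "?M f () () = prod_list (map g (lin f))" for f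
    by (induction f) (simp_all add: ac_simps)
  show "prod_list (map g (lin f)) =
    nest_behaviour {()} (\<lambda>_. 1) (\<lambda>_ a _. g a) (\<lambda>_ a _. g a) (\<lambda>_ _ a _. g a) (\<lambda>_. 1) f" for f
    by (simp add: nest_behaviour_def m)
qed simp

section \<open>Marked positions and products over positions\<close>

definition one_mark :: "('c \<times> bool) nest \<Rightarrow> bool" where
  "one_mark v \<longleftrightarrow> length (filter snd (lin v)) = 1"

lemma recog_one_mark: "recog one_mark"
proof -
  \<comment> \<open>The two bits say whether at least one and whether at least two marks have been
    read.\<close>
  define d :: "bool \<times> bool \<Rightarrow> 'a \<times> bool \<Rightarrow> bool \<times> bool"
    where "d s c = (fst s \<or> snd c, snd s \<or> fst s \<and> snd c)" for s c
  have "foldl d s xs = (fst s \<or> 0 < length (filter snd xs),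
      snd s \<or> fst s \<and> 0 < length (filter snd xs) \<or> 1 < length (filter snd xs))" for s xs
    by (induction xs arbitrary: s) (auto simp: d_def)
  moreover have "length xs = 1 \<longleftrightarrow> 0 < length xs \<and> \<not> 1 < length xs" for xs :: "('a \<times> bool) list"
    by linarith
  ultimately have "one_mark = (\<lambda>v. case foldl d (False, False) (lin v) of (p, q) \<Rightarrow> p \<and> \<not> q)"
    by (simp add: one_mark_def fun_eq_iff)
  then show ?thesis
    using recog_comp[OF recog_foldl[of d "(False, False)"], of "\<lambda>(p, q). p \<and> \<not> q"] by simp
qed

text \<open>The restriction of the correspondence between sets and Boolean labellings to singletons:
  a first-order variable is treated as a set with one element.\<close>

lemma bij_betw_one_mark:
  fixes f :: "'p nest"
  assumes d: "distinct (lin f)"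
  shows "bij_betw (\<lambda>i. map_nest (\<lambda>j. (c j, j = i)) f) (set_nest f) {v \<in> labs UNIV (map_nest c f). one_mark v}"
proof -
  let ?M = "\<lambda>P. map_nest (\<lambda>j. (c j, j \<in> P)) f"
  have one: "one_mark (?M P) \<longleftrightarrow> card P = 1" if "P \<subseteq> set_nest f" for P
  proof -
    have "length (filter snd (lin (?M P))) = length (filter (\<lambda>j. j \<in> P) (lin f))"
      by (simp add: filter_map o_def)
    also have "\<dots> = card (P \<inter> set_nest f)"
      using distinct_length_filter[OF d, of "\<lambda>j. j \<in> P"] by (simp add: Int_def)
    finally show ?thesis using that by (simp add: one_mark_def Int_absorb2)
  qed
  have b: "bij_betw ?M (Pow (set_nest f)) (labs UNIV (map_nest c f))"
    by (rule bij_betw_Pow_labs[OF d])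
  have "bij_betw (\<lambda>i. {i}) (set_nest f) {P \<in> Pow (set_nest f). card P = 1}"
    by (rule bij_betw_imageI) (auto simp: card_1_singleton_iff image_iff)
  moreover have "bij_betw ?M {P \<in> Pow (set_nest f). card P = 1} {v \<in> labs UNIV (map_nest c f). one_mark v}"
  proof (rule bij_betw_subset[OF b])
    show "?M ` {P \<in> Pow (set_nest f). card P = 1} = {v \<in> labs UNIV (map_nest c f). one_mark v}"
      unfolding bij_betw_imp_surj_on[OF b, symmetric] using one by auto
  qed auto
  ultimately show ?thesis
    using bij_betw_trans by (fastforce simp: o_def)
qed

text \<open>Exactly one labelling guesses every value correctly, so at most one term of the sum over
  guesses is nonzero. Correctness has to be recognizable, and here the finite range of
  \<open>T\<close> enters: for each possible \<open>y\<close> separately it is tested that no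
  position carries the guess \<open>y\<close> wrongly.\<close>

lemma reg_prod_positions:
  fixes T :: "('c \<times> bool) nest \<Rightarrow> 'k::comm_semiring_1"
  assumes T: "recog T"
  obtains U where "reg U"
    "\<And>(f :: 'p nest) c. distinct (lin f) \<Longrightarrow>
      U (map_nest c f) = (\<Prod>i\<in>set_nest f. T (map_nest (\<lambda>j. (c j, j = i)) f))"
proof
  define Y where "Y = range T"
  have Y: "finite Y" using finite_range_recog[OF T] by (simp add: Y_def)
  \<comment> \<open>Given exactly one mark, the middle conjunct says that the guess at the marked
    position is \<open>y\<close>.\<close>
  define bad where "bad y v \<longleftrightarrow> one_mark v \<and> \<not> (\<exists>x\<in>set_nest v. snd x \<and> snd (fst x) \<noteq> y) \<and>
    T (map_nest (\<lambda>x. (fst (fst x), snd x)) v) \<noteq> y" for y and v :: "(('c \<times> 'k) \<times> bool) nest"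
  define good where "good L \<longleftrightarrow> (\<forall>y\<in>Y. \<not> (\<exists>v\<in>labs UNIV L. bad y v))" for L :: "('c \<times> 'k) nest"
  define U where "U f = (\<Sum>L\<in>labs Y f. of_bool (good L) * prod_list (map snd (lin L)))" for f :: "'c nest"
  have "recog (bad y)" for y
    unfolding bad_def[abs_def]
    by (rule recog_comp2[OF recog_one_mark recog_comp2[OF recog_Bex recog_map_nest[OF T],
            of "\<lambda>p t. \<not> p \<and> t \<noteq> y"], of "(\<and>)"])
  then have "recog (\<lambda>L. \<not> (\<exists>v\<in>labs UNIV L. bad y v))" for y
    by (intro recog_comp[where F = Not] recog_ex_labs) simp_all
  then have "recog good" unfolding good_def[abs_def] by (intro recog_ball Y)
  then have "recog (\<lambda>L. of_bool (good L) :: 'k)" by (rule recog_comp)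
  then show "reg U"
    unfolding U_def by (intro reg_sum_labs[OF _ Y] reg_mult reg_if_recog reg_prod_list)
  fix f :: "'p nest" and c
  assume d: "distinct (lin f)"
  define t where "t i = T (map_nest (\<lambda>j. (c j, j = i)) f)" for i
  let ?L = "\<lambda>l. map_nest (\<lambda>j. (c j, l j)) f"
  have good: "good (?L l) \<longleftrightarrow> (\<forall>i\<in>set_nest f. l i = t i)" if l: "\<And>i. i \<in> set_nest f \<Longrightarrow> l i \<in> Y" for l
  proof -
    have "{v \<in> labs UNIV (?L l). one_mark v} = (\<lambda>i. map_nest (\<lambda>j. ((c j, l j), j = i)) f) ` set_nest f"
      using bij_betw_imp_surj_on[OF bij_betw_one_mark[OF d, of "\<lambda>j. (c j, l j)"]] by simp
    moreover have "(\<exists>v\<in>labs UNIV (?L l). bad y v) \<longleftrightarrow> (\<exists>v\<in>{v \<in> labs UNIV (?L l). one_mark v}. bad y v)" for y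
      by (auto simp: bad_def)
    ultimately have "(\<exists>v\<in>labs UNIV (?L l). bad y v) \<longleftrightarrow>
        (\<exists>i\<in>set_nest f. bad y (map_nest (\<lambda>j. ((c j, l j), j = i)) f))" for y
      by simp
    moreover have bad: "bad y (map_nest (\<lambda>j. ((c j, l j), j = i)) f) \<longleftrightarrow> l i = y \<and> t i \<noteq> y"
      if "i \<in> set_nest f" for i y
    proof -
      have "one_mark (map_nest (\<lambda>j. ((c j, l j), j = i)) f)"
        using bij_betwE[OF bij_betw_one_mark[OF d, of "\<lambda>j. (c j, l j)"]] that by simp
      moreover have "(\<exists>x\<in>set_nest (map_nest (\<lambda>j. ((c j, l j), j = i)) f). snd x \<and> snd (fst x) \<noteq> y) \<longleftrightarrow> l i \<noteq> y"
        using that by (auto simp: nest.set_map)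
      ultimately show ?thesis by (simp add: bad_def t_def nest.map_comp o_def)
    qed
    ultimately have "(\<exists>v\<in>labs UNIV (?L l). bad y v) \<longleftrightarrow> (\<exists>i\<in>set_nest f. l i = y \<and> t i \<noteq> y)" for y
      by (simp cong: bex_cong)
    then show ?thesis unfolding good_def using l by (simp only:) metis
  qed
  have tY: "t i \<in> Y" for i by (simp add: t_def Y_def)
  have "U (map_nest c f) = of_bool (good (?L t)) * prod_list (map snd (lin (?L t)))"
    unfolding U_def
  proof (rule sum_eq_single)
    show "?L t \<in> labs Y (map_nest c f)"
      using tY by (auto simp: in_labs_iff nest.map_comp o_def nest.set_map)
    fix L assume L: "L \<in> labs Y (map_nest c f)" "L \<noteq> ?L t"
    obtain L' where L': "L' \<in> labs Y f" "L = map_nest (map_prod c id) L'"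
      using L(1) by (auto simp: labs_map_nest)
    obtain l where l: "L' = map_nest (\<lambda>j. (j, l j)) f" "\<And>j. j \<in> set_nest f \<Longrightarrow> l j \<in> Y"
      using labs_obtain_fun[OF L'(1) d] by blast
    have Ll: "L = ?L l" by (simp add: L'(2) l(1) nest.map_comp o_def)
    have "\<not> (\<forall>i\<in>set_nest f. l i = t i)"
    proof
      assume "\<forall>i\<in>set_nest f. l i = t i"
      then have "?L l = ?L t" by (intro nest.map_cong) simp_all
      then show False using L(2) Ll by simp
    qed
    then have "\<not> good (?L l)" using good[of l] l(2) by blast
    then show "of_bool (good L) * prod_list (map snd (lin L)) = 0"
      by (simp add: Ll)
  qed (use Y in simp)
  also have "\<dots> = prod_list (map t (lin f))"
    using good[of t] tY by (simp add: o_def)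
  also have "\<dots> = (\<Prod>i\<in>set_nest f. t i)"
    using prod.distinct_set_conv_list[OF d, of t] by simp
  finally show "U (map_nest c f) = (\<Prod>i\<in>set_nest f. T (map_nest (\<lambda>j. (c j, j = i)) f))"
    by (simp add: t_def)
qed

lemma reg_map_nest:
  assumes "reg T"
  shows "reg (\<lambda>f. T (map_nest h f))"
proof -
  obtain Q \<iota> dc di dr \<kappa> where Q: "finite (Q :: nat set)" and T: "\<And>f. T f = nest_behaviour Q \<iota> dc di dr \<kappa> f"
    using assms unfolding reg_def by blast
  have m: "mat Q dc di dr (map_nest h f) p q =
      mat Q (\<lambda>r a. dc r (h a)) (\<lambda>r a. di r (h a)) (\<lambda>t r a. dr t r (h a)) f p q" for f p q
    by (induction f arbitrary: p q) simp_all
  show ?thesis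
    by (rule regI[OF Q]) (simp add: T nest_behaviour_def m)
qed

section \<open>Runs as labellings by states\<close>

fun last_label :: "'s \<Rightarrow> ('c \<times> 's) nest \<Rightarrow> 's" where
  "last_label p Emp = p"
| "last_label p (Snoc v x) = snd x"
| "last_label p (Wrap v x u y) = snd y"

text \<open>Each position is labelled with the state reached after it, and \<open>p\<close> is the
  state before the tree. Hence the inner run of a \<open>Wrap\<close> starts at the label of the
  call.\<close>

fun run_wt :: "('s \<Rightarrow> 'c \<Rightarrow> 's \<Rightarrow> 'k) \<Rightarrow> ('s \<Rightarrow> 'c \<Rightarrow> 's \<Rightarrow> 'k) \<Rightarrow> ('s \<Rightarrow> 's \<Rightarrow> 'c \<Rightarrow> 's \<Rightarrow> 'k) \<Rightarrow>
    's \<Rightarrow> ('c \<times> 's) nest \<Rightarrow> 'k::comm_semiring_1" where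
  "run_wt dc di dr p Emp = 1"
| "run_wt dc di dr p (Snoc v x) = run_wt dc di dr p v * di (last_label p v) (fst x) (snd x)"
| "run_wt dc di dr p (Wrap v x u y) =
     run_wt dc di dr p v * dc (last_label p v) (fst x) (snd x) * run_wt dc di dr (snd x) u *
     dr (last_label (snd x) u) (last_label p v) (fst y) (snd y)"

text \<open>The arbitrary column vector \<open>G\<close> carries the induction: whatever follows the
  first subtree is absorbed into a new \<open>G\<close>, so the end state never has to be
  fixed.\<close>

lemma sum_mat_eq_sum_runs:
  assumes Q: "finite Q" and p: "p \<in> Q"
  shows "(\<Sum>q\<in>Q. mat Q dc di dr f p q * G q) =
    (\<Sum>v\<in>labs Q f. run_wt dc di dr p v * G (last_label p v))"
  using p
proof (induction f arbitrary: p G)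
  case Emp
  then show ?case by (simp add: sum_eq_single[OF Q, of p])
next
  case (Snoc f a)
  have "(\<Sum>q\<in>Q. mat Q dc di dr (Snoc f a) p q * G q) =
      (\<Sum>r\<in>Q. mat Q dc di dr f p r * (\<Sum>q\<in>Q. di r a q * G q))"
    unfolding mat.simps sum_distrib_right by (subst sum.swap) (simp add: sum_distrib_left ac_simps)
  also have "\<dots> = (\<Sum>v\<in>labs Q f. run_wt dc di dr p v * (\<Sum>q\<in>Q. di (last_label p v) a q * G q))"
    by (rule Snoc.IH[OF Snoc.prems])
  also have "\<dots> = (\<Sum>v\<in>labs Q (Snoc f a). run_wt dc di dr p v * G (last_label p v))"
    by (simp only: sum_labs_Snoc) (simp add: sum_distrib_left ac_simps)
  finally show ?case .
next
  case (Wrap f a g b)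
  define H where "H r t = (\<Sum>q\<in>Q. dr t r b q * G q)" for r t
  have "(\<Sum>q\<in>Q. mat Q dc di dr (Wrap f a g b) p q * G q) =
      (\<Sum>q\<in>Q. \<Sum>y\<in>Q \<times> Q \<times> Q. mat Q dc di dr f p (fst y) * dc (fst y) a (fst (snd y)) *
        mat Q dc di dr g (fst (snd y)) (snd (snd y)) * dr (snd (snd y)) (fst y) b q * G q)"
    by (simp only: mat.simps sum_distrib_right sum_Times fst_conv snd_conv)
  also have "\<dots> = (\<Sum>y\<in>Q \<times> Q \<times> Q. \<Sum>q\<in>Q. mat Q dc di dr f p (fst y) * dc (fst y) a (fst (snd y)) *
        mat Q dc di dr g (fst (snd y)) (snd (snd y)) * dr (snd (snd y)) (fst y) b q * G q)"
    by (rule sum.swap)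
  also have "\<dots> = (\<Sum>r\<in>Q. mat Q dc di dr f p r * (\<Sum>s\<in>Q. dc r a s *
      (\<Sum>t\<in>Q. mat Q dc di dr g s t * H r t)))"
    by (simp only: sum_Times fst_conv snd_conv H_def sum_distrib_left mult.assoc)
  also have "\<dots> = (\<Sum>r\<in>Q. mat Q dc di dr f p r * (\<Sum>s\<in>Q. dc r a s *
      (\<Sum>u\<in>labs Q g. run_wt dc di dr s u * H r (last_label s u))))"
    using Wrap.IH(2) by (simp cong: sum.cong)
  also have "\<dots> = (\<Sum>v\<in>labs Q f. run_wt dc di dr p v * (\<Sum>s\<in>Q. dc (last_label p v) a s *
      (\<Sum>u\<in>labs Q g. run_wt dc di dr s u * H (last_label p v) (last_label s u))))"
    by (rule Wrap.IH(1)[OF Wrap.prems])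
  also have "\<dots> = (\<Sum>v\<in>labs Q (Wrap f a g b). run_wt dc di dr p v * G (last_label p v))"
    by (simp only: sum_labs_Wrap run_wt.simps last_label.simps fst_conv snd_conv H_def
        sum_distrib_left mult.assoc)
  finally show ?case .
qed

lemma append_Cons_eq_upt:
  "xs @ y # ys = [m..<k] \<Longrightarrow> xs = [m..<y] \<and> ys = [Suc y..<k] \<and> m \<le> y \<and> y < k"
proof (induction xs arbitrary: m)
  case Nil
  then show ?case using upt_eq_Cons_conv[of m k y ys] by auto
next
  case (Cons x xs)
  then have "x = m" "xs @ y # ys = [Suc m..<k]"
    using upt_eq_Cons_conv[of m k x "xs @ y # ys"] by auto
  then show ?case using Cons.IH[of "Suc m"] by (auto simp: upt_conv_Cons)
qed

text \<open>\<open>\<nu>\<close> belongs to the whole word, \<open>f\<close> to an interval of it.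
  The hypothesis that all edges touching the interval belong to \<open>f\<close> is inherited by the
  subtrees, and it ensures that \<open>step_wt\<close>, which consults \<open>\<nu>\<close>,
  classifies positions as the tree does.\<close>

lemma run_wt_eq_prod_step_wt:
  assumes "lin f = [m..<k]" "1 \<le> m" "m \<le> k"
    and "edges f \<subseteq> \<nu>" "\<And>u v. (u, v) \<in> \<nu> \<Longrightarrow> u \<in> {m..<k} \<or> v \<in> {m..<k} \<Longrightarrow> (u, v) \<in> edges f"
    and \<nu>: "\<And>i i' j. (i, j) \<in> \<nu> \<Longrightarrow> (i', j) \<in> \<nu> \<Longrightarrow> i = i'"
  shows "last_label (r ! (m - 1)) (map_nest (\<lambda>j. (w ! (j - 1), r ! j)) f) = r ! (k - 1) \<and>
    run_wt (dcall A) (dint A) (dret A) (r ! (m - 1)) (map_nest (\<lambda>j. (w ! (j - 1), r ! j)) f) =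
      (\<Prod>j\<in>{m..<k}. step_wt A (w, \<nu>) r j)"
  using assms(1-5)
proof (induction f arbitrary: m k)
  case Emp
  then have "[m..<k] = []" by simp
  with Emp have "m = k" by (simp add: upt_eq_Nil_conv)
  then show ?case by simp
next
  case (Snoc f a)
  have l: "lin f = [m..<a]" "k = Suc a" "m \<le> a"
    using append_Cons_eq_upt[of "lin f" a "[]" m k] Snoc.prems(1) upt_eq_Nil_conv[of "Suc a" k] by auto
  have sf: "set_nest f = {m..<a}" using l(1) set_lin[of f] by simp
  have e: "(u, v) \<in> edges f" if "(u, v) \<in> \<nu>" "u \<in> {m..a} \<or> v \<in> {m..a}" for u v
    using Snoc.prems(5)[OF that(1)] that(2) l by auto
  have "\<not> (\<exists>x. (a, x) \<in> \<nu>)" "\<not> (\<exists>x. (x, a) \<in> \<nu>)"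
    using e edges_subset[of f] sf l(3) by fastforce+
  then have "step_wt A (w, \<nu>) r a = dint A (r ! (a - 1)) (w ! (a - 1)) (r ! a)"
    by (simp add: step_wt_def)
  moreover have "last_label (r ! (m - 1)) (map_nest (\<lambda>j. (w ! (j - 1), r ! j)) f) = r ! (a - 1) \<and>
    run_wt (dcall A) (dint A) (dret A) (r ! (m - 1)) (map_nest (\<lambda>j. (w ! (j - 1), r ! j)) f) =
      (\<Prod>j\<in>{m..<a}. step_wt A (w, \<nu>) r j)"
    by (rule Snoc.IH) (use l e Snoc.prems in auto)
  ultimately show ?case using l by simp
next
  case (Wrap f a g b)
  have l1: "lin f = [m..<a]" "lin g @ [b] = [Suc a..<k]" "m \<le> a" "a < k"
    using append_Cons_eq_upt[of "lin f" a "lin g @ [b]" m k] Wrap.prems(1) by auto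
  have l2: "lin g = [Suc a..<b]" "k = Suc b" "Suc a \<le> b"
    using append_Cons_eq_upt[of "lin g" b "[]" "Suc a" k] l1(2) upt_eq_Nil_conv[of "Suc b" k] by auto
  have sf: "set_nest f = {m..<a}" "set_nest g = {Suc a..<b}"
    using l1(1) l2(1) set_lin[of f] set_lin[of g] by simp_all
  have ef: "u \<in> {m..<a} \<and> v \<in> {m..<a}" if "(u, v) \<in> edges f" for u v
    using that edges_subset[of f] sf by auto
  have eg: "u \<in> {Suc a..<b} \<and> v \<in> {Suc a..<b}" if "(u, v) \<in> edges g" for u v
    using that edges_subset[of g] sf by auto
  have e: "(u, v) = (a, b) \<or> (u, v) \<in> edges f \<or> (u, v) \<in> edges g"
    if "(u, v) \<in> \<nu>" "u \<in> {m..b} \<or> v \<in> {m..b}" for u v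
    using Wrap.prems(5)[OF that(1)] that(2) l2(2) by auto
  have ab: "(a, b) \<in> \<nu>" using Wrap.prems(4) by simp
  \<comment> \<open>\<open>step_wt\<close> tests for a call first, so it must be excluded that the
    return position \<open>b\<close> opens an edge itself.\<close>
  have nb: "\<not> (\<exists>x. (b, x) \<in> \<nu>)"
    using e[of b] ef[of b] eg[of b] l1 l2 by fastforce
  have "(THE i. (i, b) \<in> \<nu>) = a" using ab \<nu> by blast
  then have sb: "step_wt A (w, \<nu>) r b = dret A (r ! (b - 1)) (r ! (a - 1)) (w ! (b - 1)) (r ! b)"
    using nb ab by (auto simp: step_wt_def)
  have sa: "step_wt A (w, \<nu>) r a = dcall A (r ! (a - 1)) (w ! (a - 1)) (r ! a)"
    using ab by (auto simp: step_wt_def)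
  have 1: "last_label (r ! (m - 1)) (map_nest (\<lambda>j. (w ! (j - 1), r ! j)) f) = r ! (a - 1) \<and>
    run_wt (dcall A) (dint A) (dret A) (r ! (m - 1)) (map_nest (\<lambda>j. (w ! (j - 1), r ! j)) f) =
      (\<Prod>j\<in>{m..<a}. step_wt A (w, \<nu>) r j)"
  proof (rule Wrap.IH(1)[OF l1(1) Wrap.prems(2) l1(3)])
    show "(u, v) \<in> edges f" if "(u, v) \<in> \<nu>" "u \<in> {m..<a} \<or> v \<in> {m..<a}" for u v
      using e[OF that(1)] eg[of u v] that(2) l2 by auto
  qed (use Wrap.prems in auto)
  have 2: "last_label (r ! (Suc a - 1)) (map_nest (\<lambda>j. (w ! (j - 1), r ! j)) g) = r ! (b - 1) \<and>
    run_wt (dcall A) (dint A) (dret A) (r ! (Suc a - 1)) (map_nest (\<lambda>j. (w ! (j - 1), r ! j)) g) =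
      (\<Prod>j\<in>{Suc a..<b}. step_wt A (w, \<nu>) r j)"
  proof (rule Wrap.IH(2)[OF l2(1) _ l2(3)])
    show "(u, v) \<in> edges g" if "(u, v) \<in> \<nu>" "u \<in> {Suc a..<b} \<or> v \<in> {Suc a..<b}" for u v
      using e[OF that(1)] ef[of u v] that(2) l1 by auto
  qed (use Wrap.prems in auto)
  have "{m..<k} = insert b ({Suc a..<b} \<union> insert a {m..<a})"
    using l1 l2 by auto
  then have "(\<Prod>j\<in>{m..<k}. step_wt A (w, \<nu>) r j) = step_wt A (w, \<nu>) r b *
    ((\<Prod>j\<in>{Suc a..<b}. step_wt A (w, \<nu>) r j) *
      (step_wt A (w, \<nu>) r a * (\<Prod>j\<in>{m..<a}. step_wt A (w, \<nu>) r j)))"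
    using l2(3) by (simp add: prod.union_disjoint ac_simps)
  then show ?case using 1 2 sa sb l2(2) by (simp add: ac_simps)
qed

text \<open>A run is its first state together with a labelling of the positions by the states after
  them, so the sum over runs is the sum that \<open>mat\<close> evaluates.\<close>

lemma behaviour_eq_nest_behaviour:
  fixes A :: "('a, 'k::comm_semiring_1) wnwa"
  assumes Q: "finite (states A)" and nw: "(w, edges f) \<in> NW" and f: "lin f = [1..<Suc (length w)]"
  shows "behaviour A (w, edges f) = nest_behaviour (states A) (init A) (dcall A) (dint A) (dret A) (fin A)
    (map_nest (\<lambda>j. w ! (j - 1)) f)"
proof -
  define n where "n = length w"
  define c where "c j = w ! (j - 1)" for j
  have sf: "set_nest f = {1..n}" using f set_lin[of f] by (simp add: n_def atLeastLessThanSuc_atLeastAtMost del: upt_Suc)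
  have d: "distinct (lin f)" using f by simp
  let ?v = "\<lambda>r. map_nest (\<lambda>j. (c j, r ! j)) f"
  have bij: "bij_betw (\<lambda>r. (r ! 0, ?v r)) (runs A (w, edges f)) (states A \<times> labs (states A) (map_nest c f))"
  proof (rule bij_betw_imageI)
    show "inj_on (\<lambda>r. (r ! 0, ?v r)) (runs A (w, edges f))"
    proof (rule inj_onI)
      fix r r' assume r: "r \<in> runs A (w, edges f)" "r' \<in> runs A (w, edges f)"
        and eq: "(r ! 0, ?v r) = (r' ! 0, ?v r')"
      have "r ! j = r' ! j" if "j \<le> n" for j
      proof (cases "j = 0")
        case False
        then have "j \<in> set_nest f" using that sf by simp
        then show ?thesis using eq map_nest_inj_on_set[of "\<lambda>j. (c j, r ! j)" f] by auto
      qed (use eq in simp)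
      then show "r = r'" using r by (intro nth_equalityI) (auto simp: runs_def n_def)
    qed
    show "(\<lambda>r. (r ! 0, ?v r)) ` runs A (w, edges f) = states A \<times> labs (states A) (map_nest c f)"
    proof (intro equalityI subsetI)
      fix x assume "x \<in> (\<lambda>r. (r ! 0, ?v r)) ` runs A (w, edges f)"
      then obtain r where r: "r \<in> runs A (w, edges f)" "x = (r ! 0, ?v r)" by blast
      then have "r ! j \<in> states A" if "j \<le> n" for j
        using that by (auto simp: runs_def n_def less_Suc_eq_le intro!: subsetD[OF _ nth_mem])
      then show "x \<in> states A \<times> labs (states A) (map_nest c f)"
        using r(2) sf by (auto simp: in_labs_iff nest.map_comp o_def nest.set_map)
    next
      fix x assume "x \<in> states A \<times> labs (states A) (map_nest c f)"
      then obtain p v where x: "x = (p, map_nest (map_prod c id) v)" "p \<in> states A" "v \<in> labs (states A) f"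
        by (auto simp: labs_map_nest)
      obtain l where l: "v = map_nest (\<lambda>j. (j, l j)) f" "\<And>j. j \<in> set_nest f \<Longrightarrow> l j \<in> states A"
        using labs_obtain_fun[OF x(3) d] by blast
      define r where "r = p # map l [1..<Suc n]"
      have rn: "r ! j = l j" if "j \<in> set_nest f" for j
      proof -
        have "1 \<le> j" "j \<le> n" using that sf by simp_all
        then show ?thesis by (cases j) (simp_all add: r_def nth_upt del: upt_Suc)
      qed
      have "r \<in> runs A (w, edges f)"
        using x(2) l(2) sf by (auto simp: runs_def r_def n_def simp del: upt_Suc)
      moreover have "x = (r ! 0, ?v r)"
        by (auto simp: x l nest.map_comp o_def r_def[THEN arg_cong[of _ _ "\<lambda>r. r ! 0"]] rn intro!: nest.map_cong)
      ultimately show "x \<in> (\<lambda>r. (r ! 0, ?v r)) ` runs A (w, edges f)" by blast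
    qed
  qed
  have nr: "nesting_rel n (edges f)" using nw by (simp add: NW_def n_def)
  have step: "last_label (r ! 0) (?v r) = r ! n \<and>
      run_wt (dcall A) (dint A) (dret A) (r ! 0) (?v r) = (\<Prod>j\<in>{1..n}. step_wt A (w, edges f) r j)" for r
  proof -
    have "last_label (r ! (1 - 1)) (map_nest (\<lambda>j. (w ! (j - 1), r ! j)) f) = r ! (Suc n - 1) \<and>
    run_wt (dcall A) (dint A) (dret A) (r ! (1 - 1)) (map_nest (\<lambda>j. (w ! (j - 1), r ! j)) f) =
      (\<Prod>j\<in>{1..<Suc n}. step_wt A (w, edges f) r j)"
      by (rule run_wt_eq_prod_step_wt) (use f nr in \<open>auto simp: n_def nesting_rel_def simp del: upt_Suc\<close>)
    then show ?thesis by (simp add: c_def atLeastLessThanSuc_atLeastAtMost)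
  qed
  have "behaviour A (w, edges f) = (\<Sum>r\<in>runs A (w, edges f). init A (r ! 0) *
      run_wt (dcall A) (dint A) (dret A) (r ! 0) (?v r) * fin A (last_label (r ! 0) (?v r)))"
    by (simp add: behaviour_def step n_def)
  also have "\<dots> = (\<Sum>(p, v)\<in>states A \<times> labs (states A) (map_nest c f).
      init A p * run_wt (dcall A) (dint A) (dret A) p v * fin A (last_label p v))"
    using sum.reindex_bij_betw[OF bij, of "\<lambda>(p, v). init A p * run_wt (dcall A) (dint A) (dret A) p v *
      fin A (last_label p v)"] by simp
  also have "\<dots> = (\<Sum>p\<in>states A. init A p * (\<Sum>q\<in>states A.
      mat (states A) (dcall A) (dint A) (dret A) (map_nest c f) p q * fin A q))"
    by (simp add: sum_mat_eq_sum_runs[OF Q] sum.cartesian_product[symmetric] sum_distrib_left mult.assoc)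
  also have "\<dots> = nest_behaviour (states A) (init A) (dcall A) (dint A) (dret A) (fin A) (map_nest c f)"
    by (simp add: nest_behaviour_def sum_distrib_left mult.assoc)
  finally show ?thesis by (simp add: c_def[abs_def])
qed

lemma regular_if_reg:
  fixes T :: "'a nest \<Rightarrow> 'k::comm_semiring_1"
  assumes "reg T"
    and T: "\<And>w f. w \<noteq> [] \<Longrightarrow> (w, edges f) \<in> NW \<Longrightarrow> lin f = [1..<Suc (length w)] \<Longrightarrow>
      S (w, edges f) = T (map_nest (\<lambda>j. w ! (j - 1)) f)"
  shows "regular S"
proof -
  obtain A :: "('a, 'k) wnwa" where A: "finite (states A)"
    "\<And>f. T f = nest_behaviour (states A) (init A) (dcall A) (dint A) (dret A) (fin A) f"
    using assms(1) unfolding reg_def by blast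
  have "S nw = behaviour A nw" if nw: "nw \<in> NW" for nw
  proof -
    obtain w \<nu> where x: "nw = (w, \<nu>)" by force
    obtain f where f: "lin f = [1..<Suc (length w)]" "edges f = \<nu>"
      using NW_parse nw x by blast
    have "w \<noteq> []" using nw x by (simp add: NW_def)
    then show ?thesis
      using T[of w f] f behaviour_eq_nest_behaviour[OF A(1), of w f] nw x A(2) by simp
  qed
  then show ?thesis using A(1) unfolding regular_def by blast
qed

section \<open>Semantics of syntactically unambiguous formulas\<close>

fun csem :: "'a cform \<Rightarrow> 'a nword \<Rightarrow> (nat \<Rightarrow> nat) \<Rightarrow> (nat \<Rightarrow> nat set) \<Rightarrow> bool" where
  "csem (CAtom a) nw s1 s2 = asem a nw s1 s2"
| "csem (CNot p) nw s1 s2 = (\<not> csem p nw s1 s2)"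
| "csem (COr p q) nw s1 s2 = (csem p nw s1 s2 \<or> csem q nw s1 s2)"
| "csem (CEx1 x p) nw s1 s2 = (\<exists>i\<in>{1..length (fst nw)}. csem p nw (s1(x := i)) s2)"
| "csem (CExS X p) nw s1 s2 = (\<exists>P\<in>Pow {1..length (fst nw)}. csem p nw s1 (s2(X := P)))"

lemma csem_cand [simp]: "csem (cand p q) nw s1 s2 \<longleftrightarrow> csem p nw s1 s2 \<and> csem q nw s1 s2"
  by (simp add: cand_def)

lemma csem_cimp [simp]: "csem (cimp p q) nw s1 s2 \<longleftrightarrow> (csem p nw s1 s2 \<longrightarrow> csem q nw s1 s2)"
  by (auto simp: cimp_def)

lemma csem_ciff [simp]: "csem (ciff p q) nw s1 s2 \<longleftrightarrow> (csem p nw s1 s2 \<longleftrightarrow> csem q nw s1 s2)"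
  by (auto simp: ciff_def)

lemma csem_call1 [simp]:
  "csem (call1 x p) nw s1 s2 \<longleftrightarrow> (\<forall>i\<in>{1..length (fst nw)}. csem p nw (s1(x := i)) s2)"
  by (simp add: call1_def)

lemma csem_clt [simp]: "csem (clt x y) nw s1 s2 \<longleftrightarrow> s1 x < s1 y"
  by (auto simp: clt_def)

lemma asem_upd1: "y \<notin> avars1 a \<Longrightarrow> asem a nw (s1(y := j)) s2 = asem a nw s1 s2"
  by (cases a) auto

lemma asem_upd2: "Y \<notin> avars2 a \<Longrightarrow> asem a nw s1 (s2(Y := P)) = asem a nw s1 s2"
  by (cases a) auto

lemma asem_aren1: "asem (aren1 x y a) nw s1 s2 = asem a nw (s1(x := s1 y)) s2"
  by (cases a) auto

lemma asem_aren2: "asem (aren2 X Y a) nw s1 s2 = asem a nw s1 (s2(X := s2 Y))"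
  by (cases a) auto

lemma csem_upd1: "y \<notin> vars1 p \<Longrightarrow> csem p nw (s1(y := j)) s2 = csem p nw s1 s2"
  by (induction p arbitrary: s1 s2) (simp_all add: asem_upd1 fun_upd_twist)

lemma csem_upd2: "Y \<notin> vars2 p \<Longrightarrow> csem p nw s1 (s2(Y := P)) = csem p nw s1 s2"
  by (induction p arbitrary: s1 s2) (simp_all add: asem_upd2 fun_upd_twist)

lemma csem_ren1: "y \<notin> vars1 p \<Longrightarrow> csem (ren1 x y p) nw s1 s2 = csem p nw (s1(x := s1 y)) s2"
  by (induction p arbitrary: s1 s2) (auto simp: asem_aren1 fun_upd_twist)

lemma csem_ren2: "Y \<notin> vars2 p \<Longrightarrow> csem (ren2 X Y p) nw s1 s2 = csem p nw s1 (s2(X := s2 Y))"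
  by (induction p arbitrary: s1 s2) (auto simp: asem_aren2 fun_upd_twist)

definition lex_less :: "nat \<Rightarrow> nat set \<Rightarrow> nat set \<Rightarrow> bool" where
  "lex_less n R P \<longleftrightarrow> (\<exists>k\<in>{1..n}. k \<in> P \<and> k \<notin> R \<and> (\<forall>z\<in>{1..n}. z < k \<longrightarrow> (z \<in> P \<longleftrightarrow> z \<in> R)))"

lemma csem_lexless: "csem (lexless Y X) nw s1 s2 \<longleftrightarrow> lex_less (length (fst nw)) (s2 Y) (s2 X)"
  by (auto simp: lexless_def lex_less_def)

lemma lex_less_trans: "lex_less n A B \<Longrightarrow> lex_less n B C \<Longrightarrow> lex_less n A C"
proof -
  assume "lex_less n A B" "lex_less n B C"
  then obtain k l where k: "k \<in> {1..n}" "k \<in> B" "k \<notin> A" "\<forall>z\<in>{1..n}. z < k \<longrightarrow> (z \<in> B \<longleftrightarrow> z \<in> A)"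
    and l: "l \<in> {1..n}" "l \<in> C" "l \<notin> B" "\<forall>z\<in>{1..n}. z < l \<longrightarrow> (z \<in> C \<longleftrightarrow> z \<in> B)"
    unfolding lex_less_def by blast
  have "k \<noteq> l" using k l by blast
  \<comment> \<open>Below the smaller of the two points of difference all three sets agree; that
    point itself lies in \<open>C\<close> but not in \<open>A\<close>.\<close>
  then show "lex_less n A C"
    unfolding lex_less_def using k l by (intro bexI[of _ "min k l"]) (auto simp: min_def)
qed

lemma lex_less_asym: "lex_less n A B \<Longrightarrow> \<not> lex_less n B A"
  using lex_less_trans[of n A B A] by (auto simp: lex_less_def)

lemma lex_less_total:
  assumes "A \<subseteq> {1..n}" "B \<subseteq> {1..n}" "A \<noteq> B"
  shows "lex_less n A B \<or> lex_less n B A"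
proof -
  define k where "k = (LEAST z. (z \<in> A) \<noteq> (z \<in> B))"
  have ex: "\<exists>z. (z \<in> A) \<noteq> (z \<in> B)" using assms(3) by blast
  have k: "(k \<in> A) \<noteq> (k \<in> B)" unfolding k_def by (rule LeastI_ex[OF ex])
  moreover have "(z \<in> A) = (z \<in> B)" if "z < k" for z
    using not_less_Least[of z "\<lambda>z. (z \<in> A) \<noteq> (z \<in> B)"] that unfolding k_def by blast
  moreover have "k \<in> {1..n}" using k assms(1,2) by blast
  ultimately show ?thesis unfolding lex_less_def by blast
qed

text \<open>Only the smallest element satisfying \<open>P\<close> contributes; this is the effect of
  the minimality conjunct in the translation of quantifiers. \<open>R\<close> will be the order of
  positions or the lexicographic order of sets.\<close>

lemma sum_of_bool_first:
  assumes "finite A" "\<And>x y. x \<in> A \<Longrightarrow> y \<in> A \<Longrightarrow> x \<noteq> y \<Longrightarrow> R x y \<or> R y x"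
    and "\<And>x y. R x y \<Longrightarrow> \<not> R y x" "\<And>x y z. R x y \<Longrightarrow> R y z \<Longrightarrow> R x z"
  shows "(\<Sum>x\<in>A. of_bool (P x \<and> (\<forall>y\<in>A. \<not> (R y x \<and> P y)))) = (of_bool (\<exists>x\<in>A. P x) :: 'k::comm_semiring_1)"
proof (cases "\<exists>x\<in>A. P x")
  case True
  have "asymp_on {x \<in> A. P x} R" by (rule asymp_onI) (rule assms(3))
  moreover have "transp_on {x \<in> A. P x} R" by (rule transp_onI) (rule assms(4))
  moreover have "finite {x \<in> A. P x}" "{x \<in> A. P x} \<noteq> {}" using assms(1) True by auto
  ultimately obtain m where m: "m \<in> A" "P m" "\<forall>y\<in>{x \<in> A. P x}. y \<noteq> m \<longrightarrow> \<not> R y m"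
    using Finite_Set.bex_min_element[of "{x \<in> A. P x}" R] by blast
  have "\<not> R m m" using assms(3) by blast
  then have mm: "P m \<and> (\<forall>y\<in>A. \<not> (R y m \<and> P y))" using m by auto
  have "(\<Sum>x\<in>A. of_bool (P x \<and> (\<forall>y\<in>A. \<not> (R y x \<and> P y)))) =
      (of_bool (P m \<and> (\<forall>y\<in>A. \<not> (R y m \<and> P y))) :: 'k)"
  proof (rule sum_eq_single[OF assms(1) m(1)])
    fix x assume x: "x \<in> A" "x \<noteq> m"
    then have "\<not> (P x \<and> (\<forall>y\<in>A. \<not> (R y x \<and> P y)))" using assms(2)[OF x(1) m(1)] mm m(1) by blast
    then show "of_bool (P x \<and> (\<forall>y\<in>A. \<not> (R y x \<and> P y))) = (0::'k)" by simp
  qed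
  then show ?thesis using mm True by simp
qed simp

lemma prod_of_bool: "finite A \<Longrightarrow> (\<Prod>x\<in>A. of_bool (P x)) = (of_bool (\<forall>x\<in>A. P x) :: 'k::comm_semiring_1)"
  by (induction A rule: finite_induct) auto

lemma fresh1: "fresh1 x p \<notin> vars1 p" "fresh1 x p \<noteq> x"
proof -
  have "z < fresh1 x p" if "z \<in> insert x (vars1 p)" for z
    using Max_ge[of "insert x (vars1 p)" z] that by (simp add: fresh1_def less_Suc_eq_le)
  then show "fresh1 x p \<notin> vars1 p" "fresh1 x p \<noteq> x" by auto
qed

lemma fresh2: "fresh2 X p \<notin> vars2 p" "fresh2 X p \<noteq> X"
proof -
  have "z < fresh2 X p" if "z \<in> insert X (vars2 p)" for z
    using Max_ge[of "insert X (vars2 p)" z] that by (simp add: fresh2_def less_Suc_eq_le)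
  then show "fresh2 X p \<notin> vars2 p" "fresh2 X p \<noteq> X" by auto
qed

text \<open>The translation never adds two ones: a disjunction admits its second part only where the
  first fails, and an existential quantifier admits only its least witness.\<close>

lemma wsem_pm: "wsem (pm b p) nw s1 s2 = (of_bool (csem p nw s1 s2 = b) :: 'k::comm_semiring_1)"
proof (induction b p arbitrary: s1 s2 rule: pm.induct)
  case (6 x p)
  let ?y = "fresh1 x p" and ?n = "length (fst nw)"
  \<comment> \<open>The renamed copy reads the fresh variable in place of \<open>x\<close>, so the
    value \<open>i\<close> of \<open>x\<close> does not affect it.\<close>
  have eq: "csem (ren1 x ?y p) nw (s1(x := i, ?y := j)) s2 = csem p nw (s1(x := j)) s2" for i j
    using csem_upd1[OF fresh1(1)[of x p], of nw "s1(x := j)" j s2] fresh1(2)[of x p]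
    by (simp add: csem_ren1[OF fresh1(1)] fun_upd_twist)
  have "wsem (pm True p) nw (s1(x := i)) s2 *
      (\<Prod>j\<in>{1..?n}. wsem (pm False (cand (clt ?y x) (ren1 x ?y p))) nw (s1(x := i, ?y := j)) s2) =
      (of_bool (csem p nw (s1(x := i)) s2 \<and>
        (\<forall>j\<in>{1..?n}. \<not> (j < i \<and> csem p nw (s1(x := j)) s2))) :: 'k)" for i
    unfolding 6 csem_cand csem_clt eq using fresh1(2)[of x p] by (auto simp: prod_of_bool)
  then have "wsem (pm True (CEx1 x p)) nw s1 s2 =
      (\<Sum>i\<in>{1..?n}. of_bool (csem p nw (s1(x := i)) s2 \<and>
        (\<forall>j\<in>{1..?n}. \<not> (j < i \<and> csem p nw (s1(x := j)) s2))) :: 'k)"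
    by (simp only: pm.simps wsem.simps)
  also have "\<dots> = of_bool (\<exists>i\<in>{1..?n}. csem p nw (s1(x := i)) s2)"
    by (rule sum_of_bool_first[where R = "(<)"]) auto
  finally show ?case by simp
next
  case (8 X p)
  let ?Y = "fresh2 X p" and ?n = "length (fst nw)"
  have eq: "csem (ren2 X ?Y p) nw s1 (s2(X := P, ?Y := R)) = csem p nw s1 (s2(X := R))" for P R
    using csem_upd2[OF fresh2(1)[of X p], of nw s1 "s2(X := R)" R] fresh2(2)[of X p]
    by (simp add: csem_ren2[OF fresh2(1)] fun_upd_twist)
  have "wsem (pm True p) nw s1 (s2(X := P)) *
      (\<Prod>R\<in>Pow {1..?n}. wsem (pm False (cand (lexless ?Y X) (ren2 X ?Y p))) nw s1 (s2(X := P, ?Y := R))) =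
      (of_bool (csem p nw s1 (s2(X := P)) \<and>
        (\<forall>R\<in>Pow {1..?n}. \<not> (lex_less ?n R P \<and> csem p nw s1 (s2(X := R))))) :: 'k)" for P
    unfolding 8 csem_cand csem_lexless eq using fresh2(2)[of X p] by (auto simp: prod_of_bool)
  then have "wsem (pm True (CExS X p)) nw s1 s2 =
      (\<Sum>P\<in>Pow {1..?n}. of_bool (csem p nw s1 (s2(X := P)) \<and>
        (\<forall>R\<in>Pow {1..?n}. \<not> (lex_less ?n R P \<and> csem p nw s1 (s2(X := R))))) :: 'k)"
    by (simp only: pm.simps wsem.simps)
  also have "\<dots> = of_bool (\<exists>P\<in>Pow {1..?n}. csem p nw s1 (s2(X := P)))"
    by (rule sum_of_bool_first[where R = "lex_less ?n"])
      (use lex_less_asym lex_less_trans lex_less_total in blast)+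
  finally show ?case by simp
qed (auto simp: prod_of_bool)

section \<open>From formulas to automata\<close>

text \<open>A position carries the names of all variables that mark it, for the infinitely many
  variables at once. One alphabet then serves every formula and no list of free variables is
  maintained; the price is that the alphabet is infinite.\<close>

type_synonym 'a letter = "'a \<times> nat set \<times> nat set"

definition letter :: "'a list \<Rightarrow> (nat \<Rightarrow> nat) \<Rightarrow> (nat \<Rightarrow> nat set) \<Rightarrow> nat \<Rightarrow> 'a letter" where
  "letter w s1 s2 j = (w ! (j - 1), {x. s1 x = j}, {X. j \<in> s2 X})"

definition assignments :: "nat \<Rightarrow> (nat \<Rightarrow> nat) \<Rightarrow> (nat \<Rightarrow> nat set) \<Rightarrow> bool" where
  "assignments n s1 s2 \<longleftrightarrow> (\<forall>x. s1 x \<le> n) \<and> (\<forall>X. s2 X \<subseteq> {1..n})"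

text \<open>The position \<open>0\<close> stands for an undefined first-order variable: it leaves no mark on the word.
  This makes the encoding of a sentence independent of the assignment.\<close>

definition encodes :: "('a letter nest \<Rightarrow> 'v) \<Rightarrow> ('a nword \<Rightarrow> (nat \<Rightarrow> nat) \<Rightarrow> (nat \<Rightarrow> nat set) \<Rightarrow> 'v) \<Rightarrow> bool" where
  "encodes T F \<longleftrightarrow> (\<forall>w f s1 s2. w \<noteq> [] \<longrightarrow> lin f = [1..<Suc (length w)] \<longrightarrow> assignments (length w) s1 s2 \<longrightarrow>
     F (w, edges f) s1 s2 = T (map_nest (letter w s1 s2) f))"

lemma encodesI:
  assumes "\<And>w f s1 s2. w \<noteq> [] \<Longrightarrow> lin f = [1..<Suc (length w)] \<Longrightarrow> set_nest f = {1..length w} \<Longrightarrow>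
    distinct (lin f) \<Longrightarrow> assignments (length w) s1 s2 \<Longrightarrow>
    F (w, edges f) s1 s2 = T (map_nest (letter w s1 s2) f)"
  shows "encodes T F"
  unfolding encodes_def
proof (intro allI impI)
  fix w :: "'a list" and f s1 s2
  assume a: "w \<noteq> []" "lin f = [1..<Suc (length w)]" "assignments (length w) s1 s2"
  have "set_nest f = {1..length w}"
    using set_lin[of f] unfolding a(2) by (simp add: atLeastLessThanSuc_atLeastAtMost del: upt_Suc)
  moreover have "distinct (lin f)" using a(2) by simp
  ultimately show "F (w, edges f) s1 s2 = T (map_nest (letter w s1 s2) f)" using assms a by blast
qed

lemma encodesD:
  "encodes T F \<Longrightarrow> w \<noteq> [] \<Longrightarrow> lin f = [1..<Suc (length w)] \<Longrightarrow> assignments (length w) s1 s2 \<Longrightarrow>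
    F (w, edges f) s1 s2 = T (map_nest (letter w s1 s2) f)"
  unfolding encodes_def by blast

section \<open>Variable updates and quantifiers as operations on marked trees\<close>

definition mark1 :: "nat \<Rightarrow> 'a letter \<times> bool \<Rightarrow> 'a letter" where
  "mark1 x c = (fst (fst c), if snd c then insert x (fst (snd (fst c))) else fst (snd (fst c)) - {x}, snd (snd (fst c)))"

definition mark2 :: "nat \<Rightarrow> 'a letter \<times> bool \<Rightarrow> 'a letter" where
  "mark2 X c = (fst (fst c), fst (snd (fst c)), if snd c then insert X (snd (snd (fst c))) else snd (snd (fst c)) - {X})"

text \<open>Reassigning \<open>x\<close> has to erase the mark of its old value as well as set the
  new one; this is why \<open>mark1\<close> removes \<open>x\<close> from the unmarked
  positions.\<close>

lemma encodes_upd1: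
  assumes "encodes T F" "w \<noteq> []" "lin f = [1..<Suc (length w)]" "assignments (length w) s1 s2" "i \<in> {1..length w}"
  shows "F (w, edges f) (s1(x := i)) s2 =
    T (map_nest (mark1 x) (map_nest (\<lambda>j. (letter w s1 s2 j, j = i)) f))"
proof -
  have "assignments (length w) (s1(x := i)) s2" using assms(4,5) by (simp add: assignments_def)
  moreover have "letter w (s1(x := i)) s2 = (\<lambda>j. mark1 x (letter w s1 s2 j, j = i))"
    by (auto simp: letter_def mark1_def)
  ultimately show ?thesis
    using encodesD[OF assms(1-3)] by (simp add: nest.map_comp o_def)
qed

lemma encodes_upd2:
  assumes "encodes T F" "w \<noteq> []" "lin f = [1..<Suc (length w)]" "assignments (length w) s1 s2" "P \<subseteq> {1..length w}"
  shows "F (w, edges f) s1 (s2(X := P)) =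
    T (map_nest (mark2 X) (map_nest (\<lambda>j. (letter w s1 s2 j, j \<in> P)) f))"
proof -
  have "assignments (length w) s1 (s2(X := P))" using assms(4,5) by (simp add: assignments_def)
  moreover have "letter w s1 (s2(X := P)) = (\<lambda>j. mark2 X (letter w s1 s2 j, j \<in> P))"
    by (auto simp: letter_def mark2_def)
  ultimately show ?thesis
    using encodesD[OF assms(1-3)] by (simp add: nest.map_comp o_def)
qed

lemma encodes_sum1:
  fixes T :: "'a letter nest \<Rightarrow> 'k::comm_semiring_1"
  assumes "encodes T F"
  shows "encodes (\<lambda>f. \<Sum>v\<in>labs UNIV f. of_bool (one_mark v) * T (map_nest (mark1 x) v))
    (\<lambda>nw s1 s2. \<Sum>i\<in>{1..length (fst nw)}. F nw (s1(x := i)) s2)"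
proof (rule encodesI)
  fix w :: "'a list" and f s1 s2
  assume a: "w \<noteq> []" "lin f = [1..<Suc (length w)]" "set_nest f = {1..length w}" "distinct (lin f)"
    "assignments (length w) s1 s2"
  have "(\<Sum>i\<in>{1..length w}. F (w, edges f) (s1(x := i)) s2) =
      (\<Sum>i\<in>set_nest f. T (map_nest (mark1 x) (map_nest (\<lambda>j. (letter w s1 s2 j, j = i)) f)))"
    using encodes_upd1[OF assms a(1,2,5)] a(3) by (intro sum.cong) auto
  also have "\<dots> = (\<Sum>v\<in>{v \<in> labs UNIV (map_nest (letter w s1 s2) f). one_mark v}. T (map_nest (mark1 x) v))"
    by (rule sum.reindex_bij_betw[OF bij_betw_one_mark[OF a(4)]])
  also have "\<dots> = (\<Sum>v\<in>labs UNIV (map_nest (letter w s1 s2) f). of_bool (one_mark v) * T (map_nest (mark1 x) v))"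
    by (rule sum.mono_neutral_cong_left) auto
  finally show "(\<Sum>i\<in>{1..length (fst (w, edges f))}. F (w, edges f) (s1(x := i)) s2) =
    (\<Sum>v\<in>labs UNIV (map_nest (letter w s1 s2) f). of_bool (one_mark v) * T (map_nest (mark1 x) v))"
    by simp
qed

text \<open>A labelling without exactly one mark has to contribute the neutral element of the
  product; the indicator factor used for sums would annihilate it.\<close>

lemma encodes_prod1:
  fixes T :: "'a letter nest \<Rightarrow> 'k::comm_semiring_1"
  assumes "encodes T F"
  shows "encodes (\<lambda>f. \<Prod>v\<in>labs UNIV f. if one_mark v then T (map_nest (mark1 x) v) else 1)
    (\<lambda>nw s1 s2. \<Prod>i\<in>{1..length (fst nw)}. F nw (s1(x := i)) s2)"
proof (rule encodesI)
  fix w :: "'a list" and f s1 s2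
  assume a: "w \<noteq> []" "lin f = [1..<Suc (length w)]" "set_nest f = {1..length w}" "distinct (lin f)"
    "assignments (length w) s1 s2"
  have "(\<Prod>i\<in>{1..length w}. F (w, edges f) (s1(x := i)) s2) =
      (\<Prod>i\<in>set_nest f. T (map_nest (mark1 x) (map_nest (\<lambda>j. (letter w s1 s2 j, j = i)) f)))"
    using encodes_upd1[OF assms a(1,2,5)] a(3) by (intro prod.cong) auto
  also have "\<dots> = (\<Prod>v\<in>{v \<in> labs UNIV (map_nest (letter w s1 s2) f). one_mark v}. T (map_nest (mark1 x) v))"
    by (rule prod.reindex_bij_betw[OF bij_betw_one_mark[OF a(4)]])
  also have "\<dots> = (\<Prod>v\<in>labs UNIV (map_nest (letter w s1 s2) f). if one_mark v then T (map_nest (mark1 x) v) else 1)"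
    by (rule prod.mono_neutral_cong_left) auto
  finally show "(\<Prod>i\<in>{1..length (fst (w, edges f))}. F (w, edges f) (s1(x := i)) s2) =
    (\<Prod>v\<in>labs UNIV (map_nest (letter w s1 s2) f). if one_mark v then T (map_nest (mark1 x) v) else 1)"
    by simp
qed

lemma encodes_ex1:
  assumes "encodes T F"
  shows "encodes (\<lambda>f. \<exists>v\<in>labs UNIV f. one_mark v \<and> T (map_nest (mark1 x) v))
    (\<lambda>nw s1 s2. \<exists>i\<in>{1..length (fst nw)}. F nw (s1(x := i)) s2)"
proof (rule encodesI)
  fix w :: "'a list" and f s1 s2
  assume a: "w \<noteq> []" "lin f = [1..<Suc (length w)]" "set_nest f = {1..length w}" "distinct (lin f)"
    "assignments (length w) s1 s2"
  have "(\<exists>i\<in>{1..length w}. F (w, edges f) (s1(x := i)) s2) \<longleftrightarrow>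
      (\<exists>v\<in>(\<lambda>i. map_nest (\<lambda>j. (letter w s1 s2 j, j = i)) f) ` set_nest f. T (map_nest (mark1 x) v))"
    using encodes_upd1[OF assms a(1,2,5)] a(3) by auto
  then show "(\<exists>i\<in>{1..length (fst (w, edges f))}. F (w, edges f) (s1(x := i)) s2) \<longleftrightarrow>
    (\<exists>v\<in>labs UNIV (map_nest (letter w s1 s2) f). one_mark v \<and> T (map_nest (mark1 x) v))"
    unfolding bij_betw_imp_surj_on[OF bij_betw_one_mark[OF a(4), of "letter w s1 s2"]] by auto
qed

lemma encodes_sum2:
  fixes T :: "'a letter nest \<Rightarrow> 'k::comm_semiring_1"
  assumes "encodes T F"
  shows "encodes (\<lambda>f. \<Sum>v\<in>labs UNIV f. T (map_nest (mark2 X) v))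
    (\<lambda>nw s1 s2. \<Sum>P\<in>Pow {1..length (fst nw)}. F nw s1 (s2(X := P)))"
proof (rule encodesI)
  fix w :: "'a list" and f s1 s2
  assume a: "w \<noteq> []" "lin f = [1..<Suc (length w)]" "set_nest f = {1..length w}" "distinct (lin f)"
    "assignments (length w) s1 s2"
  have "(\<Sum>P\<in>Pow {1..length w}. F (w, edges f) s1 (s2(X := P))) =
      (\<Sum>P\<in>Pow (set_nest f). T (map_nest (mark2 X) (map_nest (\<lambda>j. (letter w s1 s2 j, j \<in> P)) f)))"
    using encodes_upd2[OF assms a(1,2,5)] a(3) by (intro sum.cong) auto
  then show "(\<Sum>P\<in>Pow {1..length (fst (w, edges f))}. F (w, edges f) s1 (s2(X := P))) =
    (\<Sum>v\<in>labs UNIV (map_nest (letter w s1 s2) f). T (map_nest (mark2 X) v))"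
    using sum.reindex_bij_betw[OF bij_betw_Pow_labs[OF a(4), of "letter w s1 s2"]] by simp
qed

lemma encodes_prod2:
  fixes T :: "'a letter nest \<Rightarrow> 'k::comm_semiring_1"
  assumes "encodes T F"
  shows "encodes (\<lambda>f. \<Prod>v\<in>labs UNIV f. T (map_nest (mark2 X) v))
    (\<lambda>nw s1 s2. \<Prod>P\<in>Pow {1..length (fst nw)}. F nw s1 (s2(X := P)))"
proof (rule encodesI)
  fix w :: "'a list" and f s1 s2
  assume a: "w \<noteq> []" "lin f = [1..<Suc (length w)]" "set_nest f = {1..length w}" "distinct (lin f)"
    "assignments (length w) s1 s2"
  have "(\<Prod>P\<in>Pow {1..length w}. F (w, edges f) s1 (s2(X := P))) =
      (\<Prod>P\<in>Pow (set_nest f). T (map_nest (mark2 X) (map_nest (\<lambda>j. (letter w s1 s2 j, j \<in> P)) f)))"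
    using encodes_upd2[OF assms a(1,2,5)] a(3) by (intro prod.cong) auto
  then show "(\<Prod>P\<in>Pow {1..length (fst (w, edges f))}. F (w, edges f) s1 (s2(X := P))) =
    (\<Prod>v\<in>labs UNIV (map_nest (letter w s1 s2) f). T (map_nest (mark2 X) v))"
    using prod.reindex_bij_betw[OF bij_betw_Pow_labs[OF a(4), of "letter w s1 s2"]] by simp
qed

lemma encodes_ex2:
  assumes "encodes T F"
  shows "encodes (\<lambda>f. \<exists>v\<in>labs UNIV f. T (map_nest (mark2 X) v))
    (\<lambda>nw s1 s2. \<exists>P\<in>Pow {1..length (fst nw)}. F nw s1 (s2(X := P)))"
proof (rule encodesI)
  fix w :: "'a list" and f s1 s2
  assume a: "w \<noteq> []" "lin f = [1..<Suc (length w)]" "set_nest f = {1..length w}" "distinct (lin f)"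
    "assignments (length w) s1 s2"
  have "(\<exists>P\<in>Pow {1..length w}. F (w, edges f) s1 (s2(X := P))) \<longleftrightarrow>
      (\<exists>v\<in>(\<lambda>P. map_nest (\<lambda>j. (letter w s1 s2 j, j \<in> P)) f) ` Pow (set_nest f). T (map_nest (mark2 X) v))"
    using encodes_upd2[OF assms a(1,2,5)] a(3) by auto
  then show "(\<exists>P\<in>Pow {1..length (fst (w, edges f))}. F (w, edges f) s1 (s2(X := P))) \<longleftrightarrow>
    (\<exists>v\<in>labs UNIV (map_nest (letter w s1 s2) f). T (map_nest (mark2 X) v))"
    unfolding bij_betw_imp_surj_on[OF bij_betw_Pow_labs[OF a(4), of "letter w s1 s2"]] by simp
qed

section \<open>Recognizability of the atomic formulas\<close>

lemma recog_hd_lin: "recog (\<lambda>f. lin f \<noteq> [] \<and> P (hd (lin f)))"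
proof -
  define d where "d s c = (case s of None \<Rightarrow> Some (P c) | Some b \<Rightarrow> Some b)" for s :: "bool option" and c
  have S: "foldl d (Some b) xs = Some b" for b xs
    by (induction xs) (simp_all add: d_def)
  have "foldl d None xs = Some True \<longleftrightarrow> xs \<noteq> [] \<and> P (hd xs)" for xs
    by (cases xs) (simp_all add: S d_def[of None])
  with recog_comp[OF recog_foldl[of d None], of "\<lambda>s. s = Some True"] show ?thesis by simp
qed

lemma recog_ordered_pair:
  "recog (\<lambda>f. \<exists>j<length (lin f). \<exists>i\<le>j. P (lin f ! i) \<and> R (lin f ! j))"
proof -
  \<comment> \<open>The bits record that \<open>P\<close> has occurred and that a pair has been
    completed. The current letter counts for \<open>P\<close> as well, since \<open>i = j\<close> is
    allowed.\<close>
  define d where "d s c = (fst s \<or> P c, snd s \<or> (fst s \<or> P c) \<and> R c)" for s :: "bool \<times> bool" and c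
  have "foldl d (False, False) xs =
      (\<exists>i<length xs. P (xs ! i), \<exists>j<length xs. \<exists>i\<le>j. P (xs ! i) \<and> R (xs ! j))" for xs
  proof (induction xs rule: rev_induct)
    case (snoc c xs)
    have 1: "(\<exists>i<length (xs @ [c]). P ((xs @ [c]) ! i)) \<longleftrightarrow> (\<exists>i<length xs. P (xs ! i)) \<or> P c"
      by (simp add: nth_append less_Suc_eq conj_disj_distribR ex_disj_distrib cong: conj_cong)
    have "(\<exists>j<length (xs @ [c]). \<exists>i\<le>j. P ((xs @ [c]) ! i) \<and> R ((xs @ [c]) ! j)) \<longleftrightarrow>
        (\<exists>j<length xs. \<exists>i\<le>j. P ((xs @ [c]) ! i) \<and> R ((xs @ [c]) ! j)) \<or>
        (\<exists>i\<le>length xs. P ((xs @ [c]) ! i) \<and> R c)"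
      by (simp add: less_Suc_eq conj_disj_distribR ex_disj_distrib)
    also have "(\<exists>j<length xs. \<exists>i\<le>j. P ((xs @ [c]) ! i) \<and> R ((xs @ [c]) ! j)) \<longleftrightarrow>
        (\<exists>j<length xs. \<exists>i\<le>j. P (xs ! i) \<and> R (xs ! j))"
      by (simp add: nth_append cong: conj_cong)
    also have "(\<exists>i\<le>length xs. P ((xs @ [c]) ! i) \<and> R c) \<longleftrightarrow> ((\<exists>i<length xs. P (xs ! i)) \<or> P c) \<and> R c"
      by (simp add: nth_append le_less conj_disj_distribR ex_disj_distrib cong: conj_cong) blast
    finally show ?case using 1
      by (simp only: foldl_append foldl.simps snoc) (simp only: d_def fst_conv snd_conv)
  qed (simp add: d_def)
  with recog_comp[OF recog_foldl[of d "(False, False)"], of snd] show ?thesis by simp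
qed

text \<open>Besides whether an edge was found before, the call value retains one bit of the opening
  letter, which is all that the return has to know.\<close>

lemma recog_edge: "recog (\<lambda>f. \<exists>e\<in>edges f. P (fst e) \<and> R (snd e))"
  by (rule recogI[of "\<lambda>f. \<exists>e\<in>edges f. P (fst e) \<and> R (snd e)"
        "\<lambda>f a. (\<exists>e\<in>edges f. P (fst e) \<and> R (snd e), P a)"]) auto

section \<open>Semantics of formulas as recognizable and regular functions\<close>

definition frecog :: "('a nword \<Rightarrow> (nat \<Rightarrow> nat) \<Rightarrow> (nat \<Rightarrow> nat set) \<Rightarrow> 'v) \<Rightarrow> bool" where
  "frecog F \<longleftrightarrow> (\<exists>T. recog T \<and> encodes T F)"

definition freg :: "('a nword \<Rightarrow> (nat \<Rightarrow> nat) \<Rightarrow> (nat \<Rightarrow> nat set) \<Rightarrow> 'k::comm_semiring_1) \<Rightarrow> bool" where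
  "freg F \<longleftrightarrow> (\<exists>T. reg T \<and> encodes T F)"

lemma frecog_const: "frecog (\<lambda>_ _ _. c)"
  unfolding frecog_def by (intro exI[of _ "\<lambda>_. c"]) (simp add: recog_const encodes_def)

lemma frecog_comp:
  assumes "frecog F"
  shows "frecog (\<lambda>nw s1 s2. h (F nw s1 s2))"
proof -
  obtain T where T: "recog T" "encodes T F" using assms by (auto simp: frecog_def)
  then have "encodes (\<lambda>f. h (T f)) (\<lambda>nw s1 s2. h (F nw s1 s2))" by (simp add: encodes_def)
  then show ?thesis using recog_comp[OF T(1)] unfolding frecog_def by blast
qed

lemma frecog_comp2:
  assumes "frecog F" "frecog G"
  shows "frecog (\<lambda>nw s1 s2. h (F nw s1 s2) (G nw s1 s2))"
proof -
  obtain T U where T: "recog T" "encodes T F" and U: "recog U" "encodes U G"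
    using assms by (auto simp: frecog_def)
  then have "encodes (\<lambda>f. h (T f) (U f)) (\<lambda>nw s1 s2. h (F nw s1 s2) (G nw s1 s2))" by (simp add: encodes_def)
  then show ?thesis using recog_comp2[OF T(1) U(1)] unfolding frecog_def by blast
qed

lemma frecog_asem: "frecog (asem a :: 'a nword \<Rightarrow> _)"
proof (cases a)
  case (AEq x y)
  \<comment> \<open>Either some position carries both marks, or both variables are undefined and
    thus equal.\<close>
  define T where "T f \<longleftrightarrow> (\<exists>c\<in>set_nest f. x \<in> fst (snd c) \<and> y \<in> fst (snd c)) \<or>
    \<not> (\<exists>c\<in>set_nest f. x \<in> fst (snd c) \<or> y \<in> fst (snd c))" for f :: "'a letter nest"
  have "recog T"
    unfolding T_def[abs_def] by (rule recog_comp2[OF recog_Bex recog_Bex, of "\<lambda>p q. p \<or> \<not> q"])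
  moreover have "encodes T (asem a)"
  proof (rule encodesI)
    fix w :: "'a list" and f s1 s2
    assume f: "set_nest f = {1..length w}" "assignments (length w) s1 s2"
    have z: "s1 z \<in> {1..length w} \<longleftrightarrow> s1 z \<noteq> 0" for z
      using f(2) by (simp add: assignments_def Suc_le_eq)
    have "(\<exists>j\<in>{1..length w}. s1 x = j \<and> s1 y = j) \<longleftrightarrow> s1 x = s1 y \<and> s1 x \<noteq> 0" using z[of x] by auto
    moreover have "(\<exists>j\<in>{1..length w}. s1 x = j \<or> s1 y = j) \<longleftrightarrow> s1 x \<noteq> 0 \<or> s1 y \<noteq> 0" using z by blast
    ultimately show "asem a (w, edges f) s1 s2 = T (map_nest (letter w s1 s2) f)"
      unfolding AEq T_def nest.set_map f(1) by (auto simp: letter_def)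
  qed
  ultimately show ?thesis unfolding frecog_def by blast
next
  case (ALab b x)
  \<comment> \<open>For an undefined \<open>x\<close> the truncated difference
    \<open>s1 x - 1\<close> is \<open>0\<close>, so \<open>asem\<close> inspects the first letter of
    the word.\<close>
  define T where "T f \<longleftrightarrow> (\<exists>c\<in>set_nest f. x \<in> fst (snd c) \<and> fst c = b) \<or>
    \<not> (\<exists>c\<in>set_nest f. x \<in> fst (snd c)) \<and> (lin f \<noteq> [] \<and> fst (hd (lin f)) = b)" for f :: "'a letter nest"
  have "recog T"
    unfolding T_def[abs_def]
    by (rule recog_comp2[OF recog_Bex recog_comp2[OF recog_Bex recog_hd_lin, of "\<lambda>p q. \<not> p \<and> q"], of "(\<or>)"])
  moreover have "encodes T (asem a)"
  proof (rule encodesI)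
    fix w :: "'a list" and f s1 s2
    assume f: "w \<noteq> []" "lin f = [1..<Suc (length w)]" "set_nest f = {1..length w}" "assignments (length w) s1 s2"
    have "hd (lin f) = 1" "lin f \<noteq> []" using f(1,2) by (simp_all add: hd_upt del: upt_Suc)
    then have hd: "lin f \<noteq> [] \<and> fst (hd (map (letter w s1 s2) (lin f))) = b \<longleftrightarrow> w ! 0 = b"
      by (simp add: hd_map letter_def)
    show "asem a (w, edges f) s1 s2 = T (map_nest (letter w s1 s2) f)"
    proof (cases "s1 x = 0")
      case True
      then show ?thesis using f(3) hd by (auto simp: ALab T_def nest.set_map letter_def)
    next
      case False
      then have "s1 x \<in> set_nest f" using f(3,4) by (auto simp: assignments_def)
      then show ?thesis by (auto simp: ALab T_def nest.set_map letter_def)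
    qed
  qed
  ultimately show ?thesis unfolding frecog_def by blast
next
  case (ALe x y)
  \<comment> \<open>An undefined \<open>x\<close> has the value \<open>0\<close> and lies below
    everything, an undefined \<open>y\<close> included.\<close>
  define T where "T f \<longleftrightarrow> \<not> (\<exists>c\<in>set_nest f. x \<in> fst (snd c)) \<or>
    (\<exists>j<length (lin f). \<exists>i\<le>j. x \<in> fst (snd (lin f ! i)) \<and> y \<in> fst (snd (lin f ! j)))" for f :: "'a letter nest"
  have "recog T"
    unfolding T_def[abs_def]
    by (rule recog_comp2[OF recog_Bex recog_ordered_pair, of "\<lambda>p q. \<not> p \<or> q"])
  moreover have "encodes T (asem a)"
  proof (rule encodesI)
    fix w :: "'a list" and f s1 s2
    assume f: "lin f = [1..<Suc (length w)]" "set_nest f = {1..length w}" "assignments (length w) s1 s2"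
    have nth: "map (letter w s1 s2) (lin f) ! i = letter w s1 s2 (Suc i)" if "i < length w" for i
      using that by (simp add: f(1) nth_upt del: upt_Suc)
    have "(\<exists>j<length w. \<exists>i\<le>j. x \<in> fst (snd (map (letter w s1 s2) (lin f) ! i)) \<and>
        y \<in> fst (snd (map (letter w s1 s2) (lin f) ! j))) \<longleftrightarrow> (\<exists>j<length w. \<exists>i\<le>j. s1 x = Suc i \<and> s1 y = Suc j)"
      by (intro ex_cong1 conj_cong refl) (simp_all add: nth letter_def)
    also have "\<dots> \<longleftrightarrow> 0 < s1 x \<and> s1 x \<le> s1 y"
    proof
      assume "0 < s1 x \<and> s1 x \<le> s1 y"
      moreover have "s1 y \<le> length w" using f(3) by (simp add: assignments_def)
      ultimately have "s1 y - 1 < length w" "s1 x - 1 \<le> s1 y - 1" "s1 x = Suc (s1 x - 1)" "s1 y = Suc (s1 y - 1)"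
        by linarith+
      then show "\<exists>j<length w. \<exists>i\<le>j. s1 x = Suc i \<and> s1 y = Suc j" by blast
    qed auto
    finally have "(\<exists>j<length w. \<exists>i\<le>j. x \<in> fst (snd (map (letter w s1 s2) (lin f) ! i)) \<and>
        y \<in> fst (snd (map (letter w s1 s2) (lin f) ! j))) \<longleftrightarrow> 0 < s1 x \<and> s1 x \<le> s1 y" .
    moreover have "(\<exists>c\<in>set_nest (map_nest (letter w s1 s2) f). x \<in> fst (snd c)) \<longleftrightarrow> 0 < s1 x"
      using f(2,3) by (auto simp: nest.set_map letter_def assignments_def)
    moreover have "length (lin f) = length w" using f(1) by (simp del: upt_Suc)
    ultimately show "asem a (w, edges f) s1 s2 = T (map_nest (letter w s1 s2) f)"
      by (auto simp: ALe T_def)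
  qed
  ultimately show ?thesis unfolding frecog_def by blast
next
  case (ANu x y)
  have "encodes (\<lambda>f. \<exists>e\<in>edges f. x \<in> fst (snd (fst e)) \<and> y \<in> fst (snd (snd e))) (asem a :: 'a nword \<Rightarrow> _)"
    by (rule encodesI) (force simp: ANu edges_map_nest letter_def)
  then show ?thesis
    using recog_edge[of "\<lambda>c. x \<in> fst (snd c)" "\<lambda>c. y \<in> fst (snd c)"] unfolding frecog_def by blast
next
  case (AIn x X)
  have "encodes (\<lambda>f. \<exists>c\<in>set_nest f. x \<in> fst (snd c) \<and> X \<in> snd (snd c)) (asem a :: 'a nword \<Rightarrow> _)"
    by (rule encodesI) (force simp: AIn nest.set_map letter_def assignments_def)
  then show ?thesis using recog_Bex[of "\<lambda>c. x \<in> fst (snd c) \<and> X \<in> snd (snd c)"] unfolding frecog_def by blast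
qed

lemma frecog_csem: "frecog (csem p :: 'a nword \<Rightarrow> _)"
proof (induction p)
  case (CAtom a)
  then show ?case using frecog_asem by simp
next
  case (CNot p)
  then show ?case using frecog_comp[OF CNot, of Not] by simp
next
  case (COr p q)
  then show ?case using frecog_comp2[OF COr, of "(\<or>)"] by simp
next
  case (CEx1 x p)
  then obtain T where T: "recog T" "encodes T (csem p)" by (auto simp: frecog_def)
  have "recog (\<lambda>f. \<exists>v\<in>labs UNIV f. one_mark v \<and> T (map_nest (mark1 x) v))"
    by (intro recog_ex_labs recog_comp2[OF recog_one_mark recog_map_nest[OF T(1)], of "(\<and>)"]) simp
  then show ?case using encodes_ex1[OF T(2)] unfolding frecog_def csem.simps by blast
next
  case (CExS X p)
  then obtain T where T: "recog T" "encodes T (csem p)" by (auto simp: frecog_def)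
  have "recog (\<lambda>f. \<exists>v\<in>labs UNIV f. T (map_nest (mark2 X) v))"
    by (intro recog_ex_labs recog_map_nest[OF T(1)]) simp
  then show ?case using encodes_ex2[OF T(2)] unfolding frecog_def csem.simps by blast
qed

lemma frecog_sum1:
  fixes F :: "'a nword \<Rightarrow> _ \<Rightarrow> _ \<Rightarrow> 'k::comm_semiring_1"
  assumes "frecog F" "add_locally_finite TYPE('k)"
  shows "frecog (\<lambda>nw s1 s2. \<Sum>i\<in>{1..length (fst nw)}. F nw (s1(x := i)) s2)"
proof -
  obtain T where T: "recog T" "encodes T F" using assms(1) by (auto simp: frecog_def)
  have "recog (\<lambda>f. \<Sum>v\<in>labs UNIV f. of_bool (one_mark v) * T (map_nest (mark1 x) v))"
    by (rule recog_sum_labs[OF recog_comp2[OF recog_one_mark recog_map_nest[OF T(1)]] _ assms(2)]) simp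
  then show ?thesis using encodes_sum1[OF T(2)] unfolding frecog_def by blast
qed

lemma frecog_sum2:
  fixes F :: "'a nword \<Rightarrow> _ \<Rightarrow> _ \<Rightarrow> 'k::comm_semiring_1"
  assumes "frecog F" "add_locally_finite TYPE('k)"
  shows "frecog (\<lambda>nw s1 s2. \<Sum>P\<in>Pow {1..length (fst nw)}. F nw s1 (s2(X := P)))"
proof -
  obtain T where T: "recog T" "encodes T F" using assms(1) by (auto simp: frecog_def)
  have "recog (\<lambda>f. \<Sum>v\<in>labs UNIV f. T (map_nest (mark2 X) v))"
    by (rule recog_sum_labs[OF recog_map_nest[OF T(1)] _ assms(2)]) simp
  then show ?thesis using encodes_sum2[OF T(2)] unfolding frecog_def by blast
qed

lemma frecog_prod1:
  fixes F :: "'a nword \<Rightarrow> _ \<Rightarrow> _ \<Rightarrow> 'k::comm_semiring_1"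
  assumes "frecog F" "locally_finite TYPE('k)"
  shows "frecog (\<lambda>nw s1 s2. \<Prod>i\<in>{1..length (fst nw)}. F nw (s1(x := i)) s2)"
proof -
  obtain T where T: "recog T" "encodes T F" using assms(1) by (auto simp: frecog_def)
  have "recog (\<lambda>f. \<Prod>v\<in>labs UNIV f. if one_mark v then T (map_nest (mark1 x) v) else 1)"
    by (rule recog_prod_labs[OF recog_comp2[OF recog_one_mark recog_map_nest[OF T(1)],
        of "\<lambda>p t. if p then t else 1"] _ assms(2)]) simp
  then show ?thesis using encodes_prod1[OF T(2)] unfolding frecog_def by blast
qed

lemma frecog_prod2:
  fixes F :: "'a nword \<Rightarrow> _ \<Rightarrow> _ \<Rightarrow> 'k::comm_semiring_1"
  assumes "frecog F" "locally_finite TYPE('k)"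
  shows "frecog (\<lambda>nw s1 s2. \<Prod>P\<in>Pow {1..length (fst nw)}. F nw s1 (s2(X := P)))"
proof -
  obtain T where T: "recog T" "encodes T F" using assms(1) by (auto simp: frecog_def)
  have "recog (\<lambda>f. \<Prod>v\<in>labs UNIV f. T (map_nest (mark2 X) v))"
    by (rule recog_prod_labs[OF recog_map_nest[OF T(1)] _ assms(2)]) simp
  then show ?thesis using encodes_prod2[OF T(2)] unfolding frecog_def by blast
qed

lemma frecog_synt_unamb:
  fixes p :: "('a, 'k::comm_semiring_1) wform"
  assumes "synt_unamb p"
  shows "frecog (wsem p)"
proof -
  obtain q b where p: "p = pm b q" using assms unfolding synt_unamb_def by blast
  have "wsem p = (\<lambda>nw s1 s2. of_bool (csem q nw s1 s2 = b))" by (simp add: p wsem_pm fun_eq_iff)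
  then show ?thesis using frecog_comp[OF frecog_csem[of q], of "\<lambda>c. of_bool (c = b)"] by simp
qed

lemma frecog_aUMSO: "aUMSO p \<Longrightarrow> frecog (wsem p)"
proof (induction rule: aUMSO.induct)
  case (3 p q)
  then show ?case using frecog_comp2[of "wsem p" "wsem q" "(*)"] by simp
next
  case (4 p q)
  then show ?case using frecog_comp2[of "wsem p" "wsem q" "(+)"] by simp
qed (simp_all add: frecog_const frecog_synt_unamb)

lemma frecog_wUMSO:
  fixes p :: "('a, 'k::comm_semiring_1) wform"
  assumes lf: "add_locally_finite TYPE('k)" and "wUMSO p"
  shows "frecog (wsem p)"
  using assms(2)
proof (induction rule: wUMSO.induct)
  case (3 p q)
  then show ?case using frecog_comp2[of "wsem p" "wsem q" "(*)"] by simp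
next
  case (4 p q)
  then show ?case using frecog_comp2[of "wsem p" "wsem q" "(+)"] by simp
next
  case (5 p x)
  then show ?case using frecog_sum1[OF _ lf] by simp
next
  case (6 p X)
  then show ?case using frecog_sum2[OF _ lf] by simp
qed (simp_all add: frecog_const frecog_synt_unamb)

lemma frecog_wsem:
  fixes p :: "('a, 'k::comm_semiring_1) wform"
  assumes lf: "locally_finite TYPE('k)"
  shows "frecog (wsem p)"
proof (induction p)
  case (WAtom a)
  show ?case using frecog_comp[OF frecog_asem[of a], of of_bool] by (simp add: of_bool_def)
next
  case (WNAtom a)
  show ?case using frecog_comp[OF frecog_asem[of a], of "\<lambda>b. if b then 0 else 1"] by simp
next
  case (WOr p q)
  then show ?case using frecog_comp2[of "wsem p" "wsem q" "(+)"] by simp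
next
  case (WAnd p q)
  then show ?case using frecog_comp2[of "wsem p" "wsem q" "(*)"] by simp
next
  case (WEx1 x p)
  then show ?case using frecog_sum1[OF _ add_locally_finite_if_locally_finite[OF lf]] by simp
next
  case (WExS X p)
  then show ?case using frecog_sum2[OF _ add_locally_finite_if_locally_finite[OF lf]] by simp
next
  case (WAll1 x p)
  then show ?case using frecog_prod1[OF _ lf] by simp
next
  case (WAllS X p)
  then show ?case using frecog_prod2[OF _ lf] by simp
qed (simp add: frecog_const)

lemma freg_if_frecog: "frecog F \<Longrightarrow> freg F"
  unfolding freg_def frecog_def using reg_if_recog by blast

text \<open>Below \<open>\<forall>x\<close> regularity of the body would be too weak for
  \<open>reg_prod_positions\<close>; there the restriction on the syntax supplies a recognizable
  body through \<open>U\<close>.\<close>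

lemma freg_wsem_restr:
  fixes p :: "('a, 'k::comm_semiring_1) wform"
  assumes U: "\<And>p. U p \<Longrightarrow> frecog (wsem p :: 'a nword \<Rightarrow> _ \<Rightarrow> _ \<Rightarrow> 'k)" and "restr U p"
  shows "freg (wsem p)"
  using assms(2)
proof (induction p)
  case (WConst k)
  show ?case using freg_if_frecog[OF frecog_const] by simp
next
  case (WAtom a)
  show ?case using freg_if_frecog[OF frecog_comp[OF frecog_asem[of a], of of_bool]] by (simp add: of_bool_def)
next
  case (WNAtom a)
  show ?case
    using freg_if_frecog[OF frecog_comp[OF frecog_asem[of a], of "\<lambda>b. if b then 0 else 1"]] by simp
next
  case (WOr p q)
  then obtain T T' where "reg T" "encodes T (wsem p)" "reg T'" "encodes T' (wsem q)"
    by (auto simp: freg_def)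
  then have "reg (\<lambda>f. T f + T' f)" "encodes (\<lambda>f. T f + T' f) (wsem (WOr p q))"
    by (auto simp: encodes_def intro: reg_add)
  then show ?case unfolding freg_def by blast
next
  case (WAnd p q)
  then obtain T T' where "reg T" "encodes T (wsem p)" "reg T'" "encodes T' (wsem q)"
    by (auto simp: freg_def)
  then have "reg (\<lambda>f. T f * T' f)" "encodes (\<lambda>f. T f * T' f) (wsem (WAnd p q))"
    by (auto simp: encodes_def intro: reg_mult)
  then show ?case unfolding freg_def by blast
next
  case (WEx1 x p)
  then obtain T where T: "reg T" "encodes T (wsem p)" by (auto simp: freg_def)
  have "reg (\<lambda>v. of_bool (one_mark v) * T (map_nest (mark1 x) v))"
    by (intro reg_mult reg_if_recog[OF recog_comp[OF recog_one_mark]] reg_map_nest T(1))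
  then have "reg (\<lambda>f. \<Sum>v\<in>labs UNIV f. of_bool (one_mark v) * T (map_nest (mark1 x) v))"
    by (rule reg_sum_labs) simp
  then show ?case using encodes_sum1[OF T(2)] unfolding freg_def wsem.simps by blast
next
  case (WExS X p)
  then obtain T where T: "reg T" "encodes T (wsem p)" by (auto simp: freg_def)
  have "reg (\<lambda>f. \<Sum>v\<in>labs UNIV f. T (map_nest (mark2 X) v))"
    by (rule reg_sum_labs[OF reg_map_nest[OF T(1)]]) simp
  then show ?case using encodes_sum2[OF T(2)] unfolding freg_def wsem.simps by blast
next
  case (WAll1 x p)
  then obtain T where T: "recog T" "encodes T (wsem p)" using U by (auto simp: frecog_def)
  obtain V where V: "reg V" "\<And>(f :: nat nest) c. distinct (lin f) \<Longrightarrow>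
      V (map_nest c f) = (\<Prod>i\<in>set_nest f. T (map_nest (mark1 x) (map_nest (\<lambda>j. (c j, j = i)) f)))"
    using reg_prod_positions[OF recog_map_nest[OF T(1), of "mark1 x"]] by blast
  have "encodes V (wsem (WAll1 x p))"
  proof (rule encodesI)
    fix w :: "'a list" and f s1 s2
    assume a: "w \<noteq> []" "lin f = [1..<Suc (length w)]" "set_nest f = {1..length w}" "distinct (lin f)"
      "assignments (length w) s1 s2"
    show "wsem (WAll1 x p) (w, edges f) s1 s2 = V (map_nest (letter w s1 s2) f)"
      using encodes_upd1[OF T(2) a(1,2,5)] by (simp add: V(2)[OF a(4)] a(3))
  qed
  then show ?case using V(1) unfolding freg_def by blast
next
  case (WAllS X p)
  then obtain q b where p: "p = pm b q" unfolding restr.simps synt_unamb_def by blast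
  \<comment> \<open>The body only takes the values \<open>0\<close> and \<open>1\<close>, so the
    product over all sets is a classical universal quantifier, rewritten as a negated existential
    one.\<close>
  have "wsem (WAllS X p) = (\<lambda>nw s1 s2. of_bool (\<not> csem (CExS X (if b then CNot q else q)) nw s1 s2))"
    by (auto simp: p wsem_pm prod_of_bool fun_eq_iff)
  then show ?case
    using freg_if_frecog[OF frecog_comp[OF frecog_csem[of "CExS X (if b then CNot q else q)"],
          of "\<lambda>b. of_bool (\<not> b)"]] by simp
qed

lemma regular_if_freg:
  fixes S :: "'a nword \<Rightarrow> 'k::comm_semiring_1"
  assumes "freg F" "\<And>nw. nw \<in> NW \<Longrightarrow> S nw = F nw (\<lambda>_. 0) (\<lambda>_. {})"
  shows "regular S"
proof -
  obtain T where T: "reg T" "encodes T F" using assms(1) by (auto simp: freg_def)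
  show ?thesis
  proof (rule regular_if_reg)
    show "reg (\<lambda>f. T (map_nest (\<lambda>a. (a, {}, {})) f))" by (rule reg_map_nest[OF T(1)])
    fix w :: "'a list" and f :: "nat nest"
    assume f: "w \<noteq> []" "(w, edges f) \<in> NW" "lin f = [1..<Suc (length w)]"
    have "0 \<notin> set (lin f)" using f(3) by (simp del: upt_Suc set_lin)
    \<comment> \<open>First-order variables are undefined and set variables empty, so no position is
      marked and the encoding is a mere relabelling of the word.\<close>
    then have "map_nest (letter w (\<lambda>_. 0) (\<lambda>_. {})) f = map_nest (\<lambda>j. (w ! (j - 1), {}, {})) f"
      by (intro nest.map_cong) (auto simp: letter_def intro: gr0I)
    moreover have "assignments (length w) (\<lambda>_. 0) (\<lambda>_. {})" by (simp add: assignments_def)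
    ultimately show "S (w, edges f) = T (map_nest (\<lambda>a. (a, {}, {})) (map_nest (\<lambda>j. w ! (j - 1)) f))"
      using encodesD[OF T(2) f(1,3)] assms(2)[OF f(2)] by (simp add: nest.map_comp o_def)
  qed
qed

lemma regular_if_definable:
  fixes S :: "'a nword \<Rightarrow> 'k::comm_semiring_1"
  assumes "\<And>p :: ('a, 'k) wform. Z p \<Longrightarrow> freg (wsem p)" "definable Z S"
  shows "regular S"
  using assms regular_if_freg unfolding definable_def by blast

section \<open>From automata to formulas\<close>

fun cfree1 :: "'a cform \<Rightarrow> nat set" where
  "cfree1 (CAtom a) = avars1 a"
| "cfree1 (CNot p) = cfree1 p"
| "cfree1 (COr p q) = cfree1 p \<union> cfree1 q"
| "cfree1 (CEx1 x p) = cfree1 p - {x}"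
| "cfree1 (CExS X p) = cfree1 p"

lemma cfree1_derived [simp]:
  "cfree1 (cand p q) = cfree1 p \<union> cfree1 q" "cfree1 (call1 x p) = cfree1 p - {x}" "cfree1 (clt x y) = {x, y}"
  by (auto simp: cand_def call1_def clt_def)

lemma vars2_derived [simp]:
  "vars2 (cand p q) = vars2 p \<union> vars2 q" "vars2 (call1 x p) = vars2 p" "vars2 (clt x y) = {}"
  by (auto simp: cand_def call1_def clt_def)

lemma cntS_derived [simp]:
  "cntS (cand p q) = cntS p + cntS q" "cntS (call1 x p) = cntS p" "cntS (clt x y) = 0"
  by (auto simp: cand_def call1_def clt_def)

lemma avars1_aren1: "avars1 (aren1 x y a) \<subseteq> insert y (avars1 a - {x})"
  by (cases a) auto

lemma avars2_aren1: "avars2 (aren1 x y a) = avars2 a"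
  by (cases a) auto

lemma cfree1_ren1: "cfree1 (ren1 x y p) \<subseteq> insert y (cfree1 p - {x})"
proof (induction p)
  case (CAtom a)
  show ?case by (simp add: avars1_aren1)
qed auto

lemma vars2_ren1: "vars2 (ren1 x y p) = vars2 p"
  by (induction p) (simp_all add: avars2_aren1)

text \<open>The translation of an existential quantifier brings in one fresh variable, and the
  \<open>WAll1\<close> that introduces it binds it again.\<close>

lemma wfree1_pm: "cntS p = 0 \<Longrightarrow> wfree1 (pm b p :: ('a, 'k) wform) \<subseteq> cfree1 p"
proof (induction b p rule: pm.induct)
  case (6 x p)
  let ?y = "fresh1 x p"
  have "wfree1 (pm False (cand (clt ?y x) (ren1 x ?y p)) :: ('a, 'k) wform) \<subseteq> cfree1 (cand (clt ?y x) (ren1 x ?y p))"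
    by (rule 6) (use 6 in simp)
  also have "\<dots> \<subseteq> {?y, x} \<union> cfree1 p" using cfree1_ren1[of x ?y p] by auto
  finally have "wfree1 (pm False (cand (clt ?y x) (ren1 x ?y p)) :: ('a, 'k) wform) \<subseteq> {?y, x} \<union> cfree1 p" .
  moreover have "wfree1 (pm True p :: ('a, 'k) wform) \<subseteq> cfree1 p" using 6 by simp
  ultimately show ?case by auto
qed auto

lemma wfree2_pm: "cntS p = 0 \<Longrightarrow> wfree2 (pm b p :: ('a, 'k) wform) \<subseteq> vars2 p"
proof (induction b p rule: pm.induct)
  case (6 x p)
  let ?y = "fresh1 x p"
  have "wfree2 (pm False (cand (clt ?y x) (ren1 x ?y p)) :: ('a, 'k) wform) \<subseteq> vars2 (cand (clt ?y x) (ren1 x ?y p))"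
    by (rule 6) (use 6 in simp)
  moreover have "wfree2 (pm True p :: ('a, 'k) wform) \<subseteq> vars2 p" using 6 by simp
  ultimately show ?case by (auto simp: vars2_ren1)
qed auto

lemma no_SO_pm: "cntS p = 0 \<Longrightarrow> no_SO (pm b p)"
  by (induction b p rule: pm.induct) simp_all

lemma synt_unamb_pm: "synt_unamb (pm b p)"
  unfolding synt_unamb_def by (cases b) auto

lemma restr_pm:
  assumes "\<And>p. synt_unamb p \<Longrightarrow> U p"
  shows "restr U (pm b p)"
  by (induction b p rule: pm.induct) (simp_all add: synt_unamb_pm assms)

lemma restr_aUMSO: "aUMSO p \<Longrightarrow> restr aUMSO p"
proof (induction rule: aUMSO.induct)
  case (2 p)
  then obtain b q where "p = pm b q" unfolding synt_unamb_def by blast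
  then show ?case using restr_pm[of aUMSO, OF aUMSO.intros(2)] by simp
qed simp_all

definition wsum :: "'i list \<Rightarrow> ('i \<Rightarrow> ('a, 'k::comm_semiring_1) wform) \<Rightarrow> ('a, 'k) wform" where
  "wsum is F = foldr (\<lambda>i. WOr (F i)) is (WConst 0)"

lemma wsem_wsum:
  "distinct is \<Longrightarrow> wsem (wsum is F) nw s1 s2 = (\<Sum>i\<in>set is. wsem (F i) nw s1 s2)"
  by (induction "is") (simp_all add: wsum_def)

lemma wfree1_wsum: "wfree1 (wsum is F) = (\<Union>i\<in>set is. wfree1 (F i))"
  by (induction "is") (simp_all add: wsum_def)

lemma wfree2_wsum: "wfree2 (wsum is F) = (\<Union>i\<in>set is. wfree2 (F i))"
  by (induction "is") (simp_all add: wsum_def)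

lemma aUMSO_wsum: "(\<And>i. i \<in> set is \<Longrightarrow> aUMSO (F i)) \<Longrightarrow> aUMSO (wsum is F)"
  by (induction "is") (simp_all add: wsum_def aUMSO.intros)

lemma no_SO_wsum: "(\<And>i. i \<in> set is \<Longrightarrow> no_SO (F i)) \<Longrightarrow> no_SO (wsum is F)"
  by (induction "is") (simp_all add: wsum_def)

lemma restr_wsum: "(\<And>i. i \<in> set is \<Longrightarrow> restr U (F i)) \<Longrightarrow> restr U (wsum is F)"
  by (induction "is") (simp_all add: wsum_def)

definition wex :: "nat list \<Rightarrow> ('a, 'k) wform \<Rightarrow> ('a, 'k::comm_semiring_1) wform" where
  "wex qs p = foldr WExS qs p"

lemma wfree_wex: "wfree1 (wex qs p) = wfree1 p" "wfree2 (wex qs p) = wfree2 p - set qs"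
  by (induction qs) (auto simp: wex_def)

lemma sREMSO_wex: "sRFO p \<Longrightarrow> sREMSO (wex qs p)"
  by (induction qs) (auto simp: wex_def intro: sREMSO.intros)

text \<open>Nested sums over sets become one sum over families indexed by the variables, the form in
  which they are comparable with runs.\<close>

lemma wsem_wex:
  "distinct qs \<Longrightarrow> wsem (wex qs p) nw s1 s2 =
    (\<Sum>F\<in>PiE (set qs) (\<lambda>_. Pow {1..length (fst nw)}). wsem p nw s1 (\<lambda>X. if X \<in> set qs then F X else s2 X))"
proof (induction qs arbitrary: s2)
  case Nil
  then show ?case by (simp add: wex_def)
next
  case (Cons q qs)
  let ?B = "Pow {1..length (fst nw)}"
  let ?G = "\<lambda>F. wsem p nw s1 (\<lambda>X. if X \<in> set (q # qs) then F X else s2 X)"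
  have "(\<lambda>X. if X \<in> set qs then F X else (s2(q := P)) X) =
      (\<lambda>X. if X \<in> set (q # qs) then (F(q := P)) X else s2 X)" for F P
    using Cons.prems by (auto simp: fun_eq_iff)
  then have "wsem (wex (q # qs) p) nw s1 s2 = (\<Sum>P\<in>?B. \<Sum>F\<in>PiE (set qs) (\<lambda>_. ?B). ?G (F(q := P)))"
    using Cons by (simp add: wex_def del: fun_upd_apply)
  also have "\<dots> = (\<Sum>x\<in>?B \<times> PiE (set qs) (\<lambda>_. ?B). ?G ((snd x)(q := fst x)))"
    by (simp only: sum_Times fst_conv snd_conv)
  also have "\<dots> = (\<Sum>F\<in>PiE (set (q # qs)) (\<lambda>_. ?B). ?G F)"
  proof (rule sum.reindex_bij_betw)
    have "inj_on (\<lambda>(y, g). g(q := y)) (?B \<times> PiE (set qs) (\<lambda>_. ?B))"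
      by (rule inj_combinator) (use Cons.prems in simp)
    then show "bij_betw (\<lambda>x. (snd x)(q := fst x)) (?B \<times> PiE (set qs) (\<lambda>_. ?B)) (PiE (set (q # qs)) (\<lambda>_. ?B))"
      by (simp add: bij_betw_def PiE_insert_eq case_prod_unfold)
  qed
  finally show ?case .
qed

section \<open>Formulas that describe runs\<close>

definition cfalse :: "'a cform" where "cfalse = CNot (CAtom (AEq 0 0))"

definition cany :: "'i list \<Rightarrow> ('i \<Rightarrow> 'a cform) \<Rightarrow> 'a cform" where
  "cany is F = foldr (\<lambda>i. COr (F i)) is cfalse"

lemma csem_cany: "csem (cany is F) nw s1 s2 \<longleftrightarrow> (\<exists>i\<in>set is. csem (F i) nw s1 s2)"
  by (induction "is") (simp_all add: cany_def cfalse_def)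

text \<open>The variable \<open>0\<close> stems from \<open>cfalse\<close>;
  \<open>partition_formula\<close>, where \<open>cany\<close> is applied, binds it.\<close>

lemma cfree1_cany: "cfree1 (cany is F) = insert 0 (\<Union>i\<in>set is. cfree1 (F i))"
  by (induction "is") (auto simp: cany_def cfalse_def)

lemma vars2_cany: "vars2 (cany is F) = (\<Union>i\<in>set is. vars2 (F i))"
  by (induction "is") (auto simp: cany_def cfalse_def)

lemma cntS_cany: "(\<And>i. cntS (F i) = 0) \<Longrightarrow> cntS (cany is F) = 0"
  by (induction "is") (auto simp: cany_def cfalse_def)

text \<open>The set variable \<open>q\<close> holds the positions after which a run is in state \<open>q\<close>; the state \<open>q0\<close>
  before the first position is a parameter of the formulas.\<close>

definition partition_formula :: "nat list \<Rightarrow> 'a cform" where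
  "partition_formula qs = call1 0 (cany qs (\<lambda>q. cand (CAtom (AIn 0 q))
     (CNot (cany (removeAll q qs) (\<lambda>q'. CAtom (AIn 0 q'))))))"

text \<open>Says that \<open>p\<close> is the state before position \<open>x\<close>. Whether
  \<open>p = q0\<close> is decided while the formula is built. The variables \<open>2\<close> and
  \<open>3\<close> are auxiliary, so \<open>x\<close> must differ from them, and falsity is
  expressed through \<open>x\<close> in order to add no free variable.\<close>

definition previous :: "nat \<Rightarrow> nat \<Rightarrow> nat \<Rightarrow> 'a cform" where
  "previous q0 p x = COr (if p = q0 then call1 2 (CAtom (ALe x 2)) else CNot (CAtom (AEq x x)))
     (CEx1 2 (cand (cand (clt 2 x) (CNot (CEx1 3 (cand (clt 2 3) (clt 3 x))))) (CAtom (AIn 2 p))))"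

definition is_call :: "'a cform" where "is_call = CEx1 1 (CAtom (ANu 0 1))"

definition is_return :: "'a cform" where "is_return = CEx1 1 (CAtom (ANu 1 0))"

definition is_return_from :: "nat \<Rightarrow> nat \<Rightarrow> 'a cform" where
  "is_return_from q0 p = CEx1 1 (cand (CAtom (ANu 1 0)) (previous q0 p 1))"

definition is_transition :: "nat \<Rightarrow> nat \<Rightarrow> 'a \<Rightarrow> nat \<Rightarrow> 'a cform" where
  "is_transition q0 p a q = cand (previous q0 p 0) (cand (CAtom (ALab a 0)) (CAtom (AIn 0 q)))"

definition last_state :: "nat \<Rightarrow> 'a cform" where
  "last_state q = CEx1 0 (cand (call1 1 (CAtom (ALe 1 0))) (CAtom (AIn 0 q)))"

text \<open>A step function: exactly one triple \<open>(p, a, q)\<close> is realized at a position,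
  and the sum selects its weight. Since the sums are finite disjunctions, the formula stays within
  \<open>aUMSO\<close>. The guard \<open>CNot is_call\<close> in the return case reproduces the
  order of the tests in \<open>step_wt\<close>.\<close>

definition step_formula :: "('a, 'k::comm_semiring_1) wnwa \<Rightarrow> nat list \<Rightarrow> 'a list \<Rightarrow> nat \<Rightarrow> ('a, 'k) wform" where
  "step_formula A qs as q0 = wsum qs (\<lambda>p. wsum as (\<lambda>a. wsum qs (\<lambda>q. WAnd (plusF (is_transition q0 p a q))
     (WOr (WAnd (plusF is_call) (WConst (dcall A p a q)))
       (WOr (WAnd (plusF (cand (CNot is_call) (CNot is_return))) (WConst (dint A p a q)))
         (wsum qs (\<lambda>p'. WAnd (plusF (cand (CNot is_call) (is_return_from q0 p')))
           (WConst (dret A p p' a q)))))))))"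

text \<open>The sum over \<open>q0\<close> stands outside \<open>WAll1\<close> because all factors
  of the product must refer to the same first state.\<close>

definition run_formula :: "('a, 'k::comm_semiring_1) wnwa \<Rightarrow> nat list \<Rightarrow> 'a list \<Rightarrow> ('a, 'k) wform" where
  "run_formula A qs as = WAnd (plusF (partition_formula qs)) (wsum qs (\<lambda>q0. WAnd (WConst (init A q0))
     (WAnd (WAll1 0 (step_formula A qs as q0))
       (wsum qs (\<lambda>q. WAnd (plusF (last_state q)) (WConst (fin A q)))))))"

lemmas state_formula_defs = partition_formula_def previous_def is_call_def is_return_def
  is_return_from_def is_transition_def last_state_def

lemma cntS_state_formulas [simp]:
  "cntS (partition_formula qs) = 0" "cntS (previous q0 p x) = 0" "cntS is_call = 0" "cntS is_return = 0"
  "cntS (is_return_from q0 p) = 0" "cntS (is_transition q0 p a q) = 0" "cntS (last_state q) = 0"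
  by (simp_all add: state_formula_defs cntS_cany)

lemma cfree1_state_formulas:
  "cfree1 (partition_formula qs) \<subseteq> {}" "cfree1 (is_call :: 'a cform) \<subseteq> {0}"
  "cfree1 (is_return :: 'a cform) \<subseteq> {0}"
  "cfree1 (is_return_from q0 p) \<subseteq> {0}" "cfree1 (is_transition q0 p a q) \<subseteq> {0}" "cfree1 (last_state q) \<subseteq> {}"
  by (auto simp: state_formula_defs cfree1_cany)

lemma vars2_state_formulas:
  "vars2 (partition_formula qs) \<subseteq> set qs" "vars2 (is_call :: 'a cform) \<subseteq> V"
  "vars2 (is_return :: 'a cform) \<subseteq> V"
  "vars2 (is_return_from q0 p) \<subseteq> {p}" "vars2 (is_transition q0 p a q) \<subseteq> {p, q}" "vars2 (last_state q) \<subseteq> {q}"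
  by (auto simp: state_formula_defs vars2_cany)

lemma aUMSO_step_formula: "aUMSO (step_formula A qs as q0)"
  unfolding step_formula_def by (intro aUMSO_wsum aUMSO.intros synt_unamb_pm)

lemma sRFO_run_formula: "sRFO (run_formula A qs as)"
proof -
  have "restr aUMSO (run_formula A qs as)"
    unfolding run_formula_def
    by (simp add: aUMSO_step_formula restr_aUMSO[OF aUMSO_step_formula] restr_wsum
        restr_pm[of aUMSO, OF aUMSO.intros(2)])
  moreover have "no_SO (step_formula A qs as q0)" for q0
    unfolding step_formula_def by (intro no_SO_wsum) (simp add: no_SO_pm no_SO_wsum)
  then have "no_SO (run_formula A qs as)"
    unfolding run_formula_def by (simp add: no_SO_pm no_SO_wsum)
  ultimately show ?thesis by (simp add: sRFO_def sRMSO_def)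
qed

lemma sentence_wex_run_formula: "sentence (wex qs (run_formula A qs as))"
proof -
  have 1: "wfree1 (pm True (is_transition q0 p a q)) \<subseteq> {0}" "wfree1 (pm True (is_call :: 'a cform)) \<subseteq> {0}"
    "wfree1 (pm True (cand (CNot is_call) (CNot is_return :: 'a cform))) \<subseteq> {0}"
    "wfree1 (pm True (cand (CNot is_call) (is_return_from q0 p))) \<subseteq> {0}"
    "wfree1 (pm True (last_state q)) \<subseteq> {}" "wfree1 (pm True (partition_formula qs)) \<subseteq> {}"
    for q0 p q and a :: 'a
    by (rule order_trans[OF wfree1_pm], simp, (simp only: cfree1.simps cfree1_derived)?,
        intro Un_least cfree1_state_formulas)+
  have 2: "wfree2 (pm True (is_transition q0 p a q)) \<subseteq> {p, q}" "wfree2 (pm True (is_call :: 'a cform)) \<subseteq> {}"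
    "wfree2 (pm True (cand (CNot is_call) (CNot is_return :: 'a cform))) \<subseteq> {}"
    "wfree2 (pm True (cand (CNot is_call) (is_return_from q0 p))) \<subseteq> {p}"
    "wfree2 (pm True (last_state q)) \<subseteq> {q}" "wfree2 (pm True (partition_formula qs)) \<subseteq> set qs"
    for q0 p q and a :: 'a
    by (rule order_trans[OF wfree2_pm], simp, (simp only: vars2.simps vars2_derived)?,
        intro Un_least vars2_state_formulas)+
  have "wfree1 (step_formula A qs as q0) \<subseteq> {0}" for q0
    unfolding step_formula_def wfree1_wsum wfree1.simps using 1 by blast
  then have "wfree1 (run_formula A qs as) = {}"
    unfolding run_formula_def wfree1_wsum wfree1.simps using 1 by blast
  moreover have "wfree2 (step_formula A qs as q0) \<subseteq> set qs" for q0
    unfolding step_formula_def wfree2_wsum wfree2.simps using 2 by blast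
  then have "wfree2 (run_formula A qs as) \<subseteq> set qs"
    unfolding run_formula_def wfree2_wsum wfree2.simps using 2 by blast
  ultimately show ?thesis by (simp add: sentence_def wfree_wex)
qed

section \<open>Evaluation of the run formula\<close>

lemma csem_previous:
  assumes "x \<noteq> 2" "x \<noteq> 3" "s1 x \<in> {1..length w}"
    and p: "p \<in> set qs" and s2: "\<And>q. q \<in> set qs \<Longrightarrow> s2 q = {j \<in> {1..length w}. r ! j = q}" and r0: "r ! 0 = q0"
  shows "csem (previous q0 p x) (w, \<nu>) s1 s2 \<longleftrightarrow> r ! (s1 x - 1) = p"
proof -
  have succ: "j < s1 x \<and> \<not> (\<exists>k\<in>{1..length w}. j < k \<and> k < s1 x) \<longleftrightarrow> j = s1 x - 1" if "j \<in> {1..length w}" for j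
  proof
    assume j: "j < s1 x \<and> \<not> (\<exists>k\<in>{1..length w}. j < k \<and> k < s1 x)"
    then have "\<not> Suc j < s1 x" using assms(3) that by force
    then show "j = s1 x - 1" using j by simp
  qed (use that assms(3) in auto)
  have ex: "(\<exists>j\<in>{1..length w}. (j < s1 x \<and> \<not> (\<exists>k\<in>{1..length w}. j < k \<and> k < s1 x)) \<and> j \<in> s2 p) \<longleftrightarrow>
      s1 x \<noteq> 1 \<and> r ! (s1 x - 1) = p"
  proof -
    have "(\<exists>j\<in>{1..length w}. (j < s1 x \<and> \<not> (\<exists>k\<in>{1..length w}. j < k \<and> k < s1 x)) \<and> j \<in> s2 p) \<longleftrightarrow>
        (\<exists>j\<in>{1..length w}. j = s1 x - 1 \<and> r ! j = p)"
    proof (intro bex_cong refl)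
      fix j assume j: "j \<in> {1..length w}"
      show "(j < s1 x \<and> \<not> (\<exists>k\<in>{1..length w}. j < k \<and> k < s1 x)) \<and> j \<in> s2 p \<longleftrightarrow> j = s1 x - 1 \<and> r ! j = p"
        unfolding s2[OF p] using succ[OF j] j by blast
    qed
    then show ?thesis using assms(3) by auto
  qed
  have first: "(\<forall>j\<in>{1..length w}. s1 x \<le> j) \<longleftrightarrow> s1 x = 1"
  proof
    assume "\<forall>j\<in>{1..length w}. s1 x \<le> j"
    moreover have "1 \<in> {1..length w}" using assms(3) by simp
    ultimately have "s1 x \<le> 1" by blast
    then show "s1 x = 1" using assms(3) by simp
  qed simp
  have "csem (previous q0 p x) (w, \<nu>) s1 s2 \<longleftrightarrow> (p = q0 \<and> (\<forall>j\<in>{1..length w}. s1 x \<le> j)) \<or>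
      (\<exists>j\<in>{1..length w}. (j < s1 x \<and> \<not> (\<exists>k\<in>{1..length w}. j < k \<and> k < s1 x)) \<and> j \<in> s2 p)"
    using assms(1,2) by (simp add: previous_def)
  then show ?thesis unfolding ex first using r0 by auto
qed

text \<open>When the set variables come from a run, the sum over triples reduces to one summand,
  whose three alternatives are the three cases of \<open>step_wt\<close>.\<close>

lemma wsem_step_formula:
  assumes nw: "(w, \<nu>) \<in> NW" and i: "s1 0 \<in> {1..length w}" and qs: "distinct qs" and as: "distinct as" "set as = UNIV"
    and s2: "\<And>q. q \<in> set qs \<Longrightarrow> s2 q = {j \<in> {1..length w}. r ! j = q}"
    and r: "r ! 0 = q0" "\<And>j. j \<le> length w \<Longrightarrow> r ! j \<in> set qs"
  shows "wsem (step_formula A qs as q0) (w, \<nu>) s1 s2 = step_wt A (w, \<nu>) r (s1 0)"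
proof -
  let ?i = "s1 0" and ?n = "length w"
  have nr: "nesting_rel ?n \<nu>" using nw by (simp add: NW_def)
  then have sub: "\<nu> \<subseteq> {1..?n} \<times> {1..?n}" and inj: "\<And>i i' j. (i, j) \<in> \<nu> \<Longrightarrow> (i', j) \<in> \<nu> \<Longrightarrow> i = i'"
    unfolding nesting_rel_def by blast+
  define C where "C \<longleftrightarrow> (\<exists>k. (?i, k) \<in> \<nu>)"
  define R where "R \<longleftrightarrow> (\<exists>k. (k, ?i) \<in> \<nu>)"
  have call: "csem is_call (w, \<nu>) s1 s2 \<longleftrightarrow> C" and ret: "csem is_return (w, \<nu>) s1 s2 \<longleftrightarrow> R"
    using sub by (auto simp: is_call_def is_return_def C_def R_def)
  have trans: "csem (is_transition q0 p a q) (w, \<nu>) s1 s2 \<longleftrightarrow> p = r ! (?i - 1) \<and> a = w ! (?i - 1) \<and> q = r ! ?i"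
    if "p \<in> set qs" "q \<in> set qs" for p a q
    using csem_previous[of 0 s1 w p qs s2 r q0 \<nu>] that i s2 r by (auto simp: is_transition_def)
  have from_: "csem (is_return_from q0 p) (w, \<nu>) s1 s2 \<longleftrightarrow> (\<exists>k. (k, ?i) \<in> \<nu> \<and> p = r ! (k - 1))"
    if "p \<in> set qs" for p
  proof -
    have "csem (previous q0 p 1) (w, \<nu>) (s1(1 := k)) s2 \<longleftrightarrow> r ! (k - 1) = p" if "k \<in> {1..?n}" for k
      using csem_previous[of 1 "s1(1 := k)" w p qs s2 r q0 \<nu>] \<open>p \<in> set qs\<close> that s2 r by simp
    then show ?thesis using sub by (auto simp: is_return_from_def)
  qed
  define V where "V p a q = of_bool C * dcall A p a q + (of_bool (\<not> C \<and> \<not> R) * dint A p a q +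
    (\<Sum>p'\<in>set qs. of_bool (\<not> C \<and> csem (is_return_from q0 p') (w, \<nu>) s1 s2) * dret A p p' a q))" for p a q
  have "wsem (step_formula A qs as q0) (w, \<nu>) s1 s2 =
      (\<Sum>p\<in>set qs. \<Sum>a\<in>UNIV. \<Sum>q\<in>set qs. of_bool (csem (is_transition q0 p a q) (w, \<nu>) s1 s2) * V p a q)"
    unfolding step_formula_def wsem_wsum[OF qs] wsem_wsum[OF as(1)] as(2) wsem.simps wsem_pm
      csem_cand csem.simps call ret V_def by simp
  also have "\<dots> = (\<Sum>p\<in>set qs. \<Sum>a\<in>UNIV. \<Sum>q\<in>set qs.
      of_bool (p = r ! (?i - 1) \<and> a = w ! (?i - 1) \<and> q = r ! ?i) * V p a q)"
    by (intro sum.cong refl) (simp add: trans)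
  also have "\<dots> = V (r ! (?i - 1)) (w ! (?i - 1)) (r ! ?i)"
  proof -
    have fa: "finite (UNIV :: 'a set)" using as(2) by (metis finite_set)
    have "?i - 1 \<le> ?n" "?i \<le> ?n" using i by auto
    then have m: "r ! (?i - 1) \<in> set qs" "r ! ?i \<in> set qs" using r(2) by blast+
    let ?B = "\<lambda>p a q. of_bool (p = r ! (?i - 1) \<and> a = w ! (?i - 1) \<and> q = r ! ?i) * V p a q"
    have "(\<Sum>p\<in>set qs. \<Sum>a\<in>UNIV. \<Sum>q\<in>set qs. ?B p a q) = (\<Sum>a\<in>UNIV. \<Sum>q\<in>set qs. ?B (r ! (?i - 1)) a q)"
      by (rule sum_eq_single[OF _ m(1)]) auto
    also have "\<dots> = (\<Sum>q\<in>set qs. ?B (r ! (?i - 1)) (w ! (?i - 1)) q)"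
      by (rule sum_eq_single[OF fa UNIV_I]) auto
    also have "\<dots> = ?B (r ! (?i - 1)) (w ! (?i - 1)) (r ! ?i)"
      by (rule sum_eq_single[OF _ m(2)]) auto
    finally show ?thesis by simp
  qed
  also have "\<dots> = step_wt A (w, \<nu>) r ?i"
  proof -
    consider (c) C | (i) "\<not> C" "\<not> R" | (r) "\<not> C" R by blast
    then show ?thesis
    proof cases
      case c
      then show ?thesis by (simp add: V_def step_wt_def C_def[symmetric])
    next
      case i
      then have "\<not> csem (is_return_from q0 p) (w, \<nu>) s1 s2" if "p \<in> set qs" for p
        using from_[OF that] by (auto simp: R_def)
      then show ?thesis using i by (simp add: V_def step_wt_def C_def[symmetric] R_def[symmetric])
    next
      case r
      then obtain k where k: "(k, ?i) \<in> \<nu>" by (auto simp: R_def)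
      then have "(THE k. (k, ?i) \<in> \<nu>) = k" using inj by blast
      then have st: "step_wt A (w, \<nu>) r ?i = dret A (r ! (?i - 1)) (r ! (k - 1)) (w ! (?i - 1)) (r ! ?i)"
        using r by (simp add: step_wt_def C_def[symmetric] R_def[symmetric])
      have "k \<in> {1..?n}" using k sub by blast
      then have "k - 1 \<le> ?n" by (meson atLeastAtMost_iff diff_le_self le_trans)
      then have kq: "r ! (k - 1) \<in> set qs" using assms(8) by blast
      \<comment> \<open>Only one position is matched with \<open>?i\<close>, so the state before the
        call is determined and the sum over candidate states has a single nonzero
        coefficient.\<close>
      have "csem (is_return_from q0 p) (w, \<nu>) s1 s2 \<longleftrightarrow> p = r ! (k - 1)" if "p \<in> set qs" for p
        using from_[OF that] k inj by blast
      then have "V (r ! (?i - 1)) (w ! (?i - 1)) (r ! ?i) =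
        (\<Sum>p\<in>set qs. of_bool (p = r ! (k - 1)) * dret A (r ! (?i - 1)) p (w ! (?i - 1)) (r ! ?i))"
        using r by (simp add: V_def)
      also have "\<dots> = step_wt A (w, \<nu>) r ?i"
        by (subst sum_eq_single[OF _ kq]) (auto simp: st)
      finally show ?thesis .
    qed
  qed
  finally show ?thesis .
qed

lemma csem_partition_formula:
  "csem (partition_formula qs) (w, \<nu>) s1 s2 \<longleftrightarrow> (\<forall>j\<in>{1..length w}. \<exists>!q. q \<in> set qs \<and> j \<in> s2 q)"
  unfolding partition_formula_def csem_call1 fst_conv
  by (intro ball_cong refl) (auto simp: csem_cany)

lemma csem_last_state:
  assumes "w \<noteq> []" "q \<in> set qs" "\<And>q. q \<in> set qs \<Longrightarrow> s2 q = {j \<in> {1..length w}. r ! j = q}"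
  shows "csem (last_state q) (w, \<nu>) s1 s2 \<longleftrightarrow> q = r ! length w"
proof -
  have "1 \<le> length w" using assms(1) by (cases w) auto
  then have n: "length w \<in> {1..length w}" by simp
  have "csem (last_state q) (w, \<nu>) s1 s2 \<longleftrightarrow>
      (\<exists>i\<in>{1..length w}. (\<forall>k\<in>{1..length w}. k \<le> i) \<and> i \<in> s2 q)"
    by (simp add: last_state_def)
  also have "\<dots> \<longleftrightarrow> length w \<in> s2 q"
  proof
    assume "\<exists>i\<in>{1..length w}. (\<forall>k\<in>{1..length w}. k \<le> i) \<and> i \<in> s2 q"
    then obtain i where i: "i \<in> {1..length w}" "\<forall>k\<in>{1..length w}. k \<le> i" "i \<in> s2 q" by blast
    then have "length w \<le> i" "i \<le> length w" using n by auto
    then show "length w \<in> s2 q" using i(3) by simp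
  next
    assume "length w \<in> s2 q"
    then show "\<exists>i\<in>{1..length w}. (\<forall>k\<in>{1..length w}. k \<le> i) \<and> i \<in> s2 q"
      using n by (intro bexI[of _ "length w"]) auto
  qed
  also have "\<dots> \<longleftrightarrow> q = r ! length w" unfolding assms(3)[OF assms(2)] using n by blast
  finally show ?thesis .
qed

text \<open>The sets encode only the states \<open>xs\<close> after the positions. Each
  \<open>q0\<close> completes them to a run, so the value is the sum over all runs that share the
  tail \<open>xs\<close>.\<close>

lemma wsem_run_formula:
  assumes nw: "(w, \<nu>) \<in> NW" and qs: "distinct qs" and as: "distinct as" "set as = UNIV"
    and xs: "length xs = length w" "set xs \<subseteq> set qs"
    and s2: "\<And>q. q \<in> set qs \<Longrightarrow> s2 q = {j \<in> {1..length w}. xs ! (j - 1) = q}"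
  shows "wsem (run_formula A qs as) (w, \<nu>) s1 s2 = (\<Sum>q0\<in>set qs. init A q0 *
    (\<Prod>j\<in>{1..length w}. step_wt A (w, \<nu>) (q0 # xs) j) * fin A ((q0 # xs) ! length w))"
proof -
  let ?n = "length w"
  have w: "w \<noteq> []" using nw by (simp add: NW_def)
  have xsq: "xs ! (j - 1) \<in> set qs" if "j \<in> {1..?n}" for j
    using that xs by (auto intro!: subsetD[OF xs(2) nth_mem])
  have part: "csem (partition_formula qs) (w, \<nu>) s1 s2"
    unfolding csem_partition_formula using s2 xsq by (auto intro!: ex1I)
  have "wsem (WAll1 0 (step_formula A qs as q0)) (w, \<nu>) s1 s2 = (\<Prod>j\<in>{1..?n}. step_wt A (w, \<nu>) (q0 # xs) j)
      \<and> (\<Sum>q\<in>set qs. of_bool (csem (last_state q) (w, \<nu>) s1 s2) * fin A q) = fin A ((q0 # xs) ! ?n)"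
    if q0: "q0 \<in> set qs" for q0
  proof -
    have s2': "s2 q = {j \<in> {1..?n}. (q0 # xs) ! j = q}" if "q \<in> set qs" for q
      unfolding s2[OF that] by (intro Collect_cong conj_cong refl) (simp add: nth_Cons')
    have r: "(q0 # xs) ! j \<in> set qs" if "j \<le> ?n" for j
      using that q0 xsq[of j] by (cases j) auto
    have "wsem (step_formula A qs as q0) (w, \<nu>) (s1(0 := j)) s2 = step_wt A (w, \<nu>) (q0 # xs) j"
      if "j \<in> {1..?n}" for j
      using wsem_step_formula[OF nw, of "s1(0 := j)" qs as s2 "q0 # xs" q0 A] that qs as s2' r by simp
    moreover have "(\<Sum>q\<in>set qs. of_bool (csem (last_state q) (w, \<nu>) s1 s2) * fin A q) = fin A ((q0 # xs) ! ?n)"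
    proof -
      have "(\<Sum>q\<in>set qs. of_bool (csem (last_state q) (w, \<nu>) s1 s2) * fin A q) =
        (\<Sum>q\<in>set qs. of_bool (q = (q0 # xs) ! ?n) * fin A q)"
        using csem_last_state[OF w _ s2'] by (intro sum.cong refl) simp
      also have "\<dots> = fin A ((q0 # xs) ! ?n)" by (subst sum_eq_single[OF _ r[of ?n]]) auto
      finally show ?thesis .
    qed
    ultimately show ?thesis by simp
  qed
  then show ?thesis
    unfolding run_formula_def wsem.simps wsem_wsum[OF qs] wsem_pm
    by (simp add: part mult.assoc del: wsem.simps cong: sum.cong)
qed

text \<open>A word over \<open>Q\<close> and the family of its preimages determine each other. The
  classes are indexed by \<open>Q\<close> and may be empty; restricting the family to
  \<open>Q\<close> makes it extensional and thus unique.\<close>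

lemma bij_betw_words_partitions:
  "bij_betw (\<lambda>xs. \<lambda>q\<in>Q. {j \<in> {1..n}. xs ! (j - 1) = q}) {xs. length xs = n \<and> set xs \<subseteq> Q}
     {F \<in> PiE Q (\<lambda>_. Pow {1..n}). \<forall>j\<in>{1..n}. \<exists>!q. q \<in> Q \<and> j \<in> F q}"
proof (rule bij_betw_imageI)
  let ?F = "\<lambda>xs. \<lambda>q\<in>Q. {j \<in> {1..n}. xs ! (j - 1) = q}"
  show "inj_on ?F {xs. length xs = n \<and> set xs \<subseteq> Q}"
  proof (rule inj_onI)
    fix xs ys assume xs: "xs \<in> {xs. length xs = n \<and> set xs \<subseteq> Q}" and ys: "ys \<in> {xs. length xs = n \<and> set xs \<subseteq> Q}"
      and eq: "?F xs = ?F ys"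
    show "xs = ys"
    proof (rule nth_equalityI)
      fix i assume i: "i < length xs"
      have "xs ! i \<in> Q" using i xs nth_mem by blast
      have "Suc i \<in> {j \<in> {1..n}. xs ! (j - 1) = xs ! i}" using i xs by simp
      moreover from this have "{j \<in> {1..n}. xs ! (j - 1) = xs ! i} = {j \<in> {1..n}. ys ! (j - 1) = xs ! i}"
        using fun_cong[OF eq, of "xs ! i"] \<open>xs ! i \<in> Q\<close> by simp
      ultimately have "Suc i \<in> {j \<in> {1..n}. ys ! (j - 1) = xs ! i}" by blast
      then show "xs ! i = ys ! i" by simp
    qed (use xs ys in simp)
  qed
  show "?F ` {xs. length xs = n \<and> set xs \<subseteq> Q} =
    {F \<in> PiE Q (\<lambda>_. Pow {1..n}). \<forall>j\<in>{1..n}. \<exists>!q. q \<in> Q \<and> j \<in> F q}"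
  proof (intro equalityI subsetI)
    fix F assume "F \<in> ?F ` {xs. length xs = n \<and> set xs \<subseteq> Q}"
    then obtain xs where xs: "length xs = n" "set xs \<subseteq> Q" and F: "F = ?F xs" by blast
    have "\<exists>!q. q \<in> Q \<and> j \<in> F q" if j: "j \<in> {1..n}" for j
    proof -
      have "xs ! (j - 1) \<in> Q" using j xs by (auto intro!: subsetD[OF xs(2) nth_mem])
      then show ?thesis using j by (auto simp: F intro!: ex1I)
    qed
    moreover have "F \<in> PiE Q (\<lambda>_. Pow {1..n})" by (auto simp: F)
    ultimately show "F \<in> {F \<in> PiE Q (\<lambda>_. Pow {1..n}). \<forall>j\<in>{1..n}. \<exists>!q. q \<in> Q \<and> j \<in> F q}" by blast
  next
    fix F assume F: "F \<in> {F \<in> PiE Q (\<lambda>_. Pow {1..n}). \<forall>j\<in>{1..n}. \<exists>!q. q \<in> Q \<and> j \<in> F q}"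
    define l where "l j = (THE q. q \<in> Q \<and> j \<in> F q)" for j
    have l: "l j \<in> Q" "j \<in> F (l j)" "\<And>q. q \<in> Q \<Longrightarrow> j \<in> F q \<Longrightarrow> q = l j" if "j \<in> {1..n}" for j
    proof -
      have ex: "\<exists>!q. q \<in> Q \<and> j \<in> F q" using F that by blast
      from theI'[OF ex] show "l j \<in> Q" "j \<in> F (l j)" by (simp_all add: l_def)
      with ex show "q = l j" if "q \<in> Q" "j \<in> F q" for q using that by blast
    qed
    define xs where "xs = map l [1..<Suc n]"
    have nth: "xs ! (j - 1) = l j" if "j \<in> {1..n}" for j
    proof -
      have "1 \<le> j" "j \<le> n" using that by simp_all
      then show ?thesis by (cases j) (simp_all add: xs_def nth_upt del: upt_Suc)
    qed
    have "length xs = n \<and> set xs \<subseteq> Q" using l(1) by (auto simp: xs_def simp del: upt_Suc)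
    moreover have "?F xs = F"
    proof
      fix q
      show "?F xs q = F q"
      proof (cases "q \<in> Q")
        case True
        then have "F q \<subseteq> {1..n}" using F by (auto dest: PiE_mem)
        moreover have "xs ! (j - 1) = q \<longleftrightarrow> j \<in> F q" if "j \<in> {1..n}" for j
          using nth[OF that] l[OF that] True by metis
        ultimately show ?thesis using True by auto
      next
        case False
        then show ?thesis using F by (auto dest: PiE_arb)
      qed
    qed
    ultimately show "F \<in> ?F ` {xs. length xs = n \<and> set xs \<subseteq> Q}" by blast
  qed
qed

text \<open>The first state of each run is split off, and the remaining states are replaced by the
  corresponding partition of the positions.\<close>

lemma behaviour_eq_wsem:
  assumes nw: "(w, \<nu>) \<in> NW" and qs: "distinct qs" "set qs = states A" and as: "distinct as" "set as = UNIV"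
  shows "behaviour A (w, \<nu>) = wsem (wex qs (run_formula A qs as)) (w, \<nu>) s1 s2"
proof -
  let ?n = "length w" and ?Q = "set qs"
  let ?L = "{xs. length xs = length w \<and> set xs \<subseteq> set qs}"
  let ?F = "\<lambda>xs. \<lambda>q\<in>?Q. {j \<in> {1..?n}. xs ! (j - 1) = q}"
  let ?S = "\<lambda>F X. if X \<in> ?Q then F X else s2 X"
  let ?W = "\<lambda>q0 xs. init A q0 * (\<Prod>j\<in>{1..?n}. step_wt A (w, \<nu>) (q0 # xs) j) * fin A ((q0 # xs) ! ?n)"
  have "behaviour A (w, \<nu>) = (\<Sum>x\<in>?Q \<times> ?L. ?W (fst x) (snd x))"
    unfolding behaviour_def fst_conv
  proof (rule sum.reindex_bij_witness[of _ "\<lambda>x. fst x # snd x" "\<lambda>r. (hd r, tl r)"])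
    fix r assume r: "r \<in> runs A (w, \<nu>)"
    then obtain q xs where "r = q # xs" by (cases r) (auto simp: runs_def)
    then show "fst (hd r, tl r) # snd (hd r, tl r) = r" "(hd r, tl r) \<in> ?Q \<times> ?L"
      "?W (fst (hd r, tl r)) (snd (hd r, tl r)) =
        init A (r ! 0) * (\<Prod>j\<in>{1..?n}. step_wt A (w, \<nu>) r j) * fin A (r ! ?n)"
      using r qs(2) by (auto simp: runs_def)
  qed (use qs(2) in \<open>auto simp: runs_def\<close>)
  also have "\<dots> = (\<Sum>q0\<in>?Q. \<Sum>xs\<in>?L. ?W q0 xs)" by (simp only: sum_Times fst_conv snd_conv)
  also have "\<dots> = (\<Sum>xs\<in>?L. \<Sum>q0\<in>?Q. ?W q0 xs)" by (rule sum.swap)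
  also have "\<dots> = (\<Sum>xs\<in>?L. wsem (run_formula A qs as) (w, \<nu>) s1 (?S (?F xs)))"
    by (intro sum.cong refl wsem_run_formula[symmetric] nw qs(1) as) auto
  also have "\<dots> = (\<Sum>F\<in>{F \<in> PiE ?Q (\<lambda>_. Pow {1..?n}). \<forall>j\<in>{1..?n}. \<exists>!q. q \<in> ?Q \<and> j \<in> F q}.
      wsem (run_formula A qs as) (w, \<nu>) s1 (?S F))"
    by (rule sum.reindex_bij_betw[OF bij_betw_words_partitions])
  \<comment> \<open>Families that are no partitions may be added: the factor
    \<open>partition_formula\<close> gives them the value \<open>0\<close>.\<close>
  also have "\<dots> = (\<Sum>F\<in>PiE ?Q (\<lambda>_. Pow {1..?n}). wsem (run_formula A qs as) (w, \<nu>) s1 (?S F))"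
  proof (rule sum.mono_neutral_left)
    show "\<forall>F\<in>PiE ?Q (\<lambda>_. Pow {1..?n}) - {F \<in> PiE ?Q (\<lambda>_. Pow {1..?n}). \<forall>j\<in>{1..?n}. \<exists>!q. q \<in> ?Q \<and> j \<in> F q}.
      wsem (run_formula A qs as) (w, \<nu>) s1 (?S F) = 0"
    proof
      fix F assume F: "F \<in> PiE ?Q (\<lambda>_. Pow {1..?n}) - {F \<in> PiE ?Q (\<lambda>_. Pow {1..?n}). \<forall>j\<in>{1..?n}. \<exists>!q. q \<in> ?Q \<and> j \<in> F q}"
      have "(q \<in> ?Q \<and> j \<in> ?S F q) \<longleftrightarrow> (q \<in> ?Q \<and> j \<in> F q)" for q j by simp
      then have "csem (partition_formula qs) (w, \<nu>) s1 (?S F) \<longleftrightarrow> (\<forall>j\<in>{1..?n}. \<exists>!q. q \<in> ?Q \<and> j \<in> F q)"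
        unfolding csem_partition_formula by (simp only:)
      then have "\<not> csem (partition_formula qs) (w, \<nu>) s1 (?S F)" using F by blast
      then show "wsem (run_formula A qs as) (w, \<nu>) s1 (?S F) = 0"
        unfolding run_formula_def wsem.simps wsem_pm by simp
    qed
  qed (auto intro: finite_PiE)
  also have "\<dots> = wsem (wex qs (run_formula A qs as)) (w, \<nu>) s1 s2"
    by (simp add: wsem_wex[OF qs(1)])
  finally show ?thesis .
qed

lemma definable_sREMSO_if_regular:
  fixes S :: "'a::finite nword \<Rightarrow> 'k::comm_semiring_1"
  assumes "regular S"
  shows "definable (sREMSO :: ('a, 'k) wform \<Rightarrow> bool) S"
proof -
  obtain A :: "('a, 'k) wnwa" where A: "finite (states A)" "\<And>nw. nw \<in> NW \<Longrightarrow> S nw = behaviour A nw"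
    using assms unfolding regular_def by blast
  obtain qs where qs: "set qs = states A" "distinct qs" using finite_distinct_list[OF A(1)] by blast
  obtain as where as: "set as = (UNIV :: 'a set)" "distinct as" using finite_distinct_list[of "UNIV :: 'a set"] by auto
  let ?p = "wex qs (run_formula A qs as)"
  have "S nw = wsem ?p nw (\<lambda>_. 0) (\<lambda>_. {})" if "nw \<in> NW" for nw
    using A(2)[OF that] behaviour_eq_wsem[of "fst nw" "snd nw" qs A as] that qs as by simp
  moreover have "sREMSO ?p" by (rule sREMSO_wex[OF sRFO_run_formula])
  ultimately show ?thesis unfolding definable_def using sentence_wex_run_formula by blast
qed

lemma sRMSO_if_sREMSO: "sREMSO p \<Longrightarrow> sRMSO p"
  by (induction rule: sREMSO.induct) (simp_all add: sRFO_def sRMSO_def)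

lemma wUMSO_if_aUMSO: "aUMSO p \<Longrightarrow> wUMSO p"
  by (induction rule: aUMSO.induct) (simp_all add: wUMSO.intros)

lemma restr_mono: "(\<And>p. U p \<Longrightarrow> V p) \<Longrightarrow> restr U p \<Longrightarrow> restr V p"
  by (induction p) auto

lemma swRMSO_if_sRMSO: "sRMSO p \<Longrightarrow> swRMSO p"
  unfolding sRMSO_def swRMSO_def by (rule restr_mono[OF wUMSO_if_aUMSO])

lemma definable_mono: "(\<And>p. Z p \<Longrightarrow> Z' p) \<Longrightarrow> definable Z S \<Longrightarrow> definable Z' S"
  unfolding definable_def by blast

theorem theorem3p6:
  fixes S :: "'a::finite nword \<Rightarrow> 'k::comm_semiring_1"
  shows "(regular S \<longleftrightarrow> definable (sRMSO :: ('a, 'k) wform \<Rightarrow> bool) S)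
       \<and> (definable (sRMSO :: ('a, 'k) wform \<Rightarrow> bool) S
            \<longleftrightarrow> definable (sREMSO :: ('a, 'k) wform \<Rightarrow> bool) S)
       \<and> (add_locally_finite TYPE('k) \<longrightarrow>
            (regular S \<longleftrightarrow> definable (swRMSO :: ('a, 'k) wform \<Rightarrow> bool) S))
       \<and> (locally_finite TYPE('k) \<longrightarrow>
            (regular S \<longleftrightarrow> definable (MSO :: ('a, 'k) wform \<Rightarrow> bool) S))"
proof -
  \<comment> \<open>\<open>sREMSO\<close> is contained in \<open>sRMSO\<close>, this in
    \<open>swRMSO\<close>, and all of them in \<open>MSO\<close>. So one translation of automata
    into formulas serves every equivalence, and only the way back is treated for each logic by
    itself.\<close>
  have e: "definable (sREMSO :: ('a, 'k) wform \<Rightarrow> bool) S" if "regular S"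
    using definable_sREMSO_if_regular[OF that] .
  have s: "definable (sRMSO :: ('a, 'k) wform \<Rightarrow> bool) S" if "definable (sREMSO :: ('a, 'k) wform \<Rightarrow> bool) S"
    using definable_mono[OF sRMSO_if_sREMSO that] .
  have sw: "definable (swRMSO :: ('a, 'k) wform \<Rightarrow> bool) S" if "definable (sRMSO :: ('a, 'k) wform \<Rightarrow> bool) S"
    using definable_mono[OF swRMSO_if_sRMSO that] .
  have m: "definable (MSO :: ('a, 'k) wform \<Rightarrow> bool) S" if "definable (sRMSO :: ('a, 'k) wform \<Rightarrow> bool) S"
    using definable_mono[OF _ that, of MSO] by (simp add: MSO_def)
  have "freg (wsem p)" if "sRMSO p" for p :: "('a, 'k) wform"
    using frecog_aUMSO that[unfolded sRMSO_def] by (rule freg_wsem_restr)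
  then have rs: "regular S" if "definable (sRMSO :: ('a, 'k) wform \<Rightarrow> bool) S"
    using that by (rule regular_if_definable)
  have "freg (wsem p)" if "add_locally_finite TYPE('k)" "swRMSO p" for p :: "('a, 'k) wform"
    using frecog_wUMSO[OF that(1)] that(2)[unfolded swRMSO_def] by (rule freg_wsem_restr)
  then have rw: "regular S" if "add_locally_finite TYPE('k)" "definable (swRMSO :: ('a, 'k) wform \<Rightarrow> bool) S"
    using that by (blast intro: regular_if_definable)
  have rm: "regular S" if "locally_finite TYPE('k)" "definable (MSO :: ('a, 'k) wform \<Rightarrow> bool) S"
    using freg_if_frecog[OF frecog_wsem[OF that(1)]] that(2) by (rule regular_if_definable)
  show ?thesis using e s sw m rs rw rm by blast
qed

end
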